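(* Let $(\gamma,v_1,v_2):I\to H^3\times\Delta_5$ be a hyperbolic framed curve with $a^2+b^2\neq0$, $M^2>A^2$ and $MA'-M'A\equiv0$ on $I$, and let $p_0=(t_0,\theta_0)$ be a singular point of the de Sitter focal surface $\mathcal{F}^d$. (a) If $N(t_0)\neq0$: (1) $p_0$ is a cuspidal edge; (2) $p_0$ is never a swallowtail or a cuspidal cross cap. (b) If $N(t_0)=0$: (1) $p_0$ is a cuspidal edge iff $\theta_0\notin\{0,\pi\}$ and $(AN\sqrt{M^2-A^2})'(t_0)\neq0$; (2) $p_0$ is never a cuspidal beaks, cuspidal lips, swallowtail or cuspidal cross cap.
   Context: $\mathbb{R}^4_1$ denotes $\mathbb{R}^4$ with $\langle x,y\rangle=-x_0y_0+x_1y_1+x_2y_2+x_3y_3$; $H^3=\{x:\langle x,x\rangle=-1\}$, $S^3_1=\{x:\langle x,x\rangle=1\}$. For $x^1,x^2,x^3\in\mathbb{R}^4_1$, $x^1\wedge x^2\wedge x^3$ is the vector given by the formal determinant with first row $(-e_0,e_1,e_2,e_3)$ and the components of $x^1,x^2,x^3$ as remaining rows. Let $\Delta_5=\{(v_1,v_2)\in S^3_1\times S^3_1:\langle v_1,v_2\rangle=0\}$. A hyperbolic framed curve is a smooth map $(\gamma,v_1,v_2):I\to H^3\times\Delta_5$ with $\langle\gamma,v_i\rangle=\langle\gamma',v_i\rangle=0$. Put $\mu=\gamma\wedge v_1\wedge v_2$; then $\gamma'=m\mu$, $v_1'=nv_2+a\mu$, $v_2'=-nv_1+b\mu$, $\mu'=m\gamma-av_1-bv_2$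 with $m=\langle\gamma',\mu\rangle$, $n=\langle v_1',v_2\rangle$, $a=\langle v_1',\mu\rangle$, $b=\langle v_2',\mu\rangle$. Put $f=ab'-a'b+n(a^2+b^2)$. With $a^2+b^2\neq0$, the Frenet type frame is $n_1=(av_1+bv_2)/\sqrt{a^2+b^2}$, $n_2=(-bv_1+av_2)/\sqrt{a^2+b^2}$, giving $\gamma'=M\mu$, $n_1'=Nn_2+A\mu$, $n_2'=-Nn_1$, $\mu'=M\gamma-An_1$ with $M=m$, $N=f/(a^2+b^2)$, $A=\sqrt{a^2+b^2}$. De Sitter focal surface: $\mathcal{F}^d(t,\theta)=\frac{\cos\theta}{\sqrt{M^2-A^2}}(A\gamma-Mn_1)+\sin\theta\,n_2$, $(t,\theta)\in I\times[0,2\pi]$, with singular set $\{\lambda^d=0\}$, $\lambda^d=\frac{\cos\theta(MA'-AM')-\sin\theta\,AN\sqrt{M^2-A^2}}{M^2-A^2}$. Singularity types up to $\mathcal{A}$-equivalence: cuspidal edge $(u,v)\mapsto(u,v^2,v^3)$; swallowtail $(u,v)\mapsto(u,4v^3+2uv,3v^4+uv^2)$; cuspidal beaks $(u,v)\mapsto(u,2v^3-u^2v,3v^4-u^2v^2)$; cuspidal lips $(u,v)\mapsto(u,2v^3+u^2v,3v^4+u^2v^2)$; cuspidal cross cap $(u,v)\mapsto(u,v^2,uv^3)$.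
   Formalization: In (b)(1) the condition θ₀ ∉ {0, π} is corrected to θ₀ ∉ {0, π, 2π}, since θ ranges over [0, 2π] and θ₀ = 2π gives the same germ as θ₀ = 0, where the point is not a cuspidal edge. *)

theory Defs
  imports "HOL-Analysis.Analysis"
begin

fun Ck_on :: "nat \<Rightarrow> 'a::euclidean_space set \<Rightarrow> ('a \<Rightarrow> 'b::real_normed_vector) \<Rightarrow> bool" where
  "Ck_on 0 S f = continuous_on S f"
| "Ck_on (Suc k) S f =
     ((\<forall>x\<in>S. f differentiable (at x)) \<and>
      (\<forall>i\<in>Basis. Ck_on k S (\<lambda>x. frechet_derivative f (at x) i)))"

definition smooth_on :: "'a::euclidean_space set \<Rightarrow> ('a \<Rightarrow> 'b::real_normed_vector) \<Rightarrow> bool" where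
  "smooth_on S f \<longleftrightarrow> (\<forall>k. Ck_on k S f)"

definition lor :: "real^4 \<Rightarrow> real^4 \<Rightarrow> real" where
  "lor x y = - (x$0 * y$0) + x$1 * y$1 + x$2 * y$2 + x$3 * y$3"

definition S31 :: "(real^4) set" where
  "S31 = {x. lor x x = 1}"

definition det3 :: "real \<Rightarrow> real \<Rightarrow> real \<Rightarrow> real \<Rightarrow> real \<Rightarrow> real \<Rightarrow> real \<Rightarrow> real \<Rightarrow> real \<Rightarrow> real" where
  "det3 a1 a2 a3 b1 b2 b3 c1 c2 c3 =
     a1 * (b2 * c3 - b3 * c2) - a2 * (b1 * c3 - b3 * c1) + a3 * (b1 * c2 - b2 * c1)"

text \<open>Formal determinant with first row (-e0, e1, e2, e3), expanded along the first row.\<close>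
definition wedge :: "real^4 \<Rightarrow> real^4 \<Rightarrow> real^4 \<Rightarrow> real^4" where
  "wedge x y z = (\<chi> i.
     if i = 0 then - det3 (x$1) (x$2) (x$3) (y$1) (y$2) (y$3) (z$1) (z$2) (z$3)
     else if i = 1 then - det3 (x$0) (x$2) (x$3) (y$0) (y$2) (y$3) (z$0) (z$2) (z$3)
     else if i = 2 then det3 (x$0) (x$1) (x$3) (y$0) (y$1) (y$3) (z$0) (z$1) (z$3)
     else - det3 (x$0) (x$1) (x$2) (y$0) (y$1) (y$2) (z$0) (z$1) (z$2))"

definition hyp_framed_curve :: "real set \<Rightarrow> (real \<Rightarrow> real^4) \<Rightarrow> (real \<Rightarrow> real^4) \<Rightarrow> (real \<Rightarrow> real^4) \<Rightarrow> bool" where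
  "hyp_framed_curve I g v1 v2 \<longleftrightarrow>
     smooth_on I g \<and> smooth_on I v1 \<and> smooth_on I v2 \<and>
     (\<forall>t\<in>I. lor (g t) (g t) = -1 \<and> lor (v1 t) (v1 t) = 1 \<and> lor (v2 t) (v2 t) = 1 \<and>
        lor (v1 t) (v2 t) = 0 \<and> lor (g t) (v1 t) = 0 \<and> lor (g t) (v2 t) = 0 \<and>
        lor (vector_derivative g (at t)) (v1 t) = 0 \<and>
        lor (vector_derivative g (at t)) (v2 t) = 0)"

definition fc_mu :: "(real \<Rightarrow> real^4) \<Rightarrow> (real \<Rightarrow> real^4) \<Rightarrow> (real \<Rightarrow> real^4) \<Rightarrow> real \<Rightarrow> real^4" where
  "fc_mu g v1 v2 t = wedge (g t) (v1 t) (v2 t)"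

definition fc_m :: "(real \<Rightarrow> real^4) \<Rightarrow> (real \<Rightarrow> real^4) \<Rightarrow> (real \<Rightarrow> real^4) \<Rightarrow> real \<Rightarrow> real" where
  "fc_m g v1 v2 t = lor (vector_derivative g (at t)) (fc_mu g v1 v2 t)"

definition fc_n :: "(real \<Rightarrow> real^4) \<Rightarrow> (real \<Rightarrow> real^4) \<Rightarrow> (real \<Rightarrow> real^4) \<Rightarrow> real \<Rightarrow> real" where
  "fc_n g v1 v2 t = lor (vector_derivative v1 (at t)) (v2 t)"

definition fc_a :: "(real \<Rightarrow> real^4) \<Rightarrow> (real \<Rightarrow> real^4) \<Rightarrow> (real \<Rightarrow> real^4) \<Rightarrow> real \<Rightarrow> real" where
  "fc_a g v1 v2 t = lor (vector_derivative v1 (at t)) (fc_mu g v1 v2 t)"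

definition fc_b :: "(real \<Rightarrow> real^4) \<Rightarrow> (real \<Rightarrow> real^4) \<Rightarrow> (real \<Rightarrow> real^4) \<Rightarrow> real \<Rightarrow> real" where
  "fc_b g v1 v2 t = lor (vector_derivative v2 (at t)) (fc_mu g v1 v2 t)"

definition fc_f :: "(real \<Rightarrow> real^4) \<Rightarrow> (real \<Rightarrow> real^4) \<Rightarrow> (real \<Rightarrow> real^4) \<Rightarrow> real \<Rightarrow> real" where
  "fc_f g v1 v2 t =
     fc_a g v1 v2 t * deriv (fc_b g v1 v2) t - deriv (fc_a g v1 v2) t * fc_b g v1 v2 t
     + fc_n g v1 v2 t * ((fc_a g v1 v2 t)\<^sup>2 + (fc_b g v1 v2 t)\<^sup>2)"

definition fr_M :: "(real \<Rightarrow> real^4) \<Rightarrow> (real \<Rightarrow> real^4) \<Rightarrow> (real \<Rightarrow> real^4) \<Rightarrow> real \<Rightarrow> real" where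
  "fr_M g v1 v2 t = fc_m g v1 v2 t"

definition fr_N :: "(real \<Rightarrow> real^4) \<Rightarrow> (real \<Rightarrow> real^4) \<Rightarrow> (real \<Rightarrow> real^4) \<Rightarrow> real \<Rightarrow> real" where
  "fr_N g v1 v2 t = fc_f g v1 v2 t / ((fc_a g v1 v2 t)\<^sup>2 + (fc_b g v1 v2 t)\<^sup>2)"

definition fr_A :: "(real \<Rightarrow> real^4) \<Rightarrow> (real \<Rightarrow> real^4) \<Rightarrow> (real \<Rightarrow> real^4) \<Rightarrow> real \<Rightarrow> real" where
  "fr_A g v1 v2 t = sqrt ((fc_a g v1 v2 t)\<^sup>2 + (fc_b g v1 v2 t)\<^sup>2)"

definition fr_n1 :: "(real \<Rightarrow> real^4) \<Rightarrow> (real \<Rightarrow> real^4) \<Rightarrow> (real \<Rightarrow> real^4) \<Rightarrow> real \<Rightarrow> real^4" where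
  "fr_n1 g v1 v2 t = (1 / fr_A g v1 v2 t) *\<^sub>R (fc_a g v1 v2 t *\<^sub>R v1 t + fc_b g v1 v2 t *\<^sub>R v2 t)"

definition fr_n2 :: "(real \<Rightarrow> real^4) \<Rightarrow> (real \<Rightarrow> real^4) \<Rightarrow> (real \<Rightarrow> real^4) \<Rightarrow> real \<Rightarrow> real^4" where
  "fr_n2 g v1 v2 t = (1 / fr_A g v1 v2 t) *\<^sub>R (- (fc_b g v1 v2 t *\<^sub>R v1 t) + fc_a g v1 v2 t *\<^sub>R v2 t)"

definition focal_dS :: "(real \<Rightarrow> real^4) \<Rightarrow> (real \<Rightarrow> real^4) \<Rightarrow> (real \<Rightarrow> real^4) \<Rightarrow> real \<times> real \<Rightarrow> real^4" where
  "focal_dS g v1 v2 = (\<lambda>(t, th).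
     (cos th / sqrt ((fr_M g v1 v2 t)\<^sup>2 - (fr_A g v1 v2 t)\<^sup>2)) *\<^sub>R
        (fr_A g v1 v2 t *\<^sub>R g t - fr_M g v1 v2 t *\<^sub>R fr_n1 g v1 v2 t)
     + sin th *\<^sub>R fr_n2 g v1 v2 t)"

definition singular_point :: "(real \<times> real \<Rightarrow> real^4) \<Rightarrow> real \<times> real \<Rightarrow> bool" where
  "singular_point F p \<longleftrightarrow> \<not> inj (frechet_derivative F (at p))"

definition diffeo_germ2 :: "(real \<times> real \<Rightarrow> real \<times> real) \<Rightarrow> real \<times> real \<Rightarrow> bool" where
  "diffeo_germ2 phi p \<longleftrightarrow> (\<exists>V U psi. open V \<and> open U \<and> 0 \<in> V \<and> phi ` V = U \<and>
      smooth_on V phi \<and> smooth_on U psi \<and>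
      (\<forall>v\<in>V. psi (phi v) = v) \<and> (\<forall>u\<in>U. phi (psi u) = u) \<and> phi 0 = p)"

text \<open>A germ F : (R^2,p) -> S^3_1 is A-equivalent to g : (R^2,0) -> (R^3,0):
  there are a diffeomorphism germ phi of the source and a smooth chart kappa of S^3_1
  around F p (with smooth inverse parametrisation chi), with kappa o F o phi = g near 0.\<close>
definition A_equiv_S31 :: "(real \<times> real \<Rightarrow> real^4) \<Rightarrow> real \<times> real \<Rightarrow> (real \<times> real \<Rightarrow> real \<times> real \<times> real) \<Rightarrow> bool" where
  "A_equiv_S31 F p g \<longleftrightarrow>
     (\<exists>phi W W' kappa chi e.
        diffeo_germ2 phi p \<and>
        open W \<and> F p \<in> W \<and> open W' \<and> 0 \<in> W' \<and>
        smooth_on W kappa \<and> smooth_on W' chi \<and>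
        chi ` W' = W \<inter> S31 \<and>
        (\<forall>y\<in>W'. kappa (chi y) = y) \<and> (\<forall>x\<in>W \<inter> S31. chi (kappa x) = x) \<and>
        kappa (F p) = 0 \<and> e > 0 \<and>
        (\<forall>u\<in>ball 0 e. F (phi u) \<in> W \<inter> S31 \<and> kappa (F (phi u)) = g u))"

definition cuspidal_edge :: "(real \<times> real \<Rightarrow> real^4) \<Rightarrow> real \<times> real \<Rightarrow> bool" where
  "cuspidal_edge F p \<longleftrightarrow> A_equiv_S31 F p (\<lambda>(u, v). (u, v^2, v^3))"

definition swallowtail :: "(real \<times> real \<Rightarrow> real^4) \<Rightarrow> real \<times> real \<Rightarrow> bool" where
  "swallowtail F p \<longleftrightarrow> A_equiv_S31 F p (\<lambda>(u, v). (u, 4 * v^3 + 2 * u * v, 3 * v^4 + u * v^2))"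

definition cuspidal_beaks :: "(real \<times> real \<Rightarrow> real^4) \<Rightarrow> real \<times> real \<Rightarrow> bool" where
  "cuspidal_beaks F p \<longleftrightarrow> A_equiv_S31 F p (\<lambda>(u, v). (u, 2 * v^3 - u^2 * v, 3 * v^4 - u^2 * v^2))"

definition cuspidal_lips :: "(real \<times> real \<Rightarrow> real^4) \<Rightarrow> real \<times> real \<Rightarrow> bool" where
  "cuspidal_lips F p \<longleftrightarrow> A_equiv_S31 F p (\<lambda>(u, v). (u, 2 * v^3 + u^2 * v, 3 * v^4 + u^2 * v^2))"

definition cuspidal_cross_cap :: "(real \<times> real \<Rightarrow> real^4) \<Rightarrow> real \<times> real \<Rightarrow> bool" where
  "cuspidal_cross_cap F p \<longleftrightarrow> A_equiv_S31 F p (\<lambda>(u, v). (u, v^2, u * v^3))"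

end

theory Submission
  imports Defs
begin

text \<open>
  Since \<open>M / A\<close> is a constant \<open>c\<close>, rotate the frame hyperbolically to
  \<open>e = (\<gamma> - c n1) / k\<close>, \<open>w = (c \<gamma> - n1) / k\<close> with \<open>k\<^sup>2 = c\<^sup>2 - 1\<close>. With \<open>kap = N / k\<close> one gets
  \<open>F = cos \<theta> e + sin \<theta> n2\<close> and \<open>F\<^sub>t = - c kap F\<^sub>\<theta> - kap sin \<theta> w\<close>, and \<open>\<mu>\<close> is normal to \<open>F\<close> with
  \<open>\<mu>' = k A w\<close>. So the singular set is \<open>kap sin \<theta> = 0\<close>, and \<open>F\<close> is always a front.

  In the two cases where a cuspidal edge is claimed, there are source coordinates \<open>(u, v)\<close> with
  \<open>F\<^sub>v = 0\<close> on \<open>v = 0\<close>. Whitney's theorem with parameter gives \<open>F = E(u, v\<^sup>2) + v\<^sup>3 T(u, v\<^sup>2)\<close>, and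
  \<open>(x, y, z) \<mapsto> E(x, y) + z T(x, y)\<close> normalises to a parametrisation of the pseudosphere.

  Conversely, in a normal form \<open>F \<circ> \<phi> = \<chi> \<circ> g\<close> the diffeomorphism \<open>\<phi>\<close> matches singular sets and null
  directions. This excludes swallowtails, lips, beaks and the degenerate edges on \<open>sin \<theta> = 0\<close>, because
  \<open>t = t0\<close> is a singular line as soon as \<open>N(t0) = 0\<close>. In the cross cap, and in the edge with
  \<open>kap' = 0\<close>, both \<open>\<mu>\<close> and \<open>w\<close> would be orthogonal to a three-dimensional space, which contradicts
  their independence.
\<close>

section \<open>Calculus of smooth maps\<close>

text \<open>Equivalence here is literally a chart of the pseudosphere and a source diffeomorphism,
  so a cuspidal edge must be normalised by hand, and every other type must be refuted by something
  that such maps preserve. The rotated frame comes from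
  \<open>mu' = M g - A n1 = A (c g - n1) = k A w\<close>. Up to sign, the unit vector orthogonal to
  \<open>w\<close> in the plane of \<open>g\<close> and \<open>n1\<close> is
  \<open>(g - c n1) / k\<close>, which is exactly the first direction of the focal surface. In these
  terms lambda^d collapses to \<open>- kap sin th\<close>. At every point \<open>F\<close>,
  \<open>F_th\<close>, \<open>w\<close>, \<open>mu\<close> is an orthonormal frame, so all
  conditions become comparisons of coefficients. Since \<open>k A\<close> never vanishes,
  \<open>mu\<close> moves in the null direction of \<open>F\<close>; this is why \<open>F\<close> is
  a front and what the cross cap contradicts. The analytic obstacle is Whitney's theorem. A smooth
  even function is smooth in \<open>v^2\<close>, but the formal substitution of
  \<open>sqrt y\<close> loses derivatives. So the Taylor coefficients along the axis are first
  realised by a Borel sum; the remainder vanishes to infinite order, and for it the square root is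
  harmless.\<close>

lemma Ck_on_subset: "Ck_on k S f \<Longrightarrow> T \<subseteq> S \<Longrightarrow> Ck_on k T f"
  by (induction k arbitrary: f) (auto intro: continuous_on_subset)

lemma smooth_on_subset: "smooth_on S f \<Longrightarrow> T \<subseteq> S \<Longrightarrow> smooth_on T f"
  by (auto simp: smooth_on_def intro: Ck_on_subset)

text \<open>Openness turns agreement on \<open>S\<close> into agreement near each point, which is
  what derivatives \<open>at x\<close> see.\<close>

lemma Ck_on_cong:
  assumes "open S" "Ck_on k S f" "\<And>x. x \<in> S \<Longrightarrow> f x = g x"
  shows "Ck_on k S g"
  using assms(2,3)
proof (induction k arbitrary: f g)
  case 0
  then show ?case by (auto cong: continuous_on_cong)
next
  case (Suc k)
  have d: "(g has_derivative frechet_derivative f (at x)) (at x)" if "x \<in> S" for x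
    using Suc.prems that assms(1)
    by (auto intro: has_derivative_transform_within_open simp: frechet_derivative_works)
  then have "frechet_derivative f (at x) = frechet_derivative g (at x)" if "x \<in> S" for x
    using that frechet_derivative_at by blast
  with d Suc show ?case
    by (auto simp: differentiable_def)
qed

lemma smooth_on_cong:
  assumes "open S" "smooth_on S f" "\<And>x. x \<in> S \<Longrightarrow> f x = g x"
  shows "smooth_on S g"
  using assms by (auto simp: smooth_on_def intro: Ck_on_cong)

text \<open>\<open>frechet_derivative\<close> is a choice operator; this rule lets an explicit
  derivative stand in for it.\<close>

lemma Ck_on_SucI:
  assumes "open S" "\<And>x. x \<in> S \<Longrightarrow> (f has_derivative f' x) (at x)"
    "\<And>i. i \<in> Basis \<Longrightarrow> Ck_on k S (\<lambda>x. f' x i)"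
  shows "Ck_on (Suc k) S f"
proof -
  have "f' x = frechet_derivative f (at x)" if "x \<in> S" for x
    using assms(2)[OF that] frechet_derivative_at by blast
  then show ?thesis
    using assms by (auto simp: differentiable_def intro!: Ck_on_cong[OF assms(1) assms(3)])
qed

lemma Ck_on_SucD:
  assumes "Ck_on (Suc k) S f"
  shows "Ck_on k S f"
  using assms
proof (induction k arbitrary: f)
  case 0
  then show ?case
    by (auto intro!: continuous_at_imp_continuous_on differentiable_imp_continuous_within)
qed auto

lemma smooth_on_imp_Ck_on: "smooth_on S f \<Longrightarrow> Ck_on k S f"
  by (simp add: smooth_on_def)

lemma smooth_on_imp_continuous_on: "smooth_on S f \<Longrightarrow> continuous_on S f"
  using smooth_on_imp_Ck_on[of S f 0] by simp

lemma smooth_on_has_derivative: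
  "smooth_on S f \<Longrightarrow> x \<in> S \<Longrightarrow> (f has_derivative frechet_derivative f (at x)) (at x)"
  using smooth_on_imp_Ck_on[of S f 1] by (auto simp: frechet_derivative_works)

lemma smooth_on_frechet_Basis:
  "smooth_on S f \<Longrightarrow> i \<in> Basis \<Longrightarrow> smooth_on S (\<lambda>x. frechet_derivative f (at x) i)"
  unfolding smooth_on_def
proof
  fix k assume "\<forall>k. Ck_on k S f" "i \<in> Basis"
  then have "Ck_on (Suc k) S f" by blast
  with \<open>i \<in> Basis\<close> show "Ck_on k S (\<lambda>x. frechet_derivative f (at x) i)" by simp
qed

text \<open>Proof by an invariant: a class closed under partial derivatives can be differentiated
  forever. It serves for moments, root substitutions and series, whose derivatives are objects of
  the same kind with shifted parameters.\<close>

lemma smooth_on_coinduct: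
  assumes "open S" "P f"
    and step: "\<And>f. P f \<Longrightarrow> \<exists>f'. (\<forall>x\<in>S. (f has_derivative f' x) (at x)) \<and>
                 (\<forall>i\<in>Basis. P (\<lambda>x. f' x i))"
  shows "smooth_on S f"
proof -
  have "Ck_on k S f" for k
    using assms(2)
  proof (induction k arbitrary: f)
    case 0
    then obtain f' where "\<forall>x\<in>S. (f has_derivative f' x) (at x)"
      using step by blast
    then show ?case
      by (auto intro!: continuous_at_imp_continuous_on has_derivative_continuous)
  next
    case (Suc k)
    then obtain f' where "\<forall>x\<in>S. (f has_derivative f' x) (at x)"
      "\<forall>i\<in>Basis. P (\<lambda>x. f' x i)"
      using step by blast
    with Suc.IH show ?case
      by (intro Ck_on_SucI[OF assms(1)]) auto
  qed
  then show ?thesis by (simp add: smooth_on_def)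
qed

lemma Ck_on_const: "Ck_on k S (\<lambda>x. c)"
proof (induction k arbitrary: c)
  case (Suc k)
  have "frechet_derivative (\<lambda>x. c) (at x) = (\<lambda>h. 0)" for x :: 'a
    using frechet_derivative_at[OF has_derivative_const] by metis
  with Suc show ?case by auto
qed auto

lemma smooth_on_const [simp]: "smooth_on S (\<lambda>x. c)"
  by (simp add: smooth_on_def Ck_on_const)

lemma smooth_on_linear:
  assumes "bounded_linear f"
  shows "smooth_on S f"
proof -
  have d: "(f has_derivative f) (at x)" for x
    by (rule bounded_linear_imp_has_derivative[OF assms])
  then have "frechet_derivative f (at x) = f" for x
    by (metis frechet_derivative_at)
  then have "Ck_on k S f" for k
    using d assms
    by (cases k) (auto simp: Ck_on_const differentiable_def linear_continuous_on)
  then show ?thesis by (simp add: smooth_on_def)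
qed

lemma Ck_on_add:
  assumes "open S" "Ck_on k S f" "Ck_on k S g"
  shows "Ck_on k S (\<lambda>x. f x + g x)"
  using assms(2,3)
proof (induction k arbitrary: f g)
  case 0
  then show ?case by (auto intro: continuous_intros)
next
  case (Suc k)
  then show ?case
    by (intro Ck_on_SucI[OF assms(1), where f' = "\<lambda>x h. frechet_derivative f (at x) h + frechet_derivative g (at x) h"])
       (auto intro!: has_derivative_add simp: frechet_derivative_works)
qed

lemma Ck_on_sum:
  assumes "open S" "\<And>i. i \<in> A \<Longrightarrow> Ck_on k S (f i)"
  shows "Ck_on k S (\<lambda>x. \<Sum>i\<in>A. f i x)"
  using assms(2)
  by (induction A rule: infinite_finite_induct) (auto intro: Ck_on_add[OF assms(1)] Ck_on_const)

lemma Ck_on_bilinear: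
  assumes "bounded_bilinear op" "open S" "Ck_on k S f" "Ck_on k S g"
  shows "Ck_on k S (\<lambda>x. op (f x) (g x))"
  using assms(3,4)
proof (induction k arbitrary: f g)
  case 0
  then show ?case by (auto intro: bounded_bilinear.continuous_on[OF assms(1)])
next
  case (Suc k)
  have fg: "Ck_on k S f" "Ck_on k S g" using Suc.prems by (auto intro: Ck_on_SucD)
  show ?case
    using Suc.prems fg
    by (intro Ck_on_SucI[OF assms(2), where f' = "\<lambda>x h. op (f x) (frechet_derivative g (at x) h) + op (frechet_derivative f (at x) h) (g x)"])
       (auto intro!: bounded_bilinear.FDERIV[OF assms(1)] Ck_on_add[OF assms(2)] Suc.IH simp: frechet_derivative_works)
qed

lemma Ck_on_compose:
  fixes f :: "'a::euclidean_space \<Rightarrow> 'b::euclidean_space" and g :: "'b \<Rightarrow> 'c::real_normed_vector"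
  assumes "open S" "open T" "Ck_on k S f" "Ck_on k T g" "\<And>x. x \<in> S \<Longrightarrow> f x \<in> T"
  shows "Ck_on k S (\<lambda>x. g (f x))"
  using assms(3,4)
proof (induction k arbitrary: g)
  case 0
  then show ?case using assms(5) by (auto intro: continuous_on_compose2)
next
  case (Suc k)
  have f: "Ck_on k S f" using Suc.prems by (blast intro: Ck_on_SucD)
  have df: "(f has_derivative frechet_derivative f (at x)) (at x)" if "x \<in> S" for x
    using Suc.prems that by (auto simp: frechet_derivative_works)
  have dg: "(g has_derivative frechet_derivative g (at x)) (at x)" if "x \<in> T" for x
    using Suc.prems that by (auto simp: frechet_derivative_works)
  \<comment> \<open>The induction hypothesis handles functions composed with the fixed
    \<open>f\<close>, but the direction also depends on \<open>x\<close>. Expanding in the basis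
    separates the two dependences into a sum of products.\<close>
  have expand: "frechet_derivative g (at (f x)) h =
      (\<Sum>j\<in>Basis. (h \<bullet> j) *\<^sub>R frechet_derivative g (at (f x)) j)" if "x \<in> S" for x h
  proof -
    interpret bounded_linear "frechet_derivative g (at (f x))"
      using dg[OF assms(5)[OF that]] by (rule has_derivative_bounded_linear)
    have "frechet_derivative g (at (f x)) h = frechet_derivative g (at (f x)) (\<Sum>j\<in>Basis. (h \<bullet> j) *\<^sub>R j)"
      by (simp add: euclidean_representation)
    then show ?thesis by (simp add: sum scale)
  qed
  show ?case
  proof (rule Ck_on_SucI[OF assms(1), where f' = "\<lambda>x h. frechet_derivative g (at (f x)) (frechet_derivative f (at x) h)"])
    show "((\<lambda>x. g (f x)) has_derivative (\<lambda>h. frechet_derivative g (at (f x)) (frechet_derivative f (at x) h))) (at x)"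
      if "x \<in> S" for x
      using diff_chain_at[OF df[OF that] dg[OF assms(5)[OF that]]] by (simp add: o_def)
    fix i :: 'a assume i: "i \<in> Basis"
    have "Ck_on k S (\<lambda>x. \<Sum>j\<in>Basis. (frechet_derivative f (at x) i \<bullet> j) *\<^sub>R frechet_derivative g (at (f x)) j)"
    proof (intro Ck_on_sum[OF assms(1)] Ck_on_bilinear[OF bounded_bilinear_scaleR assms(1)])
      fix j :: 'b assume j: "j \<in> Basis"
      show "Ck_on k S (\<lambda>x. frechet_derivative f (at x) i \<bullet> j)"
        using i Suc.prems by (intro Ck_on_bilinear[OF bounded_bilinear_inner assms(1)] Ck_on_const) auto
      show "Ck_on k S (\<lambda>x. frechet_derivative g (at (f x)) j)"
        using Suc.prems j by (intro Suc.IH[OF f]) simp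
    qed
    then show "Ck_on k S (\<lambda>x. frechet_derivative g (at (f x)) (frechet_derivative f (at x) i))"
      by (rule Ck_on_cong[OF assms(1)]) (simp add: expand[symmetric])
  qed
qed

lemma smooth_on_compose:
  fixes f :: "'a::euclidean_space \<Rightarrow> 'b::euclidean_space" and g :: "'b \<Rightarrow> 'c::real_normed_vector"
  assumes "smooth_on T g" "smooth_on S f" "open S" "open T" "\<And>x. x \<in> S \<Longrightarrow> f x \<in> T"
  shows "smooth_on S (\<lambda>x. g (f x))"
  unfolding smooth_on_def
proof
  fix k
  show "Ck_on k S (\<lambda>x. g (f x))"
    using Ck_on_compose[OF assms(3,4) smooth_on_imp_Ck_on[OF assms(2)] smooth_on_imp_Ck_on[OF assms(1)] assms(5)]
    by blast
qed

lemma smooth_on_add: "open S \<Longrightarrow> smooth_on S f \<Longrightarrow> smooth_on S g \<Longrightarrow> smooth_on S (\<lambda>x. f x + g x)"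
  by (simp add: smooth_on_def Ck_on_add)

lemma smooth_on_sum: "open S \<Longrightarrow> (\<And>i. i \<in> A \<Longrightarrow> smooth_on S (f i)) \<Longrightarrow> smooth_on S (\<lambda>x. \<Sum>i\<in>A. f i x)"
  by (simp add: smooth_on_def Ck_on_sum)

lemma smooth_on_bilinear:
  "bounded_bilinear op \<Longrightarrow> open S \<Longrightarrow> smooth_on S f \<Longrightarrow> smooth_on S g \<Longrightarrow> smooth_on S (\<lambda>x. op (f x) (g x))"
  by (simp add: smooth_on_def Ck_on_bilinear)

lemmas smooth_on_scaleR = smooth_on_bilinear[OF bounded_bilinear_scaleR]

lemma smooth_on_mult:
  fixes f g :: "'a::euclidean_space \<Rightarrow> 'b::real_normed_algebra"
  shows "open S \<Longrightarrow> smooth_on S f \<Longrightarrow> smooth_on S g \<Longrightarrow> smooth_on S (\<lambda>x. f x * g x)"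
  by (rule smooth_on_bilinear[OF bounded_bilinear_mult])

lemma smooth_on_inner:
  "open S \<Longrightarrow> smooth_on S f \<Longrightarrow> smooth_on S g \<Longrightarrow> smooth_on S (\<lambda>x. f x \<bullet> g x)"
  by (rule smooth_on_bilinear[OF bounded_bilinear_inner])

lemma smooth_on_power:
  fixes f :: "'a::euclidean_space \<Rightarrow> 'b::real_normed_algebra_1"
  shows "open S \<Longrightarrow> smooth_on S f \<Longrightarrow> smooth_on S (\<lambda>x. f x ^ n)"
  by (induction n) (auto intro: smooth_on_mult)

lemma smooth_on_prod:
  fixes f :: "'i \<Rightarrow> 'a::euclidean_space \<Rightarrow> real"
  shows "open S \<Longrightarrow> (\<And>i. i \<in> A \<Longrightarrow> smooth_on S (f i)) \<Longrightarrow> smooth_on S (\<lambda>x. \<Prod>i\<in>A. f i x)"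
  by (induction A rule: infinite_finite_induct) (auto intro: smooth_on_mult)

lemma smooth_on_linear_compose:
  assumes "bounded_linear L" "open S" "smooth_on S f"
  shows "smooth_on S (\<lambda>x. L (f x))"
proof -
  have "Ck_on k S f \<Longrightarrow> Ck_on k S (\<lambda>x. L (f x))" for k
  proof (induction k arbitrary: f)
    case 0
    then show ?case using assms(1) by (auto intro: bounded_linear.continuous_on)
  next
    case (Suc k)
    then show ?case
      by (intro Ck_on_SucI[OF assms(2), where f' = "\<lambda>x h. L (frechet_derivative f (at x) h)"])
         (auto intro!: bounded_linear.has_derivative[OF assms(1)] simp: frechet_derivative_works)
  qed
  with assms(3) show ?thesis by (simp add: smooth_on_def)
qed

lemma smooth_on_uminus: "open S \<Longrightarrow> smooth_on S f \<Longrightarrow> smooth_on S (\<lambda>x. - f x)"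
  by (rule smooth_on_linear_compose[OF bounded_linear_minus[OF bounded_linear_ident]])

lemma smooth_on_diff: "open S \<Longrightarrow> smooth_on S f \<Longrightarrow> smooth_on S g \<Longrightarrow> smooth_on S (\<lambda>x. f x - g x)"
  using smooth_on_add[of S f "\<lambda>x. - g x"] smooth_on_uminus[of S g] by simp

lemma smooth_on_ident [simp]: "smooth_on S (\<lambda>x. x)"
  by (rule smooth_on_linear[OF bounded_linear_ident])

lemma smooth_on_fst: "open S \<Longrightarrow> smooth_on S f \<Longrightarrow> smooth_on S (\<lambda>x. fst (f x))"
  by (rule smooth_on_linear_compose[OF bounded_linear_fst])

lemma smooth_on_snd: "open S \<Longrightarrow> smooth_on S f \<Longrightarrow> smooth_on S (\<lambda>x. snd (f x))"
  by (rule smooth_on_linear_compose[OF bounded_linear_snd])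

lemma smooth_on_vec_nth: "open S \<Longrightarrow> smooth_on S f \<Longrightarrow> smooth_on S (\<lambda>x. f x $ i)"
  by (rule smooth_on_linear_compose[OF bounded_linear_vec_nth])

lemma smooth_on_Pair:
  assumes "open S" "smooth_on S f" "smooth_on S g"
  shows "smooth_on S (\<lambda>x. (f x, g x))"
proof -
  have "bounded_linear (\<lambda>a::'b. (a, 0::'c))" "bounded_linear (\<lambda>b::'c. (0::'b, b))"
    by (auto intro: bounded_linear_Pair bounded_linear_ident bounded_linear_zero)
  then have "smooth_on S (\<lambda>x. (f x, 0) + (0, g x))"
    by (intro smooth_on_add assms smooth_on_linear_compose[where L = "\<lambda>a. (a, 0)"]
          smooth_on_linear_compose[where L = "\<lambda>b. (0, b)"])
  then show ?thesis by simp
qed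

lemma smooth_on_vec_lambda:
  fixes f :: "'a::euclidean_space \<Rightarrow> 'n::finite \<Rightarrow> 'b::euclidean_space"
  assumes "open S" "\<And>i. smooth_on S (\<lambda>x. f x i)"
  shows "smooth_on S (\<lambda>x. \<chi> i. f x i)"
proof -
  have "bounded_linear (axis i :: 'b \<Rightarrow> 'b^'n)" for i
    by (intro linear_conv_bounded_linear[THEN iffD1] linearI) (auto simp: axis_def vec_eq_iff)
  then have "smooth_on S (\<lambda>x. \<Sum>i\<in>UNIV. axis i (f x i))"
    using assms by (intro smooth_on_sum smooth_on_linear_compose[where L = "axis _"]) auto
  moreover have "(\<Sum>i\<in>UNIV. axis i (f x i)) = (\<chi> i. f x i)" for x
    by (simp add: vec_eq_iff axis_def sum.delta)
  ultimately show ?thesis by simp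
qed

section \<open>Elementary functions\<close>

lemma smooth_on_sin_real: "smooth_on UNIV (sin :: real \<Rightarrow> real)"
  and smooth_on_cos_real: "smooth_on UNIV (cos :: real \<Rightarrow> real)"
proof -
  \<comment> \<open>The invariant is the span of sine and cosine, which is closed under
    differentiation.\<close>
  have "smooth_on UNIV (\<lambda>x. a * sin x + b * cos x)" for a b :: real
  proof (rule smooth_on_coinduct[where P = "\<lambda>f. \<exists>a b. f = (\<lambda>x. a * sin x + b * cos x)"])
    fix f :: "real \<Rightarrow> real" assume "\<exists>a b. f = (\<lambda>x. a * sin x + b * cos x)"
    then obtain a b where f: "f = (\<lambda>x. a * sin x + b * cos x)" by blast
    show "\<exists>f'. (\<forall>x\<in>UNIV. (f has_derivative f' x) (at x)) \<and>
        (\<forall>i\<in>Basis. \<exists>a b. (\<lambda>x. f' x i) = (\<lambda>x. a * sin x + b * cos x))"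
    proof (intro exI conjI ballI)
      show "(f has_derivative (\<lambda>h. h * (- b * sin x + a * cos x))) (at x)" for x
        unfolding f by (auto intro!: derivative_eq_intros simp: algebra_simps)
      show "(\<lambda>x. i * (- b * sin x + a * cos x)) = (\<lambda>x. (- i * b) * sin x + (i * a) * cos x)" for i
        by (simp add: algebra_simps)
    qed
  qed auto
  from this[of 1 0] this[of 0 1] show "smooth_on UNIV (sin :: real \<Rightarrow> real)"
    "smooth_on UNIV (cos :: real \<Rightarrow> real)" by simp_all
qed

lemma smooth_on_sin: "open S \<Longrightarrow> smooth_on S f \<Longrightarrow> smooth_on S (\<lambda>x. sin (f x :: real))"
  by (rule smooth_on_compose[OF smooth_on_sin_real]) auto

lemma smooth_on_cos: "open S \<Longrightarrow> smooth_on S f \<Longrightarrow> smooth_on S (\<lambda>x. cos (f x :: real))"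
  by (rule smooth_on_compose[OF smooth_on_cos_real]) auto

text \<open>The derivative is a polynomial in the function itself, so each order of
  differentiability yields the next.\<close>

lemma smooth_on_inverse_real: "smooth_on (-{0}) (inverse :: real \<Rightarrow> real)"
proof -
  have "Ck_on k (-{0}) (inverse :: real \<Rightarrow> real)" for k
  proof (induction k)
    case 0
    then show ?case by (auto intro!: continuous_intros)
  next
    case (Suc k)
    have "Ck_on k (-{0}) (\<lambda>x::real. -1 * (inverse x * inverse x))"
      using Suc by (intro Ck_on_bilinear[OF bounded_bilinear_mult] Ck_on_const) auto
    then show ?case
      by (intro Ck_on_SucI[where f' = "\<lambda>x h. - (inverse x * h * inverse x)"])
         (auto intro!: derivative_eq_intros)
  qed
  then show ?thesis by (simp add: smooth_on_def)
qed

lemma smooth_on_inverse: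
  "open S \<Longrightarrow> smooth_on S f \<Longrightarrow> (\<And>x. x \<in> S \<Longrightarrow> f x \<noteq> 0) \<Longrightarrow> smooth_on S (\<lambda>x. inverse (f x :: real))"
  by (rule smooth_on_compose[OF smooth_on_inverse_real]) auto

lemma smooth_on_divide:
  "open S \<Longrightarrow> smooth_on S f \<Longrightarrow> smooth_on S g \<Longrightarrow> (\<And>x. x \<in> S \<Longrightarrow> g x \<noteq> 0) \<Longrightarrow>
    smooth_on S (\<lambda>x. f x / g x :: real)"
  unfolding divide_inverse by (intro smooth_on_mult smooth_on_inverse)

lemma smooth_on_sqrt_real: "smooth_on {0<..} sqrt"
proof -
  have "Ck_on k {0<..} sqrt" for k
  proof (induction k)
    case 0
    then show ?case by (auto intro!: continuous_intros)
  next
    case (Suc k)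
    have "Ck_on k {0<..} (\<lambda>x::real. inverse (sqrt x) * (1/2))"
    proof (rule Ck_on_bilinear[OF bounded_bilinear_mult _ _ Ck_on_const])
      show "Ck_on k {0<..} (\<lambda>x. inverse (sqrt x))"
        by (rule Ck_on_compose[of _ "-{0}", OF _ _ Suc smooth_on_imp_Ck_on[OF smooth_on_inverse_real]]) auto
    qed simp
    then show ?case
      using DERIV_real_sqrt
      by (intro Ck_on_SucI[where f' = "\<lambda>x. (*) (inverse (sqrt x) / 2)"])
         (auto simp: has_field_derivative_def)
  qed
  then show ?thesis by (simp add: smooth_on_def)
qed

lemma smooth_on_sqrt:
  "open S \<Longrightarrow> smooth_on S f \<Longrightarrow> (\<And>x. x \<in> S \<Longrightarrow> f x > 0) \<Longrightarrow> smooth_on S (\<lambda>x. sqrt (f x))"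
  by (rule smooth_on_compose[OF smooth_on_sqrt_real]) auto

lemmas smooth_on_intros = smooth_on_const smooth_on_ident smooth_on_add smooth_on_diff
  smooth_on_uminus smooth_on_scaleR smooth_on_mult smooth_on_power smooth_on_sin smooth_on_cos
  smooth_on_fst smooth_on_snd smooth_on_vec_nth smooth_on_Pair smooth_on_divide smooth_on_sqrt
  smooth_on_sum smooth_on_prod

lemma smooth_on_frechet_apply:
  assumes "open S" "smooth_on S f" "smooth_on S h"
  shows "smooth_on S (\<lambda>x. frechet_derivative f (at x) (h x))"
proof -
  have "smooth_on S (\<lambda>x. \<Sum>j\<in>Basis. (h x \<bullet> j) *\<^sub>R frechet_derivative f (at x) j)"
    using assms by (intro smooth_on_sum smooth_on_scaleR smooth_on_inner smooth_on_frechet_Basis) auto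
  then show ?thesis
  proof (rule smooth_on_cong[OF assms(1)])
    fix x assume "x \<in> S"
    interpret bounded_linear "frechet_derivative f (at x)"
      using smooth_on_has_derivative[OF assms(2) \<open>x \<in> S\<close>] by (rule has_derivative_bounded_linear)
    have "frechet_derivative f (at x) (\<Sum>j\<in>Basis. (h x \<bullet> j) *\<^sub>R j) = (\<Sum>j\<in>Basis. (h x \<bullet> j) *\<^sub>R frechet_derivative f (at x) j)"
      by (simp add: sum scale)
    then show "(\<Sum>j\<in>Basis. (h x \<bullet> j) *\<^sub>R frechet_derivative f (at x) j) = frechet_derivative f (at x) (h x)"
      by (simp add: euclidean_representation)
  qed
qed

lemma smooth_on_vector_derivative:
  fixes f :: "real \<Rightarrow> 'a::real_normed_vector"
  assumes "open S" "smooth_on S f"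
  shows "smooth_on S (\<lambda>x. vector_derivative f (at x))"
    and "x \<in> S \<Longrightarrow> (f has_vector_derivative vector_derivative f (at x)) (at x)"
proof -
  have d: "(f has_vector_derivative frechet_derivative f (at x) 1) (at x)" if "x \<in> S" for x
  proof -
    note h = smooth_on_has_derivative[OF assms(2) that]
    interpret bounded_linear "frechet_derivative f (at x)"
      using h by (rule has_derivative_bounded_linear)
    have "frechet_derivative f (at x) = (\<lambda>h. h *\<^sub>R frechet_derivative f (at x) 1)"
      by (metis mult.right_neutral real_scaleR_def scale)
    with h show ?thesis by (simp add: has_vector_derivative_def)
  qed
  then have e: "frechet_derivative f (at x) 1 = vector_derivative f (at x)" if "x \<in> S" for x
    using that by (metis vector_derivative_at)
  show "smooth_on S (\<lambda>x. vector_derivative f (at x))"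
    by (rule smooth_on_cong[OF assms(1) smooth_on_frechet_Basis[OF assms(2)] e]) auto
  show "x \<in> S \<Longrightarrow> (f has_vector_derivative vector_derivative f (at x)) (at x)"
    using d e by metis
qed

lemma smooth_on_deriv:
  fixes f :: "real \<Rightarrow> real"
  assumes "open S" "smooth_on S f"
  shows "smooth_on S (deriv f)"
    and "x \<in> S \<Longrightarrow> (f has_real_derivative deriv f x) (at x)"
proof -
  have e: "vector_derivative f (at x) = deriv f x" if "x \<in> S" for x
    using smooth_on_vector_derivative(2)[OF assms that]
    by (metis DERIV_imp_deriv has_real_derivative_iff_has_vector_derivative)
  show "smooth_on S (deriv f)"
    by (rule smooth_on_cong[OF assms(1) smooth_on_vector_derivative(1)[OF assms] e])
  show "x \<in> S \<Longrightarrow> (f has_real_derivative deriv f x) (at x)"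
    using smooth_on_vector_derivative(2)[OF assms] e
    by (simp add: has_real_derivative_iff_has_vector_derivative)
qed

section \<open>Partial derivatives in the plane\<close>

lemma Basis_real_prod: "(Basis :: (real \<times> real) set) = {(1,0), (0,1)}"
  by (auto simp: Basis_prod_def)

lemma linear_real_prod:
  fixes L :: "real \<times> real \<Rightarrow> 'a::real_vector"
  assumes "linear L"
  shows "L (a, b) = a *\<^sub>R L (1, 0) + b *\<^sub>R L (0, 1)"
proof -
  have "L (a *\<^sub>R (1,0) + b *\<^sub>R (0,1)) = a *\<^sub>R L (1, 0) + b *\<^sub>R L (0, 1)"
    using assms by (simp only: linear_add linear_scale)
  then show ?thesis by simp
qed

abbreviation pd1 :: "(real \<times> real \<Rightarrow> 'a::real_normed_vector) \<Rightarrow> real \<times> real \<Rightarrow> 'a" where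
  "pd1 f x \<equiv> frechet_derivative f (at x) (1, 0)"
abbreviation pd2 :: "(real \<times> real \<Rightarrow> 'a::real_normed_vector) \<Rightarrow> real \<times> real \<Rightarrow> 'a" where
  "pd2 f x \<equiv> frechet_derivative f (at x) (0, 1)"

lemma smooth_on_pd:
  assumes "smooth_on S f"
  shows "smooth_on S (pd1 f)" "smooth_on S (pd2 f)"
  using assms by (auto intro: smooth_on_frechet_Basis simp: Basis_real_prod)

lemma has_derivative_pd:
  assumes "smooth_on S f" "x \<in> S"
  shows "(f has_derivative (\<lambda>h. fst h *\<^sub>R pd1 f x + snd h *\<^sub>R pd2 f x)) (at x)"
proof -
  note d = smooth_on_has_derivative[OF assms]
  have "frechet_derivative f (at x) = (\<lambda>h. fst h *\<^sub>R pd1 f x + snd h *\<^sub>R pd2 f x)"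
  proof
    fix h :: "real \<times> real"
    show "frechet_derivative f (at x) h = fst h *\<^sub>R pd1 f x + snd h *\<^sub>R pd2 f x"
      using linear_real_prod[OF has_derivative_linear[OF d], of "fst h" "snd h"] by simp
  qed
  with d show ?thesis by simp
qed

lemma smooth_on_coinduct2:
  fixes f :: "real \<times> real \<Rightarrow> 'a::real_normed_vector"
  assumes "open S" "P f"
    and step: "\<And>f. P f \<Longrightarrow> \<exists>f1 f2. P f1 \<and> P f2 \<and>
       (\<forall>x\<in>S. (f has_derivative (\<lambda>h. fst h *\<^sub>R f1 x + snd h *\<^sub>R f2 x)) (at x))"
  shows "smooth_on S f"
proof (rule smooth_on_coinduct[where P = P, OF assms(1,2)])
  fix f assume "P f"
  then obtain f1 f2 where "P f1" "P f2"
    "\<forall>x\<in>S. (f has_derivative (\<lambda>h. fst h *\<^sub>R f1 x + snd h *\<^sub>R f2 x)) (at x)"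
    using step by blast
  then show "\<exists>f'. (\<forall>x\<in>S. (f has_derivative f' x) (at x)) \<and> (\<forall>i\<in>Basis. P (\<lambda>x. f' x i))"
    by (intro exI[of _ "\<lambda>x h. fst h *\<^sub>R f1 x + snd h *\<^sub>R f2 x"]) (auto simp: Basis_real_prod)
qed

section \<open>Hadamard's lemma and flat functions\<close>

text \<open>Squares rather than balls: they are convex, stable under shrinking the second
  coordinate, and, for \<open>r\<close> at most 1, stable under
  \<open>(u, v) -> (u, v^2)\<close>.\<close>

definition sq :: "real \<Rightarrow> (real \<times> real) set" where
  "sq r = {-r<..<r} \<times> {-r<..<r}"

lemma open_sq [simp]: "open (sq r)"
  by (simp add: sq_def open_Times)

lemma convex_sq: "convex (sq r)"
  by (simp add: sq_def convex_Times)

lemma mem_sq: "x \<in> sq r \<longleftrightarrow> \<bar>fst x\<bar> < r \<and> \<bar>snd x\<bar> < r"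
  by (cases x) (auto simp: sq_def)

lemma sq_mono: "r \<le> s \<Longrightarrow> sq r \<subseteq> sq s"
  by (auto simp: mem_sq)

lemma sq_star: "x \<in> sq r \<Longrightarrow> 0 \<le> s \<Longrightarrow> s \<le> 1 \<Longrightarrow> (fst x, s * snd x) \<in> sq r"
  using mult_left_le_one_le[of "\<bar>snd x\<bar>" s] by (auto simp: mem_sq abs_mult)

text \<open>\<open>moment 0 (pd2 f)\<close> is the Hadamard quotient. The weights \<open>s^m\<close>
  close the family under differentiation: each derivative in the second variable brings out one
  factor \<open>s\<close>.\<close>

definition moment :: "nat \<Rightarrow> (real \<times> real \<Rightarrow> 'a::euclidean_space) \<Rightarrow> real \<times> real \<Rightarrow> 'a" where
  "moment m f x = integral (cbox 0 1) (\<lambda>s. s^m *\<^sub>R f (fst x, s * snd x))"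

lemma continuous_on_dilation:
  assumes "smooth_on (sq r) f"
  shows "continuous_on (sq r \<times> cbox 0 1) (\<lambda>(x, s). f (fst x, s * snd x))"
  unfolding split_beta
  by (rule continuous_on_compose2[OF smooth_on_imp_continuous_on[OF assms]])
     (auto intro!: continuous_intros sq_star simp del: mem_Sigma_iff)

lemma moment_has_derivative:
  assumes f: "smooth_on (sq r) f" and x: "x \<in> sq r"
  shows "(moment m f has_derivative
          (\<lambda>h. fst h *\<^sub>R moment m (pd1 f) x + snd h *\<^sub>R moment (Suc m) (pd2 f) x)) (at x)"
proof -
  \<comment> \<open>The derivative is packaged as a bounded linear function because the Leibniz rule
    integrates one operator-valued integrand.\<close>
  define D where "D x s = (blinfun_scaleR_left (s^m *\<^sub>R pd1 f (fst x, s * snd x)) o\<^sub>L fst_blinfun)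
      + (blinfun_scaleR_left (s^Suc m *\<^sub>R pd2 f (fst x, s * snd x)) o\<^sub>L snd_blinfun)"
    for x :: "real \<times> real" and s :: real
  have D_apply: "blinfun_apply (D x s) h =
      fst h *\<^sub>R s^m *\<^sub>R pd1 f (fst x, s * snd x) + snd h *\<^sub>R s^Suc m *\<^sub>R pd2 f (fst x, s * snd x)" for x s h
    by (simp add: D_def blinfun.bilinear_simps)
  have cont: "continuous_on (cbox 0 1) (\<lambda>s. s^j *\<^sub>R k (fst y, s * snd y))"
    if "smooth_on (sq r) k" "y \<in> sq r" for k :: "real \<times> real \<Rightarrow> 'a" and y j
    using that by (intro continuous_intros continuous_on_compose2[OF smooth_on_imp_continuous_on[OF that(1)]])
       (auto intro!: sq_star)
  have contD: "continuous_on (sq r \<times> cbox 0 1) (\<lambda>(x, s). D x s)"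
    unfolding D_def split_beta
    using continuous_on_dilation[OF smooth_on_pd(1)[OF f]] continuous_on_dilation[OF smooth_on_pd(2)[OF f]]
    by (intro continuous_intros bounded_linear.continuous_on[OF bounded_linear_blinfun_scaleR_left])
       (auto simp: split_beta)
  have "((\<lambda>x. integral (cbox 0 1) (\<lambda>s. s^m *\<^sub>R f (fst x, s * snd x))) has_derivative
      integral (cbox 0 1) (D x)) (at x within sq r)"
  proof (rule leibniz_rule[OF _ _ contD x convex_sq])
    fix y s assume y: "y \<in> sq r" and s: "s \<in> cbox 0 (1::real)"
    have d: "((\<lambda>y. (fst y, s * snd y)) has_derivative (\<lambda>h. (fst h, s * snd h))) (at y)"
      by (auto intro!: derivative_eq_intros)
    have "(f has_derivative (\<lambda>h. fst h *\<^sub>R pd1 f (fst y, s * snd y) + snd h *\<^sub>R pd2 f (fst y, s * snd y)))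
       (at (fst y, s * snd y))"
      using s by (intro has_derivative_pd[OF f] sq_star y) auto
    from diff_chain_at[OF d this]
    have "((\<lambda>y. s^m *\<^sub>R f (fst y, s * snd y)) has_derivative
      (\<lambda>h. s^m *\<^sub>R (fst h *\<^sub>R pd1 f (fst y, s * snd y) + (s * snd h) *\<^sub>R pd2 f (fst y, s * snd y)))) (at y)"
      by (auto simp: o_def intro!: has_derivative_scaleR_right)
    moreover have "(\<lambda>h. s^m *\<^sub>R (fst h *\<^sub>R pd1 f (fst y, s * snd y) + (s * snd h) *\<^sub>R pd2 f (fst y, s * snd y))) = blinfun_apply (D y s)"
      by (auto simp: D_apply algebra_simps)
    ultimately show "((\<lambda>y. s^m *\<^sub>R f (fst y, s * snd y)) has_derivative blinfun_apply (D y s)) (at y within sq r)"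
      by (metis has_derivative_at_withinI)
  next
    fix y assume "y \<in> sq r"
    then show "(\<lambda>s. s^m *\<^sub>R f (fst y, s * snd y)) integrable_on cbox 0 1"
      by (intro integrable_continuous cont f)
  qed
  moreover have "blinfun_apply (integral (cbox 0 1) (D x)) h =
      fst h *\<^sub>R moment m (pd1 f) x + snd h *\<^sub>R moment (Suc m) (pd2 f) x" for h
  proof -
    have "continuous_on (cbox 0 1) (\<lambda>s. D x s)"
      using continuous_on_compose2[OF contD, of "cbox 0 1" "Pair x"]
        continuous_on_Pair[of "cbox 0 (1::real)" "\<lambda>_. x" "\<lambda>s. s"] x
      by auto
    then have "blinfun_apply (integral (cbox 0 1) (D x)) h = integral (cbox 0 1) (\<lambda>s. blinfun_apply (D x s) h)"
      by (intro blinfun_apply_integral integrable_continuous)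
    also have "\<dots> = integral (cbox 0 1) (\<lambda>s. fst h *\<^sub>R s^m *\<^sub>R pd1 f (fst x, s * snd x))
         + integral (cbox 0 1) (\<lambda>s. snd h *\<^sub>R s^Suc m *\<^sub>R pd2 f (fst x, s * snd x))"
      unfolding D_apply
      by (rule integral_add; intro integrable_continuous continuous_on_scaleR continuous_on_const cont[simplified] smooth_on_pd f x
          continuous_on_compose2[OF smooth_on_imp_continuous_on[OF smooth_on_pd(1)[OF f]]]
          continuous_on_compose2[OF smooth_on_imp_continuous_on[OF smooth_on_pd(2)[OF f]]])
         (auto intro!: continuous_intros sq_star x)
    also have "\<dots> = fst h *\<^sub>R moment m (pd1 f) x + snd h *\<^sub>R moment (Suc m) (pd2 f) x"
      unfolding moment_def by (simp only: integral_cmul)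
    finally show ?thesis .
  qed
  ultimately have "((\<lambda>x. integral (cbox 0 1) (\<lambda>s. s^m *\<^sub>R f (fst x, s * snd x))) has_derivative
      (\<lambda>h. fst h *\<^sub>R moment m (pd1 f) x + snd h *\<^sub>R moment (Suc m) (pd2 f) x)) (at x within sq r)"
    by (metis (no_types, lifting) has_derivative_eq_rhs ext)
  then show ?thesis
    unfolding at_within_open[OF x open_sq] by (simp only: moment_def[abs_def])
qed

lemma smooth_on_moment:
  assumes "smooth_on (sq r) f"
  shows "smooth_on (sq r) (moment m f)"
proof (rule smooth_on_coinduct2[where P = "\<lambda>g. \<exists>m f. smooth_on (sq r) f \<and> g = moment m f"])
  fix g :: "real \<times> real \<Rightarrow> 'a" assume "\<exists>m f. smooth_on (sq r) f \<and> g = moment m f"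
  then obtain m f where "smooth_on (sq r) f" "g = moment m f" by blast
  then show "\<exists>f1 f2. (\<exists>m f. smooth_on (sq r) f \<and> f1 = moment m f) \<and> (\<exists>m f. smooth_on (sq r) f \<and> f2 = moment m f) \<and>
       (\<forall>x\<in>sq r. (g has_derivative (\<lambda>h. fst h *\<^sub>R f1 x + snd h *\<^sub>R f2 x)) (at x))"
    by (intro exI[of _ "moment m (pd1 f)"] exI[of _ "moment (Suc m) (pd2 f)"])
       (auto intro: smooth_on_pd moment_has_derivative)
qed (use assms in auto)

text \<open>Fundamental theorem of calculus on the segment from \<open>(u, 0)\<close> to
  \<open>(u, v)\<close>, whose velocity contributes the factor \<open>v\<close>.\<close>

lemma hadamard:
  fixes f :: "real \<times> real \<Rightarrow> 'a::euclidean_space"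
  assumes f: "smooth_on (sq r) f"
  obtains q where "smooth_on (sq r) q" "\<And>u v. (u, v) \<in> sq r \<Longrightarrow> f (u, v) = f (u, 0) + v *\<^sub>R q (u, v)"
proof
  show "smooth_on (sq r) (moment 0 (pd2 f))"
    by (intro smooth_on_moment smooth_on_pd f)
  fix u v assume x: "(u, v) \<in> sq r"
  have "((\<lambda>s. v *\<^sub>R pd2 f (u, s * v)) has_integral f (u, 1 * v) - f (u, 0 * v)) {0..1}"
  proof (rule fundamental_theorem_of_calculus)
    fix s :: real assume s: "s \<in> {0..1}"
    have d: "((\<lambda>s. (u, s * v)) has_derivative (\<lambda>h. (0, h * v))) (at s within {0..1})"
      by (auto intro!: derivative_eq_intros)
    have "(f has_derivative (\<lambda>h. fst h *\<^sub>R pd1 f (u, s * v) + snd h *\<^sub>R pd2 f (u, s * v))) (at (u, s * v))"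
      using s sq_star[OF x, of s] by (intro has_derivative_pd[OF f]) auto
    from has_derivative_compose[OF d this]
    show "((\<lambda>s. f (u, s * v)) has_vector_derivative v *\<^sub>R pd2 f (u, s * v)) (at s within {0..1})"
      by (simp add: has_vector_derivative_def mult.commute)
  qed simp
  then have "integral {0..1} (\<lambda>s. v *\<^sub>R pd2 f (u, s * v)) = f (u, 1 * v) - f (u, 0 * v)"
    by (rule integral_unique)
  then have "v *\<^sub>R integral {0..1} (\<lambda>s. pd2 f (u, s * v)) = f (u, v) - f (u, 0)"
    by simp
  then show "f (u, v) = f (u, 0) + v *\<^sub>R moment 0 (pd2 f) (u, v)"
    by (simp add: moment_def)
qed

lemma hadamard_1d:
  fixes f :: "real \<Rightarrow> 'a::euclidean_space"
  assumes "smooth_on {-r<..<r} f"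
  obtains q where "smooth_on {-r<..<r} q" "\<And>v. \<bar>v\<bar> < r \<Longrightarrow> f v = f 0 + v *\<^sub>R q v"
proof -
  have "smooth_on (sq r) (\<lambda>x. f (snd x))"
    by (rule smooth_on_compose[OF assms]) (auto simp: mem_sq intro!: smooth_on_intros)
  then obtain q where q: "smooth_on (sq r) q"
    "\<And>u v. (u, v) \<in> sq r \<Longrightarrow> f (snd (u, v)) = f (snd (u, 0::real)) + v *\<^sub>R q (u, v)"
    using hadamard by metis
  show thesis
  proof (rule that[of "\<lambda>v. q (0, v)"])
    show "smooth_on {-r<..<r} (\<lambda>v. q (0, v))"
      by (rule smooth_on_compose[OF q(1)]) (auto simp: mem_sq intro!: smooth_on_intros)
    show "f v = f 0 + v *\<^sub>R q (0, v)" if "\<bar>v\<bar> < r" for v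
      using q(2)[of 0 v] that by (auto simp: mem_sq)
  qed
qed

text \<open>Vanishing to infinite order on the axis, expressed as smooth divisibility by every power
  of the second coordinate. In this form it survives differentiation and division by that
  coordinate, the two operations which a square root substitution calls for.\<close>

definition flat :: "real \<Rightarrow> (real \<times> real \<Rightarrow> 'a::euclidean_space) \<Rightarrow> bool" where
  "flat r f \<longleftrightarrow> (\<forall>m. \<exists>s. smooth_on (sq r) s \<and> (\<forall>x\<in>sq r. f x = snd x ^ m *\<^sub>R s x))"

lemma flatE:
  assumes "flat r f"
  obtains s where "smooth_on (sq r) s" "\<And>x. x \<in> sq r \<Longrightarrow> f x = snd x ^ m *\<^sub>R s x"
  using assms unfolding flat_def by metis

lemma flat_smooth_on: "flat r f \<Longrightarrow> smooth_on (sq r) f"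
  by (erule flatE[where m = 0]) (auto intro: smooth_on_cong)

lemma flat_axis: "flat r f \<Longrightarrow> \<bar>u\<bar> < r \<Longrightarrow> f (u, 0) = 0"
  by (erule flatE[where m = 1]) (auto simp: mem_sq)

lemma flat_add: "flat r f \<Longrightarrow> flat r g \<Longrightarrow> flat r (\<lambda>x. f x + g x)"
  unfolding flat_def
proof
  fix m
  assume "\<forall>m. \<exists>s. smooth_on (sq r) s \<and> (\<forall>x\<in>sq r. f x = snd x ^ m *\<^sub>R s x)"
    "\<forall>m. \<exists>s. smooth_on (sq r) s \<and> (\<forall>x\<in>sq r. g x = snd x ^ m *\<^sub>R s x)"
  then obtain s t where "smooth_on (sq r) s" "smooth_on (sq r) t"
    "\<forall>x\<in>sq r. f x = snd x ^ m *\<^sub>R s x" "\<forall>x\<in>sq r. g x = snd x ^ m *\<^sub>R t x" by blast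
  then show "\<exists>s. smooth_on (sq r) s \<and> (\<forall>x\<in>sq r. f x + g x = snd x ^ m *\<^sub>R s x)"
    by (intro exI[of _ "\<lambda>x. s x + t x"]) (auto intro: smooth_on_add simp: algebra_simps)
qed

lemma flat_scaleR: "flat r f \<Longrightarrow> flat r (\<lambda>x. c *\<^sub>R f x)"
  unfolding flat_def
proof
  fix m
  assume "\<forall>m. \<exists>s. smooth_on (sq r) s \<and> (\<forall>x\<in>sq r. f x = snd x ^ m *\<^sub>R s x)"
  then obtain s where "smooth_on (sq r) s" "\<forall>x\<in>sq r. f x = snd x ^ m *\<^sub>R s x" by blast
  then show "\<exists>s. smooth_on (sq r) s \<and> (\<forall>x\<in>sq r. c *\<^sub>R f x = snd x ^ m *\<^sub>R s x)"
    by (intro exI[of _ "\<lambda>x. c *\<^sub>R s x"]) (auto intro: smooth_on_scaleR simp: algebra_simps)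
qed

lemma flat_reflect:
  assumes "flat r f"
  shows "flat r (\<lambda>x. f (fst x, - snd x))"
  unfolding flat_def
proof
  fix m
  obtain s where s: "smooth_on (sq r) s" "\<And>x. x \<in> sq r \<Longrightarrow> f x = snd x ^ m *\<^sub>R s x"
    using assms by (rule flatE[where m = m]) blast
  have "smooth_on (sq r) (\<lambda>x. (-1)^m *\<^sub>R s (fst x, - snd x))"
    by (intro smooth_on_scaleR smooth_on_compose[OF s(1)] smooth_on_intros) (auto simp: mem_sq)
  moreover have "f (fst x, - snd x) = snd x ^ m *\<^sub>R (-1)^m *\<^sub>R s (fst x, - snd x)" if "x \<in> sq r" for x
    using s(2)[of "(fst x, - snd x)"] that by (simp add: mem_sq power_minus[of "snd x"] mult.commute)
  ultimately show "\<exists>s. smooth_on (sq r) s \<and> (\<forall>x\<in>sq r. f (fst x, - snd x) = snd x ^ m *\<^sub>R s x)"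
    by blast
qed

text \<open>On the axis the quotient takes the junk value $0$, which is the correct one for a flat function.\<close>

lemma flat_quotient:
  assumes "flat r f"
  shows "flat r (\<lambda>x. (1 / snd x) *\<^sub>R f x)"
  unfolding flat_def
proof
  fix m
  obtain s where s: "smooth_on (sq r) s" "\<And>x. x \<in> sq r \<Longrightarrow> f x = snd x ^ Suc (Suc m) *\<^sub>R s x"
    using assms by (rule flatE[where m = "Suc (Suc m)"]) blast
  have "smooth_on (sq r) (\<lambda>x. snd x *\<^sub>R s x)"
    by (intro smooth_on_intros s) auto
  then show "\<exists>s. smooth_on (sq r) s \<and> (\<forall>x\<in>sq r. (1 / snd x) *\<^sub>R f x = snd x ^ m *\<^sub>R s x)"
    by (intro exI[of _ "\<lambda>x. snd x *\<^sub>R s x"]) (auto simp: s(2))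
qed

text \<open>The product rule costs one power, so order \<open>m\<close> of the derivative is read
  off from order \<open>Suc m\<close> of the function.\<close>

lemma flat_pd:
  assumes "flat r f"
  shows "flat r (pd1 f)" "flat r (pd2 f)"
proof -
  have "\<exists>s1 s2. smooth_on (sq r) s1 \<and> smooth_on (sq r) s2 \<and>
     (\<forall>x\<in>sq r. pd1 f x = snd x ^ m *\<^sub>R s1 x \<and> pd2 f x = snd x ^ m *\<^sub>R s2 x)" for m
  proof -
    obtain s where s: "smooth_on (sq r) s" "\<And>x. x \<in> sq r \<Longrightarrow> f x = snd x ^ Suc m *\<^sub>R s x"
      using assms by (rule flatE[where m = "Suc m"]) blast
    have d: "pd1 f x = snd x ^ m *\<^sub>R snd x *\<^sub>R pd1 s x \<and>
        pd2 f x = snd x ^ m *\<^sub>R (real (Suc m) *\<^sub>R s x + snd x *\<^sub>R pd2 s x)" if x: "x \<in> sq r" for x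
    proof -
      have "((\<lambda>x. snd x ^ Suc m *\<^sub>R s x) has_derivative
          (\<lambda>h. snd x ^ Suc m *\<^sub>R (fst h *\<^sub>R pd1 s x + snd h *\<^sub>R pd2 s x) +
             (real (Suc m) * (snd h * snd x ^ m)) *\<^sub>R s x)) (at x)"
        by (rule has_derivative_scaleR[OF _ has_derivative_pd[OF s(1) x]])
           (rule has_derivative_eq_rhs[OF has_derivative_power[OF has_derivative_snd[OF has_derivative_ident]]],
            simp add: mult.assoc)
      then have "(f has_derivative
          (\<lambda>h. snd x ^ Suc m *\<^sub>R (fst h *\<^sub>R pd1 s x + snd h *\<^sub>R pd2 s x) +
             (real (Suc m) * (snd h * snd x ^ m)) *\<^sub>R s x)) (at x)"
        by (rule has_derivative_transform_within_open[OF _ open_sq x]) (simp add: s(2))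
      from frechet_derivative_at[OF this, symmetric] show ?thesis
        by (simp add: algebra_simps)
    qed
    have "smooth_on (sq r) (\<lambda>x. snd x *\<^sub>R pd1 s x)"
      "smooth_on (sq r) (\<lambda>x. real (Suc m) *\<^sub>R s x + snd x *\<^sub>R pd2 s x)"
      by (intro smooth_on_intros s smooth_on_pd open_sq)+
    with d show ?thesis by blast
  qed
  then show "flat r (pd1 f)" "flat r (pd2 f)"
    unfolding flat_def by metis+
qed

text \<open>Descends a flat function along \<open>v^2 = y\<close>. Flatness makes zero the smooth
  continuation to \<open>y <= 0\<close>.\<close>

definition root_fun :: "(real \<times> real \<Rightarrow> 'a::real_normed_vector) \<Rightarrow> real \<times> real \<Rightarrow> 'a" where
  "root_fun f x = (if snd x > 0 then f (fst x, sqrt (snd x)) else 0)"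

text \<open>Off the axis the chain rule produces \<open>1 / (2 sqrt y)\<close>, which is absorbed
  into the flat quotient of \<open>pd2 f\<close> by \<open>2 v\<close>; so the derivatives are root
  functions of flat functions again. On the axis a quadratic bound gives derivative zero.\<close>

lemma root_fun_has_derivative:
  assumes f: "flat r f" and x: "x \<in> {-r<..<r} \<times> {..<r\<^sup>2}"
  shows "(root_fun f has_derivative (\<lambda>h. fst h *\<^sub>R root_fun (pd1 f) x +
      snd h *\<^sub>R root_fun (\<lambda>x. (1/2) *\<^sub>R (1 / snd x) *\<^sub>R pd2 f x) x)) (at x)"
proof -
  consider "snd x > 0" | "snd x < 0" | "snd x = 0" by linarith
  then show ?thesis
  proof cases
    case 1
    have rt: "sqrt (snd x) < r"
      using x 1 real_sqrt_less_mono[of "snd x" "r\<^sup>2"] by (auto simp: mem_Times_iff)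
    have d: "((\<lambda>x. (fst x, sqrt (snd x))) has_derivative (\<lambda>h. (fst h, snd h * (inverse (sqrt (snd x)) / 2)))) (at x)"
      using 1 by (auto intro!: derivative_eq_intros simp: divide_simps)
    have m: "(fst x, sqrt (snd x)) \<in> sq r"
      using x rt 1 by (auto simp: mem_sq)
    have "((\<lambda>x. f (fst x, sqrt (snd x))) has_derivative
       (\<lambda>h. fst h *\<^sub>R pd1 f (fst x, sqrt (snd x)) + (snd h * (inverse (sqrt (snd x)) / 2)) *\<^sub>R pd2 f (fst x, sqrt (snd x)))) (at x)"
      using has_derivative_compose[OF d has_derivative_pd[OF flat_smooth_on[OF f] m]] by simp
    then have "(root_fun f has_derivative
       (\<lambda>h. fst h *\<^sub>R pd1 f (fst x, sqrt (snd x)) + (snd h * (inverse (sqrt (snd x)) / 2)) *\<^sub>R pd2 f (fst x, sqrt (snd x)))) (at x)"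
      by (rule has_derivative_transform_within_open[where s = "UNIV \<times> {0<..}"])
         (use 1 in \<open>auto simp: root_fun_def open_Times mem_Times_iff\<close>)
    then show ?thesis
      using 1 by (simp add: root_fun_def field_simps)
  next
    case 2
    have "((\<lambda>x. 0) has_derivative (\<lambda>h. 0::'a)) (at x)" by simp
    then have "(root_fun f has_derivative (\<lambda>h. 0)) (at x)"
      by (rule has_derivative_transform_within_open[where s = "UNIV \<times> {..<0}"])
         (use 2 in \<open>auto simp: root_fun_def open_Times mem_Times_iff\<close>)
    with 2 show ?thesis by (simp add: root_fun_def)
  next
    case 3
    have r: "r > 0" using x by auto
    \<comment> \<open>Four factors of \<open>v\<close> become \<open>y^2\<close>, a remainder of
      second order.\<close>
    obtain s where s: "smooth_on (sq r) s" "\<And>x. x \<in> sq r \<Longrightarrow> f x = snd x ^ 4 *\<^sub>R s x"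
      using f by (rule flatE[where m = 4]) blast
    have xs: "x \<in> sq r" using 3 x r by (auto simp: mem_sq)
    have "isCont s x"
      using smooth_on_imp_continuous_on[OF s(1)] xs by (simp add: continuous_on_eq_continuous_at)
    then obtain d where d: "d > 0" "\<And>y. dist y x < d \<Longrightarrow> dist (s y) (s x) < 1"
      unfolding continuous_at_eps_delta using zero_less_one by blast
    define K where "K = norm (s x) + 1"
    have K: "norm (s y) \<le> K" if "dist y x < d" for y
      using d(2)[OF that] norm_triangle_ineq2[of "s y" "s x"] by (simp add: dist_norm K_def)
    \<comment> \<open>\<open>r - |fst x|\<close> keeps the first coordinate in the square,
      \<open>d / 2\<close> leaves room for two coordinate distances below \<open>d / 2\<close>, and
      the two squares bound \<open>y\<close> so that \<open>sqrt y\<close> is below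
      \<open>d / 2\<close> and below \<open>r\<close>.\<close>
    define e where "e = min (r - \<bar>fst x\<bar>) (min ((d/2)\<^sup>2) (min (d/2) (r\<^sup>2)))"
    have e: "e > 0" using d(1) x r by (auto simp: e_def)
    have bound: "norm (root_fun f y) \<le> K * (norm (y - x))\<^sup>2" if y: "dist y x < e" for y
    proof (cases "snd y > 0")
      case True
      have "norm (snd (y - x)) \<le> norm (y - x)" "norm (fst (y - x)) \<le> norm (y - x)"
        by (metis norm_snd_le prod.collapse, metis norm_fst_le prod.collapse)
      then have sy: "\<bar>snd y\<bar> \<le> norm (y - x)" "\<bar>fst y - fst x\<bar> \<le> norm (y - x)"
        using 3 by auto
      have ny: "norm (y - x) < e" using y by (simp add: dist_norm)
      then have y2: "snd y < (d/2)\<^sup>2" "snd y < r\<^sup>2" using sy by (auto simp: e_def)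
      have rt: "sqrt (snd y) < d/2" "sqrt (snd y) < r"
        using real_sqrt_less_mono[OF y2(1)] real_sqrt_less_mono[OF y2(2)] d(1) r by auto
      have "dist (fst y, sqrt (snd y)) x \<le> \<bar>fst y - fst x\<bar> + \<bar>sqrt (snd y)\<bar>"
        using 3 norm_Pair_le[of "fst y - fst x" "sqrt (snd y)"]
        by (cases x) (auto simp: dist_norm)
      also have "\<dots> < d"
        using sy ny rt True by (auto simp: e_def)
      finally have n: "norm (s (fst y, sqrt (snd y))) \<le> K" by (rule K)
      have "(fst y, sqrt (snd y)) \<in> sq r"
        using rt True sy ny by (auto simp: mem_sq e_def)
      then have "norm (root_fun f y) = (snd y)\<^sup>2 * norm (s (fst y, sqrt (snd y)))"
        using True by (simp add: root_fun_def s(2) power4_eq_xxxx power2_eq_square)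
      also have "\<dots> \<le> (norm (y - x))\<^sup>2 * K"
        using sy n True by (intro mult_mono power_mono) auto
      finally show ?thesis by (simp add: mult.commute)
    qed (auto simp: root_fun_def K_def)
    have "(root_fun f has_derivative (\<lambda>h. 0)) (at x)"
    proof (rule has_derivativeI_sandwich[where e = e and H = "\<lambda>y. K * norm (y - x)"])
      show "norm (root_fun f y - root_fun f x - 0) / norm (y - x) \<le> K * norm (y - x)"
        if "y \<in> UNIV" "y \<noteq> x" "dist y x < e" for y
        using bound[OF that(3)] that(2) 3 by (simp add: root_fun_def divide_simps power2_eq_square)
      show "((\<lambda>y. K * norm (y - x)) \<longlongrightarrow> 0) (at x)"
        by (auto intro!: tendsto_eq_intros)
    qed (use e in auto)
    with 3 show ?thesis by (simp add: root_fun_def)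
  qed
qed

lemma smooth_on_root_fun:
  assumes "flat r f"
  shows "smooth_on ({-r<..<r} \<times> {..<r\<^sup>2}) (root_fun f)"
proof (rule smooth_on_coinduct2[where P = "\<lambda>g. \<exists>f. flat r f \<and> g = root_fun f"])
  fix g :: "real \<times> real \<Rightarrow> 'a" assume "\<exists>f. flat r f \<and> g = root_fun f"
  then obtain f where f: "flat r f" "g = root_fun f" by blast
  let ?k = "\<lambda>x. (1/2) *\<^sub>R (1 / snd x) *\<^sub>R pd2 f x"
  have "flat r ?k" by (intro flat_scaleR flat_quotient flat_pd f(1))
  moreover have "flat r (pd1 f)" by (rule flat_pd[OF f(1)])
  moreover have "\<forall>x\<in>{-r<..<r} \<times> {..<r\<^sup>2}. (g has_derivative (\<lambda>h. fst h *\<^sub>R root_fun (pd1 f) x + snd h *\<^sub>R root_fun ?k x)) (at x)"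
    using root_fun_has_derivative[OF f(1)] f(2) by blast
  ultimately show "\<exists>f1 f2. (\<exists>f. flat r f \<and> f1 = root_fun f) \<and> (\<exists>f. flat r f \<and> f2 = root_fun f) \<and>
       (\<forall>x\<in>{-r<..<r} \<times> {..<r\<^sup>2}. (g has_derivative (\<lambda>h. fst h *\<^sub>R f1 x + snd h *\<^sub>R f2 x)) (at x))"
    by blast
qed (use assms in \<open>auto simp: open_Times\<close>)

text \<open>Induction on the power already split off: the bound of order \<open>Suc m\<close> forces
  the \<open>m\<close>-th quotient to vanish on the axis, and then Hadamard's lemma supplies one
  more factor.\<close>

lemma flatI_bounded:
  assumes f: "smooth_on (sq r) f"
    and bd: "\<And>m. \<exists>C. \<forall>x\<in>sq r. norm (f x) \<le> C * \<bar>snd x\<bar> ^ m"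
  shows "flat r f"
  unfolding flat_def
proof
  fix m
  show "\<exists>s. smooth_on (sq r) s \<and> (\<forall>x\<in>sq r. f x = snd x ^ m *\<^sub>R s x)"
  proof (induction m)
    case 0
    then show ?case using f by auto
  next
    case (Suc m)
    then obtain s where s: "smooth_on (sq r) s" "\<And>x. x \<in> sq r \<Longrightarrow> f x = snd x ^ m *\<^sub>R s x" by blast
    obtain C where C: "\<And>x. x \<in> sq r \<Longrightarrow> norm (f x) \<le> C * \<bar>snd x\<bar> ^ Suc m" using bd by blast
    have sC: "norm (s x) \<le> C * \<bar>snd x\<bar>" if "x \<in> sq r" "snd x \<noteq> 0" for x
    proof -
      have "\<bar>snd x\<bar> ^ m * norm (s x) \<le> \<bar>snd x\<bar> ^ m * (C * \<bar>snd x\<bar>)"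
        using C[OF that(1)] s(2)[OF that(1)] by (simp add: power_abs mult_ac)
      then show ?thesis using that(2) by simp
    qed
    have s0: "s (u, 0) = 0" if u: "\<bar>u\<bar> < r" for u
    proof -
      have "isCont s (u, 0)"
        using smooth_on_imp_continuous_on[OF s(1)] u by (simp add: continuous_on_eq_continuous_at mem_sq)
      then have "((\<lambda>v. s (u, v)) \<longlongrightarrow> s (u, 0)) (at 0)"
        by (rule isCont_tendsto_compose) (auto intro!: tendsto_eq_intros)
      moreover have "((\<lambda>v. s (u, v)) \<longlongrightarrow> 0) (at 0)"
      proof (rule Lim_null_comparison)
        have "\<forall>\<^sub>F v in at 0. v \<noteq> (0::real) \<and> dist v 0 < r"
          using u by (auto simp: eventually_at intro!: exI[of _ r])
        then show "\<forall>\<^sub>F v in at 0. norm (s (u, v)) \<le> C * \<bar>v\<bar>"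
          by eventually_elim (use u sC[of "(u, _)"] in \<open>auto simp: mem_sq\<close>)
        show "((\<lambda>v. C * \<bar>v\<bar>) \<longlongrightarrow> 0) (at 0)"
          by (auto intro!: tendsto_eq_intros)
      qed
      ultimately show ?thesis by (rule tendsto_unique[rotated 1]) simp
    qed
    obtain q where q: "smooth_on (sq r) q" "\<And>u v. (u, v) \<in> sq r \<Longrightarrow> s (u, v) = s (u, 0) + v *\<^sub>R q (u, v)"
      using hadamard[OF s(1)] by blast
    have "f x = snd x ^ Suc m *\<^sub>R q x" if "x \<in> sq r" for x
      using s(2)[OF that] q(2)[of "fst x" "snd x"] s0[of "fst x"] that
      by (cases x) (auto simp: mem_sq mult.commute)
    with q(1) show ?case by blast
  qed
qed

section \<open>Whitney's theorem on even and odd parts\<close>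

fun Ck_bound :: "nat \<Rightarrow> 'a::euclidean_space set \<Rightarrow> ('a \<Rightarrow> 'b::real_normed_vector) \<Rightarrow> real \<Rightarrow> bool" where
  "Ck_bound 0 S f M \<longleftrightarrow> (\<forall>x\<in>S. norm (f x) \<le> M)"
| "Ck_bound (Suc k) S f M \<longleftrightarrow> (\<forall>x\<in>S. norm (f x) \<le> M) \<and>
     (\<forall>i\<in>Basis. Ck_bound k S (\<lambda>x. frechet_derivative f (at x) i) M)"

lemma Ck_bound_norm: "Ck_bound k S f M \<Longrightarrow> x \<in> S \<Longrightarrow> norm (f x) \<le> M"
  by (cases k) auto

lemma Ck_bound_mono: "Ck_bound k S f M \<Longrightarrow> M \<le> N \<Longrightarrow> Ck_bound k S f N"
  by (induction k arbitrary: f) (auto intro: order_trans)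

lemma Ck_bound_cong:
  assumes "open S" "Ck_bound k S f M" "\<And>x. x \<in> S \<Longrightarrow> f x = g x" "Ck_on k S f"
  shows "Ck_bound k S g M"
  using assms(2-4)
proof (induction k arbitrary: f g)
  case 0
  then show ?case by simp
next
  case (Suc k)
  have "(g has_derivative frechet_derivative f (at x)) (at x)" if "x \<in> S" for x
    using Suc.prems that assms(1)
    by (auto intro: has_derivative_transform_within_open simp: frechet_derivative_works)
  then have "frechet_derivative f (at x) = frechet_derivative g (at x)" if "x \<in> S" for x
    using that frechet_derivative_at by blast
  with Suc show ?case by (auto simp del: Ck_on.simps(1))
qed

lemma Ck_bound_SucI2:
  fixes f :: "real \<times> real \<Rightarrow> 'a::real_normed_vector"
  assumes "open S" "\<And>x. x \<in> S \<Longrightarrow> norm (f x) \<le> M"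
    "\<And>x. x \<in> S \<Longrightarrow> (f has_derivative (\<lambda>h. fst h *\<^sub>R f1 x + snd h *\<^sub>R f2 x)) (at x)"
    "Ck_bound k S f1 M" "Ck_bound k S f2 M" "smooth_on S f1" "smooth_on S f2"
  shows "Ck_bound (Suc k) S f M"
proof -
  have "frechet_derivative f (at x) = (\<lambda>h. fst h *\<^sub>R f1 x + snd h *\<^sub>R f2 x)" if "x \<in> S" for x
    using assms(3)[OF that] frechet_derivative_at by metis
  then have "Ck_bound k S (pd1 f) M" "Ck_bound k S (pd2 f) M"
    using assms(6,7) by (auto intro: Ck_bound_cong[OF assms(1,4)] Ck_bound_cong[OF assms(1,5)] smooth_on_imp_Ck_on)
  with assms(2) show ?thesis by (simp add: Basis_real_prod)
qed

text \<open>The \<open>k\<close>-th term is controlled only up to order \<open>k - m\<close>.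
  Differentiation loses one order, which is paid for by passing from \<open>m\<close> to
  \<open>Suc m\<close>; only finitely many further terms escape control, and the majorant
  \<open>(1/2)^k\<close> stays. This is the coinduction invariant.\<close>

lemma smooth_on_suminf:
  fixes f :: "nat \<Rightarrow> real \<times> real \<Rightarrow> 'a::euclidean_space"
  assumes S: "open S" "convex S" and "\<And>k. smooth_on S (f k)"
    and "\<And>k. m \<le> k \<Longrightarrow> Ck_bound (k - m) S (f k) ((1/2)^k)"
  shows "smooth_on S (\<lambda>x. \<Sum>k. f k x)"
proof (rule smooth_on_coinduct2[where P = "\<lambda>F. \<exists>f m. F = (\<lambda>x. \<Sum>k. f k x) \<and> (\<forall>k. smooth_on S (f k)) \<and>
     (\<forall>k\<ge>m. Ck_bound (k - m) S (f k) ((1/2)^k))"])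
  show "open S" by fact
  show "\<exists>f' m. (\<lambda>x. \<Sum>k. f k x) = (\<lambda>x. \<Sum>k. f' k x) \<and> (\<forall>k. smooth_on S (f' k)) \<and>
     (\<forall>k\<ge>m. Ck_bound (k - m) S (f' k) ((1/2)^k))"
    using assms by blast
next
  fix F :: "real \<times> real \<Rightarrow> 'a"
  assume "\<exists>f m. F = (\<lambda>x. \<Sum>k. f k x) \<and> (\<forall>k. smooth_on S (f k)) \<and>
     (\<forall>k\<ge>m. Ck_bound (k - m) S (f k) ((1/2)^k))"
  then obtain f m where F: "F = (\<lambda>x. \<Sum>k. f k x)" and f: "\<And>k. smooth_on S (f k)"
    and b: "\<And>k. k \<ge> m \<Longrightarrow> Ck_bound (k - m) S (f k) ((1/2)^k)" by blast
  have bd: "Ck_bound (k - Suc m) S (pd1 (f k)) ((1/2)^k)" "Ck_bound (k - Suc m) S (pd2 (f k)) ((1/2)^k)"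
    if "k \<ge> Suc m" for k
  proof -
    have "Ck_bound (Suc (k - Suc m)) S (f k) ((1/2)^k)"
      using b[of k] that by (metis Suc_diff_Suc Suc_le_lessD less_imp_le_nat)
    then show "Ck_bound (k - Suc m) S (pd1 (f k)) ((1/2)^k)" "Ck_bound (k - Suc m) S (pd2 (f k)) ((1/2)^k)"
      by (simp_all add: Basis_real_prod)
  qed
  have summ: "summable (\<lambda>k. (1/2)^k :: real)" by (rule summable_geometric) simp
  have sums: "(\<lambda>k. f k x) sums F x" if "x \<in> S" for x
  proof -
    have "summable (\<lambda>k. f k x)"
      by (rule summable_comparison_test[OF _ summ]) (use b Ck_bound_norm that in blast)
    then show ?thesis by (simp add: F summable_sums)
  qed
  define F1 where "F1 = (\<lambda>x. \<Sum>k. pd1 (f k) x)"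
  define F2 where "F2 = (\<lambda>x. \<Sum>k. pd2 (f k) x)"
  have u: "uniform_limit S (\<lambda>n x. \<Sum>k<n. pd1 (f k) x) F1 sequentially"
    "uniform_limit S (\<lambda>n x. \<Sum>k<n. pd2 (f k) x) F2 sequentially"
    unfolding F1_def F2_def
    by (rule Weierstrass_m_test_ev[OF _ summ],
        intro eventually_sequentiallyI[of "Suc m"] ballI Ck_bound_norm[OF bd(1)] Ck_bound_norm[OF bd(2)]; assumption)+
  have d: "(F has_derivative (\<lambda>h. fst h *\<^sub>R F1 x + snd h *\<^sub>R F2 x)) (at x)" if x: "x \<in> S" for x
  proof -
    have "\<exists>g. \<forall>x\<in>S. (\<lambda>n. f n x) sums g x \<and>
        (g has_derivative (\<lambda>h. fst h *\<^sub>R F1 x + snd h *\<^sub>R F2 x)) (at x within S)"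
    proof (rule has_derivative_series[where f = f and x = x and f' = "\<lambda>k x h. fst h *\<^sub>R pd1 (f k) x + snd h *\<^sub>R pd2 (f k) x"])
      show "(f n has_derivative (\<lambda>h. fst h *\<^sub>R pd1 (f n) x + snd h *\<^sub>R pd2 (f n) x)) (at x within S)"
        if "x \<in> S" for n x
        by (rule has_derivative_at_withinI[OF has_derivative_pd[OF f that]])
      fix e :: real assume "e > 0"
      then have "\<forall>\<^sub>F n in sequentially. \<forall>x\<in>S. dist (\<Sum>k<n. pd1 (f k) x) (F1 x) < e/2"
        "\<forall>\<^sub>F n in sequentially. \<forall>x\<in>S. dist (\<Sum>k<n. pd2 (f k) x) (F2 x) < e/2"
        using uniform_limitD[OF u(1), of "e/2"] uniform_limitD[OF u(2), of "e/2"] by simp_all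
      then show "\<forall>\<^sub>F n in sequentially. \<forall>x\<in>S. \<forall>h. norm ((\<Sum>i<n. fst h *\<^sub>R pd1 (f i) x + snd h *\<^sub>R pd2 (f i) x) -
          (fst h *\<^sub>R F1 x + snd h *\<^sub>R F2 x)) \<le> e * norm h"
      proof eventually_elim
        case (elim n)
        show ?case
        proof (intro ballI allI)
          fix x h assume x: "x \<in> S"
          let ?a = "(\<Sum>k<n. pd1 (f k) x) - F1 x" and ?b = "(\<Sum>k<n. pd2 (f k) x) - F2 x"
          have n: "\<bar>fst h\<bar> \<le> norm h" "\<bar>snd h\<bar> \<le> norm h"
            by (metis norm_fst_le prod.collapse real_norm_def, metis norm_snd_le prod.collapse real_norm_def)
          have ab: "norm ?a \<le> e/2" "norm ?b \<le> e/2"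
            using elim x by (auto simp: dist_norm intro: less_imp_le)
          have "(\<Sum>i<n. fst h *\<^sub>R pd1 (f i) x + snd h *\<^sub>R pd2 (f i) x) - (fst h *\<^sub>R F1 x + snd h *\<^sub>R F2 x)
              = fst h *\<^sub>R ?a + snd h *\<^sub>R ?b"
            by (simp add: sum.distrib scaleR_sum_right algebra_simps)
          also have "norm \<dots> \<le> \<bar>fst h\<bar> * norm ?a + \<bar>snd h\<bar> * norm ?b"
            by (rule order_trans[OF norm_triangle_ineq]) simp
          also have "\<dots> \<le> norm h * (e/2) + norm h * (e/2)"
            using n ab \<open>e > 0\<close> by (intro add_mono mult_mono) auto
          finally show "norm ((\<Sum>i<n. fst h *\<^sub>R pd1 (f i) x + snd h *\<^sub>R pd2 (f i) x) -
            (fst h *\<^sub>R F1 x + snd h *\<^sub>R F2 x)) \<le> e * norm h" by (simp add: algebra_simps)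
        qed
      qed
    next
      show "(\<lambda>n. f n x) sums F x" by (rule sums[OF x])
    qed (use S x in auto)
    then obtain g where g: "\<And>x. x \<in> S \<Longrightarrow> (\<lambda>n. f n x) sums g x"
      "\<And>x. x \<in> S \<Longrightarrow> (g has_derivative (\<lambda>h. fst h *\<^sub>R F1 x + snd h *\<^sub>R F2 x)) (at x within S)" by blast
    have "(g has_derivative (\<lambda>h. fst h *\<^sub>R F1 x + snd h *\<^sub>R F2 x)) (at x)"
      using g(2)[OF x] at_within_open[OF x S(1)] by simp
    then show ?thesis
      by (rule has_derivative_transform_within_open[OF _ S(1) x]) (use g(1) sums sums_unique2 in blast)
  qed
  show "\<exists>f1 f2. (\<exists>f m. f1 = (\<lambda>x. \<Sum>k. f k x) \<and> (\<forall>k. smooth_on S (f k)) \<and> (\<forall>k\<ge>m. Ck_bound (k - m) S (f k) ((1/2)^k))) \<and>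
      (\<exists>f m. f2 = (\<lambda>x. \<Sum>k. f k x) \<and> (\<forall>k. smooth_on S (f k)) \<and> (\<forall>k\<ge>m. Ck_bound (k - m) S (f k) ((1/2)^k))) \<and>
      (\<forall>x\<in>S. (F has_derivative (\<lambda>h. fst h *\<^sub>R f1 x + snd h *\<^sub>R f2 x)) (at x))"
  proof (rule exI[of _ F1], rule exI[of _ F2], intro conjI)
    show "\<exists>f m. F1 = (\<lambda>x. \<Sum>k. f k x) \<and> (\<forall>k. smooth_on S (f k)) \<and> (\<forall>k\<ge>m. Ck_bound (k - m) S (f k) ((1/2)^k))"
      using bd(1) smooth_on_pd(1)[OF f]
      by (intro exI[of _ "\<lambda>k. pd1 (f k)"] exI[of _ "Suc m"]) (auto simp: F1_def)
    show "\<exists>f m. F2 = (\<lambda>x. \<Sum>k. f k x) \<and> (\<forall>k. smooth_on S (f k)) \<and> (\<forall>k\<ge>m. Ck_bound (k - m) S (f k) ((1/2)^k))"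
      using bd(2) smooth_on_pd(2)[OF f]
      by (intro exI[of _ "\<lambda>k. pd2 (f k)"] exI[of _ "Suc m"]) (auto simp: F2_def)
  qed (use d in blast)
qed

text \<open>These functions are bounded together with all their derivatives, hence a derivative of
  order \<open>j\<close> of \<open>g (lam y)\<close> is at most a constant times
  \<open>lam^j\<close>.\<close>

inductive trig_poly :: "(real \<Rightarrow> real) \<Rightarrow> bool" where
  trig_const: "trig_poly (\<lambda>x. c)"
| trig_sin: "trig_poly sin"
| trig_cos: "trig_poly cos"
| trig_add: "trig_poly f \<Longrightarrow> trig_poly g \<Longrightarrow> trig_poly (\<lambda>x. f x + g x)"
| trig_mult: "trig_poly f \<Longrightarrow> trig_poly g \<Longrightarrow> trig_poly (\<lambda>x. f x * g x)"

lemma trig_poly_bounded: "trig_poly f \<Longrightarrow> \<exists>B. \<forall>x. \<bar>f x\<bar> \<le> B"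
proof (induction rule: trig_poly.induct)
  case (trig_add f g)
  then obtain B C where "\<forall>x. \<bar>f x\<bar> \<le> B" "\<forall>x. \<bar>g x\<bar> \<le> C" by blast
  then have "\<bar>f x + g x\<bar> \<le> B + C" for x
    by (meson abs_triangle_ineq add_mono order_trans)
  then show ?case by blast
next
  case (trig_mult f g)
  then obtain B C where B: "\<forall>x. \<bar>f x\<bar> \<le> B" and "\<forall>x. \<bar>g x\<bar> \<le> C" by blast
  then have "\<bar>f x * g x\<bar> \<le> B * C" for x
    unfolding abs_mult by (intro mult_mono) (use B order_trans[OF abs_ge_zero] in blast)+
  then show ?case by blast
qed (auto intro: abs_sin_le_one abs_cos_le_one)

lemma trig_poly_deriv:
  "trig_poly f \<Longrightarrow> \<exists>g. trig_poly g \<and> (\<forall>x. (f has_real_derivative g x) (at x))"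
proof (induction rule: trig_poly.induct)
  case (trig_const c)
  show ?case by (rule exI[of _ "\<lambda>x. 0"]) (auto intro: trig_poly.intros)
next
  case trig_sin
  show ?case by (rule exI[of _ cos]) (auto intro: trig_poly.intros DERIV_sin)
next
  case trig_cos
  have "trig_poly (\<lambda>x. -1 * sin x)" by (intro trig_poly.intros)
  then show ?case by (intro exI[of _ "\<lambda>x. -1 * sin x"]) (auto intro: DERIV_cos)
next
  case (trig_add f g)
  then obtain f' g' where "trig_poly f'" "trig_poly g'"
    "\<forall>x. (f has_real_derivative f' x) (at x)" "\<forall>x. (g has_real_derivative g' x) (at x)" by blast
  then show ?case
    by (intro exI[of _ "\<lambda>x. f' x + g' x"]) (auto intro: trig_poly.trig_add DERIV_add)
next
  case (trig_mult f g)
  then obtain f' g' where "trig_poly f'" "trig_poly g'"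
    "\<forall>x. (f has_real_derivative f' x) (at x)" "\<forall>x. (g has_real_derivative g' x) (at x)" by blast
  with trig_mult.hyps show ?case
    by (intro exI[of _ "\<lambda>x. f' x * g x + g' x * f x"]) (auto intro!: trig_poly.trig_add trig_poly.trig_mult DERIV_mult)
qed

lemma trig_poly_smooth: "trig_poly f \<Longrightarrow> smooth_on UNIV f"
  by (induction rule: trig_poly.induct) (auto intro: smooth_on_intros smooth_on_sin_real smooth_on_cos_real)

lemma trig_poly_sin_power: "trig_poly (\<lambda>x. sin x ^ k)"
  by (induction k) (auto intro: trig_poly.intros)

text \<open>Powers of \<open>sin (\<lambda> y) / \<lambda>\<close> replace the cut-off monomials in the usual proof of Borel's
  lemma: they agree with the powers of \<open>y\<close> up to higher order, and their derivatives of lower order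
  are uniformly small for large \<open>\<lambda>\<close>.\<close>

lemma Ck_bound_scaled:
  fixes a :: "real \<Rightarrow> 'a::euclidean_space"
  assumes "smooth_on {-r<..<r} a" "trig_poly g" "0 < p" "p < r"
  shows "\<exists>M\<ge>0. \<forall>lam\<ge>1. \<forall>c\<ge>0. Ck_bound j (sq p) (\<lambda>x. (c * g (lam * snd x)) *\<^sub>R a (fst x)) (M * c * lam ^ j)"
  using assms(1,2)
proof (induction j arbitrary: a g)
  case 0
  obtain B where B: "\<And>x. \<bar>g x\<bar> \<le> B" using trig_poly_bounded[OF 0(2)] by blast
  obtain C where C: "\<And>x. x \<in> {-p..p} \<Longrightarrow> norm (a x) \<le> C"
  proof -
    have "continuous_on {-p..p} a"
      by (rule continuous_on_subset[OF smooth_on_imp_continuous_on[OF 0(1)]]) (use assms(4) in auto)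
    then have "bounded (a ` {-p..p})"
      by (intro compact_imp_bounded compact_continuous_image) auto
    then obtain C where "\<forall>x\<in>{-p..p}. norm (a x) \<le> C" by (auto simp: bounded_iff)
    then show thesis using that by blast
  qed
  have BC: "0 \<le> B" "0 \<le> C" using order_trans[OF abs_ge_zero B] order_trans[OF norm_ge_zero C[of 0]] assms(3) by auto
  have "Ck_bound 0 (sq p) (\<lambda>x. (c * g (lam * snd x)) *\<^sub>R a (fst x)) (B * C * c * lam ^ 0)" if "c \<ge> 0" for c lam
  proof -
    have "norm ((c * g (lam * snd x)) *\<^sub>R a (fst x)) \<le> B * C * c" if x: "x \<in> sq p" for x
    proof -
      have "norm ((c * g (lam * snd x)) *\<^sub>R a (fst x)) = c * (\<bar>g (lam * snd x)\<bar> * norm (a (fst x)))"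
        using \<open>c \<ge> 0\<close> by (simp add: abs_mult)
      also have "\<dots> \<le> c * (B * C)"
      proof (intro mult_left_mono mult_mono B C)
        show "fst x \<in> {-p..p}" using x by (auto simp: mem_sq)
      qed (use BC \<open>c \<ge> 0\<close> in auto)
      finally show ?thesis by (simp add: mult_ac)
    qed
    then show ?thesis by simp
  qed
  with BC show ?case by (intro exI[of _ "B * C"]) auto
next
  case (Suc j)
  obtain g' where g': "trig_poly g'" "\<And>x. (g has_real_derivative g' x) (at x)"
    using trig_poly_deriv[OF Suc.prems(2)] by blast
  let ?a' = "\<lambda>x. vector_derivative a (at x)"
  have a': "smooth_on {-r<..<r} ?a'" "\<And>x. x \<in> {-r<..<r} \<Longrightarrow> (a has_vector_derivative ?a' x) (at x)"
    using smooth_on_vector_derivative[OF _ Suc.prems(1)] by auto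
  obtain B where B: "\<And>x. \<bar>g x\<bar> \<le> B" using trig_poly_bounded[OF Suc.prems(2)] by blast
  obtain M1 where M1: "M1 \<ge> 0" "\<And>lam c. lam \<ge> 1 \<Longrightarrow> c \<ge> 0 \<Longrightarrow> Ck_bound j (sq p) (\<lambda>x. (c * g (lam * snd x)) *\<^sub>R ?a' (fst x)) (M1 * c * lam ^ j)"
    using Suc.IH[OF a'(1) Suc.prems(2)] by blast
  obtain M2 where M2: "M2 \<ge> 0" "\<And>lam c. lam \<ge> 1 \<Longrightarrow> c \<ge> 0 \<Longrightarrow> Ck_bound j (sq p) (\<lambda>x. (c * g' (lam * snd x)) *\<^sub>R a (fst x)) (M2 * c * lam ^ j)"
    using Suc.IH[OF Suc.prems(1) g'(1)] by blast
  obtain M0 where M0: "M0 \<ge> 0" "\<And>lam c. lam \<ge> 1 \<Longrightarrow> c \<ge> 0 \<Longrightarrow> Ck_bound j (sq p) (\<lambda>x. (c * g (lam * snd x)) *\<^sub>R a (fst x)) (M0 * c * lam ^ j)"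
    using Suc.IH[OF Suc.prems] by blast
  define M where "M = M0 + M1 + M2"
  have "Ck_bound (Suc j) (sq p) (\<lambda>x. (c * g (lam * snd x)) *\<^sub>R a (fst x)) (M * c * lam ^ Suc j)"
    if lam: "lam \<ge> 1" and c: "c \<ge> 0" for lam c
  proof (rule Ck_bound_SucI2[OF open_sq])
    have le: "Mi * c * lam ^ j \<le> M * c * lam ^ Suc j" if "0 \<le> Mi" "Mi \<le> M" for Mi
      using that lam c by (intro mult_mono power_increasing mult_right_mono) auto
    show "norm ((c * g (lam * snd x)) *\<^sub>R a (fst x)) \<le> M * c * lam ^ Suc j" if "x \<in> sq p" for x
      using order_trans[OF Ck_bound_norm[OF M0(2)[OF lam c] that] le[of M0]] M0(1) M1(1) M2(1) by (simp add: M_def)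
    show "Ck_bound j (sq p) (\<lambda>x. (c * g (lam * snd x)) *\<^sub>R ?a' (fst x)) (M * c * lam ^ Suc j)"
      by (rule Ck_bound_mono[OF M1(2)[OF lam c] le]) (use M0(1) M1(1) M2(1) in \<open>simp_all add: M_def\<close>)
    show "Ck_bound j (sq p) (\<lambda>x. (c * lam * g' (lam * snd x)) *\<^sub>R a (fst x)) (M * c * lam ^ Suc j)"
    proof (rule Ck_bound_mono[OF M2(2)[OF lam]])
      show "M2 * (c * lam) * lam ^ j \<le> M * c * lam ^ Suc j"
      proof -
        have "M2 * (c * lam * lam ^ j) \<le> M * (c * lam * lam ^ j)"
          using M0(1) M1(1) lam c by (intro mult_right_mono) (auto simp: M_def)
        then show ?thesis by (simp add: mult_ac)
      qed
    qed (use lam c in auto)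
    show "((\<lambda>x. (c * g (lam * snd x)) *\<^sub>R a (fst x)) has_derivative
       (\<lambda>h. fst h *\<^sub>R ((c * g (lam * snd x)) *\<^sub>R ?a' (fst x)) + snd h *\<^sub>R ((c * lam * g' (lam * snd x)) *\<^sub>R a (fst x)))) (at x)"
      if x: "x \<in> sq p" for x
    proof -
      have 1: "((\<lambda>x. c * g (lam * snd x)) has_derivative (\<lambda>h. c * (g' (lam * snd x) * (lam * snd h)))) (at x)"
      proof -
        have A: "((\<lambda>x. lam * snd x) has_derivative (\<lambda>h. lam * snd h)) (at x)"
          by (intro has_derivative_mult_right has_derivative_snd has_derivative_ident)
        have B: "(g has_derivative (\<lambda>h. g' (lam * snd x) * h)) (at (lam * snd x))"
          using g'(2)[of "lam * snd x"] by (simp add: has_field_derivative_def)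
        show ?thesis
          by (rule has_derivative_mult_right[OF has_derivative_compose[OF A B]])
      qed
      have 2: "((\<lambda>x. a (fst x)) has_derivative (\<lambda>h. fst h *\<^sub>R ?a' (fst x))) (at x)"
      proof -
        have "fst x \<in> {-r<..<r}" using x assms(4) by (auto simp: mem_sq)
        from a'(2)[OF this] have "(a has_derivative (\<lambda>h. h *\<^sub>R ?a' (fst x))) (at (fst x))"
          by (simp add: has_vector_derivative_def)
        from has_derivative_compose[OF has_derivative_fst[OF has_derivative_ident] this] show ?thesis .
      qed
      show ?thesis
        by (rule has_derivative_eq_rhs[OF has_derivative_scaleR[OF 1 2]]) (auto simp: algebra_simps)
    qed
    have af: "smooth_on (sq p) (\<lambda>x. b (fst x))" if "smooth_on {-r<..<r} b" for b :: "real \<Rightarrow> 'a"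
      by (rule smooth_on_compose[OF that]) (use assms(4) in \<open>auto simp: mem_sq intro!: smooth_on_intros\<close>)
    have gf: "smooth_on (sq p) (\<lambda>x. k (lam * snd x))" if "trig_poly k" for k
      by (rule smooth_on_compose[OF trig_poly_smooth[OF that]]) (auto intro!: smooth_on_intros)
    show "smooth_on (sq p) (\<lambda>x. (c * g (lam * snd x)) *\<^sub>R ?a' (fst x))"
      "smooth_on (sq p) (\<lambda>x. (c * lam * g' (lam * snd x)) *\<^sub>R a (fst x))"
      by (intro smooth_on_scaleR smooth_on_mult af gf a' g' Suc.prems smooth_on_const open_sq)+
  qed
  moreover have "M \<ge> 0" using M0(1) M1(1) M2(1) by (simp add: M_def)
  ultimately show ?case by blast
qed

section \<open>Sine series for Borel's lemma along the axis\<close>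

definition sin_term :: "real \<Rightarrow> nat \<Rightarrow> (real \<Rightarrow> 'a::real_normed_vector) \<Rightarrow> real \<times> real \<Rightarrow> 'a" where
  "sin_term lam k a x = (sin (lam * snd x) / lam) ^ k *\<^sub>R a (fst x)"

text \<open>The two bounds have different purposes: the pointwise one makes the tails of the series
  vanish to high order on the axis, the one on derivatives makes the series smooth. The term
  \<open>k = 0\<close> has no power of \<open>1 / lam\<close> to spend, so nothing is asked of its
  derivatives.\<close>

definition sin_term_small :: "real \<Rightarrow> nat \<Rightarrow> (real \<Rightarrow> 'a::euclidean_space) \<Rightarrow> real \<Rightarrow> bool" where
  "sin_term_small p k a lam \<longleftrightarrow> lam \<ge> 1 \<and> (\<forall>u. \<bar>u\<bar> < p \<longrightarrow> norm (a u) \<le> lam * (1/2)^k) \<and>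
     (k \<ge> 1 \<longrightarrow> Ck_bound (k - 1) (sq p) (sin_term lam k a) ((1/2)^k))"

text \<open>A derivative of order below \<open>k\<close> costs at most \<open>lam^(k - 1)\<close>
  against the prefactor \<open>1 / lam^k\<close>, which leaves \<open>M / lam\<close>.\<close>

lemma sin_term_small_ex:
  fixes a :: "real \<Rightarrow> 'a::euclidean_space"
  assumes "smooth_on {-r<..<r} a" "0 < p" "p < r"
  shows "\<exists>L. \<forall>lam\<ge>L. sin_term_small p k a lam"
proof -
  obtain M where M: "M \<ge> 0" "\<And>lam c. lam \<ge> 1 \<Longrightarrow> c \<ge> 0 \<Longrightarrow>
      Ck_bound (k - 1) (sq p) (\<lambda>x. (c * sin (lam * snd x) ^ k) *\<^sub>R a (fst x)) (M * c * lam ^ (k - 1))"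
    using Ck_bound_scaled[OF assms(1) trig_poly_sin_power[of k] assms(2,3), of "k - 1"] by blast
  obtain C where C: "C \<ge> 0" "\<And>lam c. lam \<ge> 1 \<Longrightarrow> c \<ge> 0 \<Longrightarrow>
      Ck_bound 0 (sq p) (\<lambda>x. (c * 1) *\<^sub>R a (fst x)) (C * c * lam ^ 0)"
    using Ck_bound_scaled[OF assms(1) trig_const[of 1] assms(2,3), of 0] by blast
  have aC: "norm (a u) \<le> C" if "\<bar>u\<bar> < p" for u
    using C(2)[of 1 1] that assms(2) by (auto simp: mem_sq dest: bspec[of _ _ "(u, 0)"])
  \<comment> \<open>Beyond this threshold both \<open>M / lam\<close> and \<open>C / lam\<close> are
    at most \<open>(1/2)^k\<close>.\<close>
  have "sin_term_small p k a lam" if lam: "lam \<ge> max 1 (2^k * (M + C))" for lam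
  proof -
    have l1: "lam \<ge> 1" and l2: "2^k * (M + C) \<le> lam" using lam by auto
    have l3: "M + C \<le> lam * (1/2)^k" using l2 by (simp add: field_simps)
    have "Ck_bound (k - 1) (sq p) (sin_term lam k a) ((1/2)^k)" if k: "k \<ge> 1"
    proof -
      have "M * (1 / lam ^ k) * lam ^ (k - 1) \<le> (1/2)^k"
      proof -
        have "M * (1 / lam ^ k) * lam ^ (k - 1) = M / lam"
          using k l1 by (cases k) (auto simp: field_simps)
        moreover have "M \<le> (1/2)^k * lam" using l3 C(1) by (simp add: mult.commute)
        ultimately show ?thesis using l1 by (simp add: pos_divide_le_eq)
      qed
      from Ck_bound_mono[OF M(2)[OF l1, of "1 / lam ^ k"] this] l1
      show ?thesis by (simp add: sin_term_def[abs_def] power_divide)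
    qed
    with l1 l3 aC M(1) show ?thesis
      unfolding sin_term_small_def by (meson add_increasing order_trans order_refl)
  qed
  then show ?thesis by blast
qed

lemma smooth_on_sin_term:
  assumes "smooth_on {-r<..<r} a" "p \<le> r" "lam \<noteq> 0"
  shows "smooth_on (sq p) (sin_term lam k a)"
  unfolding sin_term_def[abs_def]
  by (intro smooth_on_intros smooth_on_compose[OF assms(1)]) (use assms in \<open>auto simp: mem_sq\<close>)

lemma smooth_on_sin_series:
  fixes a :: "nat \<Rightarrow> real \<Rightarrow> 'a::euclidean_space"
  assumes "\<And>k. smooth_on {-r<..<r} (a k)" "p < r" "\<And>k. sin_term_small p k (a k) (lam k)"
  shows "smooth_on (sq p) (\<lambda>x. \<Sum>k. sin_term (lam k) k (a k) x)"
proof (rule smooth_on_suminf[where m = 1, OF open_sq convex_sq])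
  fix k
  have "lam k \<noteq> 0" using assms(3)[of k] by (auto simp: sin_term_small_def)
  then show "smooth_on (sq p) (sin_term (lam k) k (a k))"
    using assms(2) by (intro smooth_on_sin_term[OF assms(1)]) auto
  show "1 \<le> k \<Longrightarrow> Ck_bound (k - 1) (sq p) (sin_term (lam k) k (a k)) ((1/2)^k)"
    using assms(3)[of k] by (simp add: sin_term_small_def)
qed

text \<open>Of the \<open>k > m\<close> factors, \<open>m\<close> are estimated by
  \<open>|y|\<close>, one by \<open>1 / lam\<close> to cancel the growth allowed to
  \<open>a\<close>, and the others by 1.\<close>

lemma sin_term_bound:
  assumes "sin_term_small p k a lam" "m < k" "\<bar>u\<bar> < p" "\<bar>y\<bar> \<le> 1"
  shows "norm (sin_term lam k a (u, y)) \<le> \<bar>y\<bar>^m * (1/2)^k"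
proof -
  have lam: "lam \<ge> 1" "norm (a u) \<le> lam * (1/2)^k"
    using assms by (auto simp: sin_term_small_def)
  obtain d where d: "k = m + Suc d" using assms(2) less_iff_Suc_add by auto
  let ?s = "sin (lam * y) / lam"
  have s1: "\<bar>?s\<bar> \<le> \<bar>y\<bar>"
    using abs_sin_x_le_abs_x[of "lam * y"] lam by (simp add: abs_mult field_simps)
  have s2: "\<bar>?s\<bar> \<le> 1 / lam" using lam abs_sin_le_one[of "lam * y"] by (simp add: field_simps)
  have "norm (sin_term lam k a (u, y)) = \<bar>?s\<bar>^m * (\<bar>?s\<bar>^d * \<bar>?s\<bar>) * norm (a u)"
    by (simp add: sin_term_def d power_add power_abs abs_mult mult_ac)
  also have "\<dots> \<le> \<bar>y\<bar>^m * (1 * (1 / lam)) * (lam * (1/2)^k)"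
    using s1 s2 lam assms(4) order_trans[OF s1 assms(4)]
    by (intro mult_mono power_mono power_le_one) auto
  finally show ?thesis using lam by simp
qed

text \<open>\<open>sin (lam y) / lam\<close> is \<open>y\<close> times a smooth function with value
  1 at 0; the normalisation by \<open>lam\<close> is what makes the leading coefficient independent
  of \<open>lam\<close>.\<close>

lemma sin_power_expansion:
  fixes lam R :: real
  assumes "lam \<noteq> 0" "R > 0"
  obtains s where "smooth_on {-R<..<R} s"
    "\<And>y. \<bar>y\<bar> < R \<Longrightarrow> (sin (lam * y) / lam) ^ k = y ^ k * (1 + y * s y)"
proof -
  have "smooth_on {-R<..<R} (\<lambda>y. sin (lam * y) / lam)"
    by (intro smooth_on_intros) (use assms in auto)
  then obtain q where q: "smooth_on {-R<..<R} q" "\<And>y. \<bar>y\<bar> < R \<Longrightarrow> sin (lam * y) / lam = y * q y"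
    using hadamard_1d[of R "\<lambda>y. sin (lam * y) / lam"] by auto
  have q0: "q 0 = 1"
  proof (rule DERIV_unique[of "\<lambda>y. y * q y" _ 0])
    have "(q has_real_derivative deriv q 0) (at 0)"
      using smooth_on_deriv(2)[OF _ q(1)] assms by auto
    from DERIV_mult[OF DERIV_ident this] show "((\<lambda>y. y * q y) has_real_derivative q 0) (at 0)" by simp
    have "((\<lambda>y. sin (lam * y) / lam) has_real_derivative 1) (at 0)"
      using assms by (auto intro!: derivative_eq_intros)
    then show "((\<lambda>y. y * q y) has_real_derivative 1) (at 0)"
      by (rule has_field_derivative_transform_within_open[of _ _ _ "{-R<..<R}"]) (use q assms in auto)
  qed
  have "smooth_on {-R<..<R} (\<lambda>y. q y ^ k)"
    by (intro smooth_on_intros q) auto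
  then obtain s where s: "smooth_on {-R<..<R} s" "\<And>y. \<bar>y\<bar> < R \<Longrightarrow> q y ^ k = q 0 ^ k + y * s y"
    using hadamard_1d[of R "\<lambda>y. q y ^ k"] by auto
  show thesis
    by (rule that[OF s(1)]) (simp add: q s power_mult_distrib q0)
qed

text \<open>Two applications of Hadamard's lemma split off the value and the first derivative of
  \<open>h\<close> in \<open>v\<close> on the axis. These are the next coefficients of the even and
  the odd part. Using sine terms in place of the powers of \<open>v^2\<close> costs only higher
  order, which goes into the next remainder.\<close>

lemma whitney_step:
  fixes h :: "real \<times> real \<Rightarrow> 'a::euclidean_space"
  assumes h: "smooth_on (sq r) h" and r: "0 < p" "p < r" "r \<le> 1"
  obtains b d lam h' where "smooth_on {-r<..<r} b" "smooth_on {-r<..<r} d" "smooth_on (sq r) h'"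
    "sin_term_small p k b lam" "sin_term_small p k d lam"
    "\<And>u v. (u, v) \<in> sq r \<Longrightarrow> v^(2*k) *\<^sub>R h (u, v) =
       sin_term lam k b (u, v\<^sup>2) + v *\<^sub>R sin_term lam k d (u, v\<^sup>2) + v^(2 * Suc k) *\<^sub>R h' (u, v)"
proof -
  have axis: "smooth_on {-r<..<r} (\<lambda>u. g (u, 0))" if "smooth_on (sq r) g" for g :: "real \<times> real \<Rightarrow> 'a"
    by (rule smooth_on_compose[OF that]) (use r in \<open>auto simp: mem_sq intro!: smooth_on_intros\<close>)
  have comp1: "smooth_on (sq r) (\<lambda>x. b (fst x))" if "smooth_on {-r<..<r} b" for b :: "real \<Rightarrow> 'a"
    by (rule smooth_on_compose[OF that]) (auto simp: mem_sq intro!: smooth_on_intros)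
  obtain q1 where q1: "smooth_on (sq r) q1" "\<And>u v. (u, v) \<in> sq r \<Longrightarrow> h (u, v) = h (u, 0) + v *\<^sub>R q1 (u, v)"
    using hadamard[OF h] by blast
  obtain q2 where q2: "smooth_on (sq r) q2" "\<And>u v. (u, v) \<in> sq r \<Longrightarrow> q1 (u, v) = q1 (u, 0) + v *\<^sub>R q2 (u, v)"
    using hadamard[OF q1(1)] by blast
  define b where "b = (\<lambda>u. h (u, 0))"
  define d where "d = (\<lambda>u. q1 (u, 0))"
  have b: "smooth_on {-r<..<r} b" and d: "smooth_on {-r<..<r} d"
    using axis[OF h] axis[OF q1(1)] by (simp_all add: b_def d_def)
  obtain L1 where L1: "\<And>lam. lam \<ge> L1 \<Longrightarrow> sin_term_small p k b lam"
    using sin_term_small_ex[OF b r(1,2)] by blast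
  obtain L2 where L2: "\<And>lam. lam \<ge> L2 \<Longrightarrow> sin_term_small p k d lam"
    using sin_term_small_ex[OF d r(1,2)] by blast
  define lam where "lam = max L1 L2"
  have small: "sin_term_small p k b lam" "sin_term_small p k d lam"
    using L1 L2 by (auto simp: lam_def)
  then have "lam \<noteq> 0" by (auto simp: sin_term_small_def)
  then obtain s where s: "smooth_on {-2<..<2} s"
    "\<And>y. \<bar>y\<bar> < 2 \<Longrightarrow> (sin (lam * y) / lam) ^ k = y ^ k * (1 + y * s y)"
    using sin_power_expansion[of lam 2 k] by auto
  \<comment> \<open>With \<open>y = v^2\<close>, the sine term exceeds \<open>y^k\<close> by
    \<open>y^(k+1) s y\<close>; the correction removes this excess from \<open>q2\<close>.\<close>
  define h' where "h' = (\<lambda>x. q2 x - s ((snd x)\<^sup>2) *\<^sub>R (b (fst x) + snd x *\<^sub>R d (fst x)))"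
  have v1: "v\<^sup>2 < 2" if "(u, v) \<in> sq r" for u v
    using that r power_le_one[of "\<bar>v\<bar>" 2] by (auto simp: mem_sq)
  have s': "smooth_on (sq r) (\<lambda>x. s ((snd x)\<^sup>2))"
  proof (rule smooth_on_compose[OF s(1)])
    show "(snd x)\<^sup>2 \<in> {-2<..<2}" if "x \<in> sq r" for x
      using v1[of "fst x" "snd x"] that less_le_trans[OF _ zero_le_power2[of "snd x"], of "-2"] by auto
  qed (auto intro!: smooth_on_intros)
  show thesis
  proof (rule that[OF b d _ small])
    show "smooth_on (sq r) h'"
      unfolding h'_def by (intro smooth_on_intros q2 s' comp1 b d open_sq)
    fix u v assume x: "(u, v) \<in> sq r"
    have sb: "sin_term lam k a (u, v\<^sup>2) = (v^(2*k) * (1 + v\<^sup>2 * s (v\<^sup>2))) *\<^sub>R a u" for a :: "real \<Rightarrow> 'a"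
      using s(2)[of "v\<^sup>2"] v1[OF x] by (simp add: sin_term_def power_mult)
    have hx: "h (u, v) = b u + v *\<^sub>R d u + v\<^sup>2 *\<^sub>R q2 (u, v)"
      using q1(2)[OF x] q2(2)[OF x] by (simp add: b_def d_def algebra_simps power2_eq_square)
    have p: "v^(2 * Suc k) = v^(2*k) * v\<^sup>2" by (simp add: power_add power2_eq_square)
    show "v^(2*k) *\<^sub>R h (u, v) =
       sin_term lam k b (u, v\<^sup>2) + v *\<^sub>R sin_term lam k d (u, v\<^sup>2) + v^(2 * Suc k) *\<^sub>R h' (u, v)"
      unfolding sb hx p h'_def by (simp add: algebra_simps)
  qed
qed

text \<open>The sine series realise all Taylor coefficients of \<open>h\<close> along the axis at
  once. Comparing with the partial sums of length \<open>Suc m\<close> bounds the remainder by a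
  constant times \<open>|v|^m\<close> for every \<open>m\<close>, hence it is flat.\<close>

lemma borel_even_odd:
  fixes h :: "real \<times> real \<Rightarrow> 'a::euclidean_space"
  assumes h: "smooth_on (sq r) h" and r: "0 < p" "p < r" "r \<le> 1"
  obtains E Od where "smooth_on (sq p) E" "smooth_on (sq p) Od"
    "flat p (\<lambda>x. h x - E (fst x, (snd x)\<^sup>2) - snd x *\<^sub>R Od (fst x, (snd x)\<^sup>2))"
proof -
  define Q where "Q = (\<lambda>k h h' (b :: real \<Rightarrow> 'a) d lam. smooth_on {-r<..<r} b \<and> smooth_on {-r<..<r} d \<and>
    sin_term_small p k b lam \<and> sin_term_small p k d lam \<and>
    (\<forall>u v. (u, v) \<in> sq r \<longrightarrow> v^(2*k) *\<^sub>R h (u, v) =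
       sin_term lam k b (u, v\<^sup>2) + v *\<^sub>R sin_term lam k d (u, v\<^sup>2) + v^(2 * Suc k) *\<^sub>R h' (u, v)))"
  \<comment> \<open>Each step consumes the remainder of the previous one, so the remainders are
    produced by dependent choice; coefficients and frequencies are chosen afterwards.\<close>
  have "\<exists>H. \<forall>k. (smooth_on (sq r) (H k) \<and> (k = 0 \<longrightarrow> H k = h)) \<and> (\<exists>b d lam. Q k (H k) (H (Suc k)) b d lam)"
  proof (rule dependent_nat_choice)
    show "\<exists>x. smooth_on (sq r) x \<and> (0 = (0::nat) \<longrightarrow> x = h)" using h by blast
    fix H :: "real \<times> real \<Rightarrow> 'a" and k :: nat
    assume "smooth_on (sq r) H \<and> (k = 0 \<longrightarrow> H = h)"
    then have "smooth_on (sq r) H" by blast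
    from whitney_step[OF this r, of k]
    show "\<exists>y. (smooth_on (sq r) y \<and> (Suc k = 0 \<longrightarrow> y = h)) \<and> (\<exists>b d lam. Q k H y b d lam)"
      unfolding Q_def by (metis nat.distinct(1))
  qed
  then obtain H where H: "\<And>k. smooth_on (sq r) (H k)" "H 0 = h" and "\<forall>k. \<exists>b d lam. Q k (H k) (H (Suc k)) b d lam"
    by blast
  then obtain b d lam where "\<forall>k. Q k (H k) (H (Suc k)) (b k) (d k) (lam k)"
    by metis
  then have b: "\<And>k. smooth_on {-r<..<r} (b k)" and d: "\<And>k. smooth_on {-r<..<r} (d k)"
    and sb: "\<And>k. sin_term_small p k (b k) (lam k)" and sd: "\<And>k. sin_term_small p k (d k) (lam k)"
    and step: "\<And>k u v. (u, v) \<in> sq r \<Longrightarrow> v^(2*k) *\<^sub>R H k (u, v) =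
       sin_term (lam k) k (b k) (u, v\<^sup>2) + v *\<^sub>R sin_term (lam k) k (d k) (u, v\<^sup>2) + v^(2 * Suc k) *\<^sub>R H (Suc k) (u, v)"
    unfolding Q_def by blast+
  define E where "E = (\<lambda>x. \<Sum>k. sin_term (lam k) k (b k) x)"
  define Od where "Od = (\<lambda>x. \<Sum>k. sin_term (lam k) k (d k) x)"
  have E: "smooth_on (sq p) E" and Od: "smooth_on (sq p) Od"
    unfolding E_def Od_def by (rule smooth_on_sin_series[OF b r(2) sb] smooth_on_sin_series[OF d r(2) sd])+
  have sq_p: "(fst x, (snd x)\<^sup>2) \<in> sq p" if "x \<in> sq p" for x
    using that r mult_left_le_one_le[of "\<bar>snd x\<bar>" "\<bar>snd x\<bar>"] by (auto simp: mem_sq power2_eq_square)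
  have partial: "h (u, v) = (\<Sum>k<m. sin_term (lam k) k (b k) (u, v\<^sup>2)) + v *\<^sub>R (\<Sum>k<m. sin_term (lam k) k (d k) (u, v\<^sup>2))
      + v^(2*m) *\<^sub>R H m (u, v)" if "(u, v) \<in> sq r" for u v m
  proof (induction m)
    case 0
    then show ?case by (simp add: H)
  next
    case (Suc m)
    then show ?case using step[OF that, of m] by (simp add: algebra_simps)
  qed
  let ?R = "\<lambda>x. h x - E (fst x, (snd x)\<^sup>2) - snd x *\<^sub>R Od (fst x, (snd x)\<^sup>2)"
  \<comment> \<open>Summing \<open>Suc m\<close> terms leaves indices strictly above
    \<open>m\<close>, the range where \<open>sin_term_bound\<close> applies.\<close>
  have tail: "norm ((\<Sum>k. sin_term (lam k) k (a k) (u, y)) - (\<Sum>k<Suc m. sin_term (lam k) k (a k) (u, y))) \<le> \<bar>y\<bar>^m * 2"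
    if a: "\<And>k. sin_term_small p k (a k) (lam k)" and uy: "(u, y) \<in> sq p" for a :: "nat \<Rightarrow> real \<Rightarrow> 'a" and u y m
  proof -
    let ?t = "\<lambda>k. sin_term (lam k) k (a k) (u, y)"
    have geo: "summable (\<lambda>k. (1/2)^k :: real)" by (rule summable_geometric) simp
    have u: "\<bar>u\<bar> < p" "\<bar>y\<bar> \<le> 1" using uy r by (auto simp: mem_sq)
    have bd: "norm (?t (k + Suc m)) \<le> \<bar>y\<bar>^m * (1/2)^k" for k
    proof -
      have "norm (?t (k + Suc m)) \<le> \<bar>y\<bar>^m * (1/2)^(k + Suc m)"
        by (rule sin_term_bound[OF a _ u]) simp
      also have "\<dots> \<le> \<bar>y\<bar>^m * (1/2)^k"
        by (intro mult_left_mono power_decreasing) auto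
      finally show ?thesis .
    qed
    have summ: "summable (\<lambda>k. norm (?t (k + Suc m)))"
    proof (rule summable_comparison_test[OF _ summable_mult[OF geo, of "\<bar>y\<bar>^m"]])
      show "\<exists>N. \<forall>k\<ge>N. norm (norm (?t (k + Suc m))) \<le> \<bar>y\<bar>^m * (1/2)^k"
        by (intro exI[of _ 0] allI impI) (simp only: real_norm_def abs_norm_cancel bd)
    qed
    then have "summable (\<lambda>k. ?t (k + Suc m))" by (rule summable_norm_cancel)
    then have "summable ?t" by (rule iffD1[OF summable_iff_shift[of ?t "Suc m"]])
    then have "(\<Sum>k. ?t k) - (\<Sum>k<Suc m. ?t k) = (\<Sum>k. ?t (k + Suc m))"
      using suminf_minus_initial_segment[of ?t "Suc m"] by simp
    also have "norm \<dots> \<le> (\<Sum>k. norm (?t (k + Suc m)))"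
      by (rule summable_norm[OF summ])
    also have "\<dots> \<le> (\<Sum>k. \<bar>y\<bar>^m * (1/2)^k)"
      by (rule suminf_le[OF bd summ summable_mult[OF geo]])
    also have "\<dots> = \<bar>y\<bar>^m * 2"
      using suminf_mult[OF geo, of "\<bar>y\<bar>^m"] suminf_geometric[of "1/2::real"] by simp
    finally show ?thesis .
  qed
  have "flat p ?R"
  proof (rule flatI_bounded)
    have "smooth_on (sq p) (\<lambda>x. g (fst x, (snd x)\<^sup>2))" if "smooth_on (sq p) g" for g :: "real \<times> real \<Rightarrow> 'a"
      by (rule smooth_on_compose[OF that]) (auto intro!: smooth_on_intros simp: sq_p)
    then show "smooth_on (sq p) ?R"
      using smooth_on_subset[OF h sq_mono[of p r]] r E Od
      by (intro smooth_on_intros) auto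
    fix m
    have "bounded (H (Suc m) ` ({-p..p} \<times> {-p..p}))"
      by (intro compact_imp_bounded compact_continuous_image compact_Times
           continuous_on_subset[OF smooth_on_imp_continuous_on[OF H(1)]]) (use r in \<open>auto simp: mem_sq\<close>)
    then obtain C where C: "\<And>x. x \<in> {-p..p} \<times> {-p..p} \<Longrightarrow> norm (H (Suc m) x) \<le> C"
      unfolding bounded_iff by blast
    have "norm (?R x) \<le> (C + 4) * \<bar>snd x\<bar>^m" if x: "x \<in> sq p" for x
    proof -
      obtain u v where uv: "x = (u, v)" by (cases x)
      have xr: "(u, v) \<in> sq r" using x r by (auto simp: mem_sq uv)
      have v1: "\<bar>v\<bar> \<le> 1" using x r by (auto simp: mem_sq uv)
      let ?y = "v\<^sup>2"
      let ?e = "E (u, ?y) - (\<Sum>k<Suc m. sin_term (lam k) k (b k) (u, ?y))"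
      let ?o = "Od (u, ?y) - (\<Sum>k<Suc m. sin_term (lam k) k (d k) (u, ?y))"
      have y: "(u, ?y) \<in> sq p" using sq_p[OF x] by (simp add: uv)
      have pw: "\<bar>?y\<bar>^m \<le> \<bar>v\<bar>^m"
        using v1 power_decreasing[of m "2*m" "\<bar>v\<bar>"] by (simp add: power_mult)
      have pw2: "\<bar>v^(2 * Suc m)\<bar> \<le> \<bar>v\<bar>^m"
        unfolding power_abs by (rule power_decreasing) (use v1 in auto)
      have "?R x = v^(2 * Suc m) *\<^sub>R H (Suc m) (u, v) - ?e - v *\<^sub>R ?o"
        using partial[OF xr, of "Suc m"] by (simp only: uv fst_conv snd_conv) (simp add: algebra_simps)
      also have "norm \<dots> \<le> norm (v^(2 * Suc m) *\<^sub>R H (Suc m) (u, v)) + norm ?e + norm (v *\<^sub>R ?o)"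
        by (rule order_trans[OF norm_triangle_ineq4]) (intro add_right_mono norm_triangle_ineq4)
      also have "\<dots> \<le> \<bar>v\<bar>^m * C + \<bar>v\<bar>^m * 2 + \<bar>v\<bar>^m * 2"
      proof (intro add_mono)
        show "norm (v^(2 * Suc m) *\<^sub>R H (Suc m) (u, v)) \<le> \<bar>v\<bar>^m * C"
          unfolding norm_scaleR
        proof (intro mult_mono pw2 C)
          show "(u, v) \<in> {-p..p} \<times> {-p..p}" using x by (auto simp: mem_sq uv)
        qed auto
        show "norm ?e \<le> \<bar>v\<bar>^m * 2"
          using tail[OF sb y, of m] pw unfolding E_def by linarith
        have "norm ?o \<le> \<bar>v\<bar>^m * 2"
          using tail[OF sd y, of m] pw unfolding Od_def by linarith
        then show "norm (v *\<^sub>R ?o) \<le> \<bar>v\<bar>^m * 2"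
          using mult_left_le_one_le[of "norm ?o" "\<bar>v\<bar>"] v1 by simp
      qed
      finally show ?thesis by (simp add: uv algebra_simps)
    qed
    then show "\<exists>C. \<forall>x\<in>sq p. norm (?R x) \<le> C * \<bar>snd x\<bar>^m" by blast
  qed
  with E Od show thesis using that by blast
qed

text \<open>After Borel summation only a flat remainder is left. Its even part, and its odd part
  divided by \<open>v\<close>, are flat as well, so the root substitution writes both as smooth
  functions of \<open>v^2\<close>.\<close>

theorem whitney_even_odd:
  fixes h :: "real \<times> real \<Rightarrow> 'a::euclidean_space"
  assumes h: "smooth_on (sq r) h" and "0 < r"
  obtains p E Od where "0 < p" "p \<le> r" "smooth_on (sq p) E" "smooth_on (sq p) Od"
    "\<And>u v. (u, v) \<in> sq p \<Longrightarrow> h (u, v) = E (u, v\<^sup>2) + v *\<^sub>R Od (u, v\<^sup>2)"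
proof -
  define r1 where "r1 = min r 1"
  define q where "q = r1 / 2"
  have rq: "0 < q" "q < r1" "r1 \<le> 1" "r1 \<le> r" using \<open>0 < r\<close> by (auto simp: r1_def q_def)
  obtain E Od where E: "smooth_on (sq q) E" and Od: "smooth_on (sq q) Od"
    and fl: "flat q (\<lambda>x. h x - E (fst x, (snd x)\<^sup>2) - snd x *\<^sub>R Od (fst x, (snd x)\<^sup>2))"
    using borel_even_odd[OF smooth_on_subset[OF h sq_mono[OF rq(4)]] rq(1-3)] by blast
  define R where "R = (\<lambda>x. h x - E (fst x, (snd x)\<^sup>2) - snd x *\<^sub>R Od (fst x, (snd x)\<^sup>2))"
  have R: "flat q R" using fl by (simp add: R_def)
  define Re where "Re = (\<lambda>x. (1/2) *\<^sub>R (R x + R (fst x, - snd x)))"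
  define Ro where "Ro = (\<lambda>x. (1 / snd x) *\<^sub>R (1/2) *\<^sub>R (R x + (-1) *\<^sub>R R (fst x, - snd x)))"
  have fe: "flat q Re" and fo: "flat q Ro"
    unfolding Re_def Ro_def by (intro flat_quotient flat_scaleR flat_add flat_reflect R)+
  \<comment> \<open>The root functions are smooth only for second coordinate below
    \<open>q^2\<close>.\<close>
  define p where "p = q\<^sup>2"
  have q1: "q < 1" using rq by linarith
  have p: "0 < p" "p \<le> q" using rq q1 by (auto simp: p_def power2_eq_square mult_left_le)
  have sub: "sq p \<subseteq> {-q<..<q} \<times> {..<q\<^sup>2}" using p by (auto simp: mem_sq p_def)
  show thesis
  proof (rule that[of p "\<lambda>x. E x + root_fun Re x" "\<lambda>x. Od x + root_fun Ro x"])
    show "0 < p" by fact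
    show "p \<le> r" using p rq by linarith
    show "smooth_on (sq p) (\<lambda>x. E x + root_fun Re x)" "smooth_on (sq p) (\<lambda>x. Od x + root_fun Ro x)"
      using smooth_on_subset[OF E sq_mono[OF p(2)]] smooth_on_subset[OF Od sq_mono[OF p(2)]]
        smooth_on_subset[OF smooth_on_root_fun[OF fe] sub] smooth_on_subset[OF smooth_on_root_fun[OF fo] sub]
      by (auto intro: smooth_on_add)
    fix u v assume uv: "(u, v) \<in> sq p"
    have R0: "R (u, 0) = 0" using flat_axis[OF R] uv p by (auto simp: mem_sq)
    have "R (u, v) = root_fun Re (u, v\<^sup>2) + v *\<^sub>R root_fun Ro (u, v\<^sup>2)"
    proof (cases "v = 0")
      case True
      then show ?thesis by (simp add: R0 root_fun_def)
    next
      case False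
      \<comment> \<open>Since \<open>sqrt (v^2)\<close> is \<open>|v|\<close>, the symmetrised
        values at \<open>|v|\<close> have to be compared with those at \<open>v\<close>.\<close>
      have av: "R (u, \<bar>v\<bar>) + R (u, - \<bar>v\<bar>) = R (u, v) + R (u, - v)"
        "(v / \<bar>v\<bar>) *\<^sub>R (R (u, \<bar>v\<bar>) - R (u, - \<bar>v\<bar>)) = R (u, v) - R (u, - v)"
        using False by (cases "v > 0"; simp add: algebra_simps abs_if)+
      have "root_fun Re (u, v\<^sup>2) + v *\<^sub>R root_fun Ro (u, v\<^sup>2) =
          (1/2) *\<^sub>R (R (u, \<bar>v\<bar>) + R (u, - \<bar>v\<bar>)) + (1/2) *\<^sub>R (v / \<bar>v\<bar>) *\<^sub>R (R (u, \<bar>v\<bar>) - R (u, - \<bar>v\<bar>))"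
        using False by (simp add: root_fun_def Re_def Ro_def)
      also have "\<dots> = R (u, v)"
        unfolding av by (simp add: scaleR_add_left[symmetric] algebra_simps)
      finally show ?thesis by simp
    qed
    then show "h (u, v) = E (u, v\<^sup>2) + root_fun Re (u, v\<^sup>2) + v *\<^sub>R (Od (u, v\<^sup>2) + root_fun Ro (u, v\<^sup>2))"
      by (simp add: R_def algebra_simps)
  qed
qed

section \<open>A criterion for cuspidal edges\<close>

lemma smooth_on_det:
  fixes A :: "'a::euclidean_space \<Rightarrow> real^'n^'n"
  assumes "open S" "\<And>i j. smooth_on S (\<lambda>x. A x $ i $ j)"
  shows "smooth_on S (\<lambda>x. det (A x))"
  unfolding det_def by (intro smooth_on_intros assms)

text \<open>The derivative of the local inverse \<open>g\<close> at \<open>y\<close> is a smooth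
  function of \<open>g y\<close>, by Cramer's rule. So if \<open>g\<close> is C^k, its derivative is
  C^k too, and the order of smoothness climbs.\<close>

lemma smooth_inverse_function:
  fixes f :: "real^'n \<Rightarrow> real^'n"
  assumes S: "open S" "smooth_on S f" "x0 \<in> S" and inj: "inj (frechet_derivative f (at x0))"
  obtains U V g where "open U" "U \<subseteq> S" "x0 \<in> U" "open V" "f x0 \<in> V" "homeomorphism U V f g" "smooth_on V g"
proof -
  let ?D = "\<lambda>x. frechet_derivative f (at x)"
  define D where "D = (\<lambda>x. Blinfun (?D x))"
  have bl: "bounded_linear (?D x)" if "x \<in> S" for x
    using smooth_on_has_derivative[OF S(2) that] by (rule has_derivative_bounded_linear)
  have D: "blinfun_apply (D x) = ?D x" if "x \<in> S" for x
    unfolding D_def by (rule bounded_linear_Blinfun_apply[OF bl[OF that]])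
  have contD: "continuous_on S D"
  proof (rule continuous_on_blinfun_componentwise)
    fix i :: "real^'n" assume "i \<in> Basis"
    from smooth_on_imp_continuous_on[OF smooth_on_frechet_Basis[OF S(2) this]]
    show "continuous_on S (\<lambda>x. blinfun_apply (D x) i)"
      by (rule continuous_on_eq) (simp add: D)
  qed
  obtain k where k: "linear k" "k \<circ> ?D x0 = id"
    using linear_injective_left_inverse[OF bounded_linear.linear[OF bl[OF S(3)]] inj] by blast
  have "Blinfun k o\<^sub>L D x0 = id_blinfun"
    by (rule blinfun_eqI)
       (use k in \<open>auto simp: D S bounded_linear_Blinfun_apply linear_conv_bounded_linear o_def id_def fun_eq_iff\<close>)
  then obtain U V g g' where U: "open U" "U \<subseteq> S" "x0 \<in> U" and V: "open V" "f x0 \<in> V"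
    and hom: "homeomorphism U V f g"
    and g: "\<And>y. y \<in> V \<Longrightarrow> (g has_derivative (g' y)) (at y)"
    "\<And>y. y \<in> V \<Longrightarrow> g' y = inv (blinfun_apply (D (g y)))"
    "\<And>y. y \<in> V \<Longrightarrow> bij (blinfun_apply (D (g y)))"
    using inverse_function_theorem[OF S(1) _ contD S(3), of f] smooth_on_has_derivative[OF S(2)] D
    by metis
  have gU: "g y \<in> U" if "y \<in> V" for y
    using hom that by (auto simp: homeomorphism_def)
  have bijU: "bij (?D x)" if "x \<in> U" for x
  proof -
    have "f x \<in> V" "g (f x) = x" using hom that by (auto simp: homeomorphism_def)
    then show ?thesis using g(3)[of "f x"] D U(2) that by auto
  qed
  define A where "A = (\<lambda>x. matrix (?D x))"
  have A: "?D x h = A x *v h" if "x \<in> U" for x h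
    using bounded_linear.linear[OF bl] U(2) that by (auto simp: A_def matrix_works)
  have detA: "det (A x) \<noteq> 0" if "x \<in> U" for x
    using bijU[OF that] bounded_linear.linear[OF bl, of x] U(2) that
    by (metis A_def bij_is_inj det_nz_iff_inj subsetD)
  \<comment> \<open>Cramer's formula for the inverse matrix of the derivative at \<open>x\<close>,
    applied to \<open>i\<close>.\<close>
  define K where "K = (\<lambda>i x. \<chi> k. det (\<chi> a b. if b = k then i $ a else A x $ a $ b) / det (A x))"
  have Ks: "smooth_on U (K i)" for i
  proof -
    have entry: "smooth_on U (\<lambda>x. A x $ a $ b)" for a b
    proof -
      have "smooth_on U (\<lambda>x. ?D x (axis b 1) $ a)"
        by (intro smooth_on_vec_nth U smooth_on_frechet_Basis smooth_on_subset[OF S(2) U(2)]) (auto simp: Basis_vec_def)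
      then show ?thesis by (simp add: A_def matrix_def)
    qed
    have "smooth_on U (\<lambda>x. if b = k then i $ a else A x $ a $ b)" for a b k
      by (cases "b = k") (auto intro: entry)
    then show ?thesis unfolding K_def
      by (intro smooth_on_vec_lambda smooth_on_divide smooth_on_det U entry detA) auto
  qed
  have gK: "g' y i = K i (g y)" if "y \<in> V" for y i
  proof -
    note x = gU[OF that]
    have "g' y i = inv (?D (g y)) i" using g(2)[OF that] D[of "g y"] U(2) x by auto
    moreover have "?D (g y) (inv (?D (g y)) i) = i"
      using bijU[OF x] by (simp add: bij_is_surj surj_f_inv_f)
    ultimately have "A (g y) *v g' y i = i" using A[OF x] by simp
    then show ?thesis
      unfolding K_def using cramer[OF detA[OF x], of "g' y i" i] by simp
  qed
  have "Ck_on k V g" for k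
  proof (induction k)
    case 0
    then show ?case using hom by (simp add: homeomorphism_def)
  next
    case (Suc k)
    show ?case
    proof (rule Ck_on_SucI[OF V(1) g(1)])
      fix i :: "real^'n"
      have "Ck_on k V (\<lambda>y. K i (g y))"
        by (rule Ck_on_compose[OF V(1) U(1) Suc smooth_on_imp_Ck_on[OF Ks] gU])
      then show "Ck_on k V (\<lambda>y. g' y i)"
        by (rule Ck_on_cong[OF V(1)]) (simp add: gK)
    qed
  qed
  then have "smooth_on V g" by (simp add: smooth_on_def)
  with U V hom show thesis using that by blast
qed

text \<open>Conjugation with the linear isomorphism \<open>J\<close> moves the inverse function
  theorem from \<open>real^2\<close> to pairs.\<close>

lemma diffeo_germ2I:
  fixes f :: "real \<times> real \<Rightarrow> real \<times> real"
  assumes S: "open S" "smooth_on S f" "0 \<in> S" and inj: "inj (frechet_derivative f (at 0))"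
  shows "diffeo_germ2 f (f 0)"
proof -
  define J :: "real \<times> real \<Rightarrow> real^2" where "J = (\<lambda>p. \<chi> i. if i = 1 then fst p else snd p)"
  define J' :: "real^2 \<Rightarrow> real \<times> real" where "J' = (\<lambda>q. (q $ 1, q $ 2))"
  have JJ [simp]: "J (J' q) = q" "J' (J p) = p" for p q
    by (auto simp: J_def J'_def vec_eq_iff forall_2)
  have Jl: "linear J" "linear J'"
    by (auto simp: J_def J'_def vec_eq_iff intro!: linearI)
  then have Jb: "bounded_linear J" "bounded_linear J'" by (simp_all add: linear_conv_bounded_linear)
  have Js: "smooth_on T J" "smooth_on T' J'" for T T' by (intro smooth_on_linear Jb)+
  define S' where "S' = J' -` S"
  have oS': "open S'" unfolding S'_def
    by (rule open_vimage[OF S(1) linear_continuous_on[OF Jb(2)]])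
  have S0': "0 \<in> S'" using S(3) Jl by (simp add: S'_def linear_0)
  have fs: "smooth_on S' (\<lambda>q. f (J' q))"
    by (rule smooth_on_compose[OF S(2) Js(2) oS' S(1)]) (simp add: S'_def)
  have s: "smooth_on S' (\<lambda>q. J (f (J' q)))"
    by (rule smooth_on_linear_compose[OF Jb(1) oS' fs])
  have J0 [simp]: "J' 0 = 0" "J 0 = 0" using Jl by (simp_all add: linear_0)
  have "((\<lambda>q. J (f (J' q))) has_derivative (\<lambda>h. J (frechet_derivative f (at 0) (J' h)))) (at 0)"
    using bounded_linear.has_derivative[OF Jb(1) has_derivative_compose[OF bounded_linear_imp_has_derivative[OF Jb(2)], of f "frechet_derivative f (at 0)" 0 UNIV]]
      smooth_on_has_derivative[OF S(2,3)] by simp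
  then have fd: "frechet_derivative (\<lambda>q. J (f (J' q))) (at 0) = (\<lambda>h. J (frechet_derivative f (at 0) (J' h)))"
    using frechet_derivative_at by metis
  have "inj J" "inj J'" by (metis JJ(2) injI, metis JJ(1) injI)
  then have "inj (frechet_derivative (\<lambda>q. J (f (J' q))) (at 0))"
    unfolding fd using inj_compose[OF inj_compose[OF \<open>inj J\<close> inj] \<open>inj J'\<close>] by (simp add: o_def)
  then obtain U V g where U: "open U" "U \<subseteq> S'" "0 \<in> U" and V: "open V" "J (f (J' 0)) \<in> V"
    and hom: "homeomorphism U V (\<lambda>q. J (f (J' q))) g" and g: "smooth_on V g"
    using smooth_inverse_function[OF oS' s S0'] by blast
  have hom': "\<And>x. x \<in> U \<Longrightarrow> J (f (J' x)) \<in> V \<and> g (J (f (J' x))) = x" "\<And>y. y \<in> V \<Longrightarrow> g y \<in> U \<and> J (f (J' (g y))) = y"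
    using hom by (auto simp: homeomorphism_def)
  define U2 where "U2 = J -` U"
  define V2 where "V2 = J -` V"
  have o: "open U2" "open V2" unfolding U2_def V2_def
    by (rule open_vimage[OF U(1) linear_continuous_on[OF Jb(1)]] open_vimage[OF V(1) linear_continuous_on[OF Jb(1)]])+
  define psi where "psi = (\<lambda>y. J' (g (J y)))"
  have fU: "f x \<in> V2 \<and> psi (f x) = x" if "x \<in> U2" for x
    using hom'(1)[of "J x"] that by (auto simp: U2_def V2_def psi_def)
  have fV: "psi y \<in> U2 \<and> f (psi y) = y" if "y \<in> V2" for y
  proof -
    have "g (J y) \<in> U" "J (f (J' (g (J y)))) = J y" using hom'(2)[of "J y"] that by (auto simp: V2_def)
    then show ?thesis using injD[OF \<open>inj J\<close>] by (auto simp: U2_def psi_def)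
  qed
  have "smooth_on U2 f"
    by (rule smooth_on_subset[OF S(2)]) (use U(2) JJ(2) in \<open>force simp: U2_def S'_def\<close>)
  moreover have "smooth_on V2 psi"
    unfolding psi_def
    by (intro smooth_on_linear_compose[OF Jb(2)] smooth_on_compose[OF g Js(1)] o V) (simp add: V2_def)
  moreover have "f ` U2 = V2" using fU fV by force
  ultimately show ?thesis
    unfolding diffeo_germ2_def using o fU fV U(3)
    by (intro exI[of _ U2] exI[of _ V2] exI[of _ psi]) (auto simp: U2_def)
qed

section \<open>Coordinates of four-space and the Lorentzian form\<close>

definition vec4 :: "real \<Rightarrow> real \<Rightarrow> real \<Rightarrow> real \<Rightarrow> real^4" where
  "vec4 a b c d = (\<chi> i. if i = 0 then a else if i = 1 then b else if i = 2 then c else d)"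

lemma vec4_nth [simp]: "vec4 a b c d $ 0 = a" "vec4 a b c d $ 1 = b" "vec4 a b c d $ 2 = c" "vec4 a b c d $ 3 = d"
  by (simp_all add: vec4_def)

text \<open>Arithmetic in the index type is modulo 4, so the index written 4 is the time coordinate
  0.\<close>

lemma forall_4_zero: "(\<forall>i::4. P i) \<longleftrightarrow> P 0 \<and> P 1 \<and> P 2 \<and> P 3"
proof -
  have "(4::4) = 0" by simp
  then show ?thesis unfolding forall_4 by metis
qed

lemma vec4_eta: "vec4 (w $ 0) (w $ 1) (w $ 2) (w $ 3) = w"
  by (simp add: vec_eq_iff forall_4_zero)

lemma smooth_on_vec4:
  "open S \<Longrightarrow> smooth_on S a \<Longrightarrow> smooth_on S b \<Longrightarrow> smooth_on S c \<Longrightarrow> smooth_on S d \<Longrightarrow>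
    smooth_on S (\<lambda>x. vec4 (a x) (b x) (c x) (d x))"
  unfolding vec4_def
  apply (rule smooth_on_vec_lambda, assumption)
  subgoal for i by (cases "i = 0"; cases "i = 1"; cases "i = 2") simp_all
  done

lemma smooth_on_lor:
  "open S \<Longrightarrow> smooth_on S f \<Longrightarrow> smooth_on S g \<Longrightarrow> smooth_on S (\<lambda>x. lor (f x) (g x))"
  unfolding lor_def by (intro smooth_on_intros)

lemma lor_add: "lor (x + y) z = lor x z + lor y z" "lor x (y + z) = lor x y + lor x z"
  by (auto simp: lor_def algebra_simps)
lemma lor_diff: "lor (x - y) z = lor x z - lor y z" "lor x (y - z) = lor x y - lor x z"
  by (auto simp: lor_def algebra_simps)
lemma lor_minus: "lor (- x) z = - lor x z" "lor x (- z) = - lor x z"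
  by (auto simp: lor_def algebra_simps)
lemma lor_scaleR: "lor (a *\<^sub>R x) z = a * lor x z" "lor x (a *\<^sub>R z) = a * lor x z"
  by (auto simp: lor_def algebra_simps)
lemma lor_zero: "lor 0 z = 0" "lor z 0 = 0"
  by (auto simp: lor_def)
lemma lor_commute: "lor x y = lor y x"
  by (auto simp: lor_def)

lemmas lor_simps = lor_add lor_diff lor_minus lor_scaleR lor_zero

text \<open>The chart inverts the radial extension \<open>(y, s) \<mapsto> (1 + s) \<Psi>(y)\<close>; its inverse normalises \<open>\<Psi>\<close>.\<close>

lemma A_equiv_S31I:
  fixes Psi :: "real \<times> real \<times> real \<Rightarrow> real^4" and G :: "real \<times> real \<Rightarrow> real \<times> real \<times> real"
  assumes phi: "diffeo_germ2 phi p"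
    and D: "open D" "smooth_on D Psi" "0 \<in> D"
    and G: "open B" "0 \<in> B" "continuous_on B G" "G 0 = 0" "\<And>x. x \<in> B \<Longrightarrow> G x \<in> D"
      "\<And>x. x \<in> B \<Longrightarrow> F (phi x) = Psi (G x)" "\<And>x. x \<in> B \<Longrightarrow> F (phi x) \<in> S31"
    and indep: "\<And>s y. s *\<^sub>R Psi 0 + frechet_derivative Psi (at 0) y = 0 \<Longrightarrow> s = 0 \<and> y = 0"
  shows "A_equiv_S31 F p G"
proof -
  have phi0: "phi 0 = p" using phi by (auto simp: diffeo_germ2_def)
  have Fp: "F p = Psi 0" using G phi0 by metis
  have lor0: "lor (Psi 0) (Psi 0) = 1" using G(7)[OF G(2)] G(6)[OF G(2)] G(4) by (simp add: S31_def)
  define pr :: "real^4 \<Rightarrow> real \<times> real \<times> real" where "pr = (\<lambda>w. (w $ 0, w $ 1, w $ 2))"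
  have prb: "bounded_linear pr"
    by (auto simp: pr_def linear_conv_bounded_linear[symmetric] intro!: linearI)
  have pr0: "pr 0 = 0" by (simp add: pr_def zero_prod_def)
  define D1 where "D1 = {y \<in> D. lor (Psi y) (Psi y) > 0}"
  have lors: "smooth_on D (\<lambda>y. lor (Psi y) (Psi y))" by (intro smooth_on_lor D)
  have D1: "open D1"
  proof -
    have "D1 = D \<inter> (\<lambda>y. lor (Psi y) (Psi y)) -` {0<..}" by (auto simp: D1_def)
    then show ?thesis
      using continuous_open_preimage[OF smooth_on_imp_continuous_on[OF lors] D(1), of "{0<..}"] by simp
  qed
  \<comment> \<open>The condition on the last coordinate keeps the radial factor
    \<open>1 + s\<close> positive, which fixes the sign when a square root is taken.\<close>
  define S where "S = pr -` D1 \<inter> (\<lambda>w. w $ 3) -` {-1<..}"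
  have S: "open S" unfolding S_def
    by (intro open_Int open_vimage D1 linear_continuous_on prb bounded_linear_vec_nth) auto
  have S0: "0 \<in> S" using D(3) lor0 by (auto simp: S_def D1_def pr0)
  define T where "T = (\<lambda>w. (1 + w $ 3) *\<^sub>R Psi (pr w))"
  have Ps: "smooth_on S (\<lambda>w. Psi (pr w))"
    by (rule smooth_on_compose[OF D(2) smooth_on_linear[OF prb] S D(1)]) (auto simp: S_def D1_def)
  have Ts: "smooth_on S T"
    unfolding T_def by (intro smooth_on_intros Ps S)
  let ?P = "frechet_derivative Psi (at 0)"
  have "(T has_derivative (\<lambda>h. (1 + (0::real^4) $ 3) *\<^sub>R ?P (pr h) + h $ 3 *\<^sub>R Psi (pr 0))) (at 0)"
    unfolding T_def
  proof (rule has_derivative_scaleR)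
    show "((\<lambda>w::real^4. 1 + w $ 3) has_derivative (\<lambda>h. h $ 3)) (at 0)"
      by (auto intro!: derivative_eq_intros bounded_linear_imp_has_derivative bounded_linear_vec_nth)
    have "(Psi has_derivative ?P) (at (pr 0))"
      using smooth_on_has_derivative[OF D(2,3)] by (simp add: pr0)
    from has_derivative_compose[OF bounded_linear_imp_has_derivative[OF prb] this]
    show "((\<lambda>w. Psi (pr w)) has_derivative (\<lambda>h. ?P (pr h))) (at 0)" .
  qed
  then have Td: "frechet_derivative T (at 0) = (\<lambda>h. ?P (pr h) + h $ 3 *\<^sub>R Psi 0)"
    using frechet_derivative_at by (fastforce simp: pr0)
  have "linear (frechet_derivative T (at 0))"
    using smooth_on_has_derivative[OF Ts S0] by (rule has_derivative_linear)
  then have "inj (frechet_derivative T (at 0))"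
  proof (rule linear_injective_0[THEN iffD2], intro allI impI)
    fix h assume "frechet_derivative T (at 0) h = 0"
    then have "h $ 3 = 0 \<and> pr h = 0" using indep[of "h $ 3" "pr h"] by (simp add: Td add.commute)
    then show "h = 0" by (auto simp: pr_def zero_prod_def vec_eq_iff forall_4_zero)
  qed
  then obtain U V g where U: "open U" "U \<subseteq> S" "0 \<in> U" and V: "open V" "T 0 \<in> V"
    and hom: "homeomorphism U V T g" and gs: "smooth_on V g"
    using smooth_inverse_function[OF S Ts S0] by blast
  have TU: "T x \<in> V" "g (T x) = x" if "x \<in> U" for x using hom that by (auto simp: homeomorphism_def)
  have gV: "g y \<in> U" "T (g y) = y" if "y \<in> V" for y using hom that by (auto simp: homeomorphism_def)
  define L where "L = (\<lambda>y. lor (Psi y) (Psi y))"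
  \<comment> \<open>The last coordinate is the \<open>s\<close> with
    \<open>(1 + s) sqrt (L y) = 1\<close>, so \<open>T (em y)\<close> lies on the
    pseudosphere.\<close>
  define em where "em = (\<lambda>y :: real \<times> real \<times> real. vec4 (fst y) (fst (snd y)) (snd (snd y)) (1 / sqrt (L y) - 1))"
  have pr_em [simp]: "pr (em y) = y" for y by (simp add: pr_def em_def)
  have ems: "smooth_on D1 em"
    unfolding em_def
  proof (intro smooth_on_vec4 smooth_on_intros D1)
    show "smooth_on D1 L" unfolding L_def by (rule smooth_on_subset[OF lors]) (auto simp: D1_def)
  qed (auto simp: D1_def L_def)
  define W' where "W' = D1 \<inter> em -` U"
  have W': "open W'" unfolding W'_def
    by (rule continuous_open_preimage[OF smooth_on_imp_continuous_on[OF ems] D1 U(1)])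
  define chi where "chi = (\<lambda>y. T (em y))"
  define kap where "kap = (\<lambda>x. pr (g x))"
  have em0: "em 0 = 0" by (simp add: em_def L_def lor0 vec_eq_iff forall_4_zero)
  have S31: "chi y \<in> V \<inter> S31" "kap (chi y) = y" if "y \<in> W'" for y
  proof -
    have em: "em y \<in> U" and Ly: "L y > 0" using that by (auto simp: W'_def D1_def L_def)
    have "lor (chi y) (chi y) = (1 / sqrt (L y))\<^sup>2 * L y"
      by (simp add: chi_def T_def lor_simps L_def power2_eq_square) (simp add: em_def L_def)
    also have "\<dots> = 1" using Ly by (simp add: power_divide)
    finally show "chi y \<in> V \<inter> S31" using TU[OF em] by (simp add: S31_def chi_def)
    show "kap (chi y) = y" using TU[OF em] by (simp add: kap_def chi_def)
  qed
  have inv_chi: "kap x \<in> W' \<and> chi (kap x) = x" if "x \<in> V \<inter> S31" for x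
  proof -
    let ?w = "g x"
    have w: "?w \<in> U" "T ?w = x" using gV that by auto
    then have "?w \<in> S" using U by auto
    then have w3: "?w $ 3 > -1" and pD: "pr ?w \<in> D1" by (auto simp: S_def)
    have "1 = lor (T ?w) (T ?w)" using that w(2) by (simp add: S31_def)
    also have "\<dots> = (1 + ?w $ 3)\<^sup>2 * L (pr ?w)"
      by (simp add: T_def lor_simps L_def power2_eq_square)
    finally have "1 = (1 + ?w $ 3)\<^sup>2 * L (pr ?w)" .
    then have "sqrt 1 = sqrt ((1 + ?w $ 3)\<^sup>2 * L (pr ?w))" by simp
    then have "1 = (1 + ?w $ 3) * sqrt (L (pr ?w))"
      using w3 by (simp add: real_sqrt_mult)
    then have "1 / sqrt (L (pr ?w)) - 1 = ?w $ 3"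
      by (metis add_diff_cancel_left' mult_zero_right nonzero_eq_divide_eq zero_neq_one)
    then have "em (pr ?w) = ?w" by (simp add: em_def) (simp add: pr_def vec4_eta)
    then show ?thesis using w pD by (auto simp: W'_def kap_def chi_def)
  qed
  have chis: "smooth_on W' chi"
    unfolding chi_def
    by (rule smooth_on_compose[OF Ts _ W' S]) (use U in \<open>auto intro: smooth_on_subset[OF ems] simp: W'_def\<close>)
  have kaps: "smooth_on V kap"
    unfolding kap_def by (rule smooth_on_linear_compose[OF prb V(1) gs])
  have T0: "T 0 = F p" by (simp add: T_def pr0 Fp)
  \<comment> \<open>\<open>Psi\<close> is already normalised at the points \<open>G x\<close>, so
    they sit at radial coordinate 0.\<close>
  define em0 where "em0 = (\<lambda>y :: real \<times> real \<times> real. vec4 (fst y) (fst (snd y)) (snd (snd y)) 0)"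
  have "bounded_linear em0"
    by (auto simp: em0_def linear_conv_bounded_linear[symmetric] vec_eq_iff forall_4_zero intro!: linearI)
  then have "continuous_on B (\<lambda>x. em0 (G x))"
    by (rule bounded_linear.continuous_on[OF _ G(3)])
  then have "open (B \<inter> (\<lambda>x. em0 (G x)) -` U)"
    by (rule continuous_open_preimage[OF _ G(1) U(1)])
  moreover have "0 \<in> B \<inter> (\<lambda>x. em0 (G x)) -` U"
    using G(2,4) U(3) by (simp add: em0_def vec4_def zero_vec_def[symmetric] cong: if_cong)
  ultimately obtain e where e: "e > 0" "ball 0 e \<subseteq> B \<inter> (\<lambda>x. em0 (G x)) -` U"
    by (meson open_contains_ball)
  have near: "F (phi x) \<in> V \<inter> S31 \<and> kap (F (phi x)) = G x" if "x \<in> ball 0 e" for x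
  proof -
    have xB: "x \<in> B" and xU: "em0 (G x) \<in> U" using e that by auto
    have pe: "pr (em0 (G x)) = G x" by (simp add: pr_def em0_def)
    have "T (em0 (G x)) = F (phi x)"
      using G(6)[OF xB] by (simp add: T_def pe) (simp add: em0_def)
    then show ?thesis using TU[OF xU] G(7)[OF xB] pe by (simp add: kap_def) 
  qed
  show ?thesis
    unfolding A_equiv_S31_def
  proof (intro exI conjI)
    show "chi ` W' = V \<inter> S31" using S31 inv_chi by force
    show "0 \<in> W'" using D(3) lor0 U(3) em0 by (auto simp: W'_def D1_def)
    show "F p \<in> V" using V(2) T0 by simp
    show "kap (F p) = 0" using TU[OF U(3)] T0 pr0 by (simp add: kap_def)
  qed (use phi V W' chis kaps S31 inv_chi e(1) near in auto)
qed

lemma has_vector_derivative_pd: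
  assumes g: "smooth_on S g" and "(a t, b t) \<in> S"
    and "(a has_real_derivative a') (at t)" "(b has_real_derivative b') (at t)"
  shows "((\<lambda>s. g (a s, b s)) has_vector_derivative a' *\<^sub>R pd1 g (a t, b t) + b' *\<^sub>R pd2 g (a t, b t)) (at t)"
proof -
  have "((\<lambda>s. (a s, b s)) has_derivative (\<lambda>h. (a' * h, b' * h))) (at t)"
    using assms(3,4) by (auto simp: has_field_derivative_def intro: has_derivative_Pair)
  from has_derivative_compose[OF this has_derivative_pd[OF assms(1,2)]]
  show ?thesis
    by (simp add: has_vector_derivative_def algebra_simps)
qed

text \<open>Here \<open>h\<close> is the quotient \<open>F_v / v\<close> on the axis
  \<open>u = 0\<close>. In the representation \<open>E0 + v^3 T\<close> one has
  \<open>h 0 = 2 pd2 E0\<close> and \<open>h' 0 = 3 T\<close>, so the independence condition says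
  that \<open>E0 + z T\<close> parametrises a hypersurface transversal to the radial direction
  \<open>F p\<close>.\<close>

lemma cuspidal_edge_criterion:
  assumes phi: "diffeo_germ2 phi p"
    and f: "smooth_on (sq r) (\<lambda>x. F (phi x))" "0 < r" "\<And>x. x \<in> sq r \<Longrightarrow> F (phi x) \<in> S31"
    and null: "\<And>u. \<bar>u\<bar> < r \<Longrightarrow> pd2 (\<lambda>x. F (phi x)) (u, 0) = 0"
    and h: "\<And>v. \<bar>v\<bar> < r \<Longrightarrow> ((\<lambda>v. F (phi (0, v))) has_vector_derivative v *\<^sub>R h v) (at v)"
      "(h has_vector_derivative h1) (at 0)"
    and indep: "\<And>a b c d. a *\<^sub>R F p + b *\<^sub>R pd1 (\<lambda>x. F (phi x)) (0, 0) + c *\<^sub>R h 0 + d *\<^sub>R h1 = 0 \<Longrightarrow>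
        a = 0 \<and> b = 0 \<and> c = 0 \<and> d = 0"
  shows "cuspidal_edge F p"
proof -
  define f where "f = (\<lambda>x. F (phi x))"
  note fs = f(1)[folded f_def] and null = null[folded f_def]
  obtain q0 E0 Od0 where q0: "0 < q0" "q0 \<le> r" "smooth_on (sq q0) E0" "smooth_on (sq q0) Od0"
    and f0: "\<And>u v. (u, v) \<in> sq q0 \<Longrightarrow> f (u, v) = E0 (u, v\<^sup>2) + v *\<^sub>R Od0 (u, v\<^sup>2)"
    using whitney_even_odd[OF fs f(2)] by blast
  \<comment> \<open>A half side of at most 1 keeps \<open>(u, v^2)\<close> in the square.\<close>
  define q where "q = min q0 1"
  have q: "0 < q" "q \<le> r" "q \<le> 1" "q \<le> q0" and sub: "sq q \<subseteq> sq q0" using q0 by (simp_all add: q_def sq_mono)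
  have E: "smooth_on (sq q) E0" and Od: "smooth_on (sq q) Od0"
    using smooth_on_subset[OF q0(3) sub] smooth_on_subset[OF q0(4) sub] by auto
  have v2: "(u, v\<^sup>2) \<in> sq q" if "(u, v) \<in> sq q" for u v
    using that q mult_left_le_one_le[of "\<bar>v\<bar>" "\<bar>v\<bar>"] by (auto simp: mem_sq power2_eq_square)
  have fr: "smooth_on (sq q) f" by (rule smooth_on_subset[OF fs sq_mono[OF q(2)]])
  \<comment> \<open>On the axis the derivative in \<open>v\<close> is the odd coefficient
    \<open>Od0 (u, 0)\<close>. Degeneracy along the whole axis therefore gives a factor
    \<open>y\<close> in \<open>Od0\<close>, and \<open>v Od0\<close> becomes
    \<open>v^3 T\<close>.\<close>
  have Od_axis: "Od0 (u, 0) = 0" if u: "\<bar>u\<bar> < q" for u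
  proof -
    have m: "(u, 0) \<in> sq q" using u q by (simp add: mem_sq)
    have "((\<lambda>v. E0 (u, v\<^sup>2) + v *\<^sub>R Od0 (u, v\<^sup>2)) has_vector_derivative
        (0 *\<^sub>R pd1 E0 (u, 0\<^sup>2) + 0 *\<^sub>R pd2 E0 (u, 0\<^sup>2)) + (0 *\<^sub>R (0 *\<^sub>R pd1 Od0 (u, 0\<^sup>2) + 0 *\<^sub>R pd2 Od0 (u, 0\<^sup>2)) + 1 *\<^sub>R Od0 (u, 0\<^sup>2))) (at 0)"
      using m by (intro has_vector_derivative_add has_vector_derivative_scaleR has_vector_derivative_pd[OF E] has_vector_derivative_pd[OF Od])
         (auto intro!: derivative_eq_intros)
    then have "((\<lambda>v. E0 (u, v\<^sup>2) + v *\<^sub>R Od0 (u, v\<^sup>2)) has_vector_derivative Od0 (u, 0)) (at 0)" by simp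
    then have "((\<lambda>v. f (u, v)) has_vector_derivative Od0 (u, 0)) (at 0)"
      by (rule has_vector_derivative_transform_within_open[of _ _ _ "{-q<..<q}"])
         (use q u f0 sub in \<open>auto simp: mem_sq\<close>)
    moreover have "((\<lambda>v. f (u, v)) has_vector_derivative 0 *\<^sub>R pd1 f (u, 0) + 1 *\<^sub>R pd2 f (u, 0)) (at 0)"
      using has_vector_derivative_pd[of "sq q" f "\<lambda>_. u" 0 "\<lambda>v. v" 0 1] fr m by simp
    ultimately show ?thesis
      using null[of u] u q(2) vector_derivative_unique_at by fastforce
  qed
  obtain T where T: "smooth_on (sq q) T" "\<And>u y. (u, y) \<in> sq q \<Longrightarrow> Od0 (u, y) = y *\<^sub>R T (u, y)"
    using hadamard[OF Od] Od_axis by (metis add_0 fst_conv mem_sq)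
  have fT: "f (u, v) = E0 (u, v\<^sup>2) + v^3 *\<^sub>R T (u, v\<^sup>2)" if "(u, v) \<in> sq q" for u v
    using f0[of u v] T(2)[OF v2[OF that]] that sub by (auto simp: power3_eq_cube power2_eq_square)
  have z: "(0, 0) \<in> sq q" using q by (simp add: mem_sq)
  have p1: "pd1 f (0, 0) = pd1 E0 (0, 0)"
  proof -
    have "((\<lambda>u. E0 (u, 0)) has_vector_derivative 1 *\<^sub>R pd1 E0 (0, 0) + 0 *\<^sub>R pd2 E0 (0, 0)) (at 0)"
      using has_vector_derivative_pd[of "sq q" E0 "\<lambda>u. u" 0 "\<lambda>_. 0" 1 0] E z by simp
    moreover have "E0 (y, 0) = f (y, 0)" if "\<bar>y\<bar> < q" for y
      using fT[of y 0] q that by (simp add: mem_sq)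
    ultimately have "((\<lambda>u. f (u, 0)) has_vector_derivative pd1 E0 (0, 0)) (at 0)"
      using has_vector_derivative_transform_within_open[of "\<lambda>u. E0 (u, 0)" "pd1 E0 (0, 0)" 0 "{-q<..<q}" "\<lambda>u. f (u, 0)"] q
      by (auto simp: abs_less_iff)
    moreover have "((\<lambda>u. f (u, 0)) has_vector_derivative 1 *\<^sub>R pd1 f (0, 0) + 0 *\<^sub>R pd2 f (0, 0)) (at 0)"
      using has_vector_derivative_pd[of "sq q" f "\<lambda>u. u" 0 "\<lambda>_. 0" 1 0] fr z by simp
    ultimately show ?thesis using vector_derivative_unique_at by fastforce
  qed
  \<comment> \<open>The derivative of \<open>E0 (0, v^2) + v^3 T (0, v^2)\<close> divided by
    \<open>v\<close>. It equals \<open>h\<close> off 0, and by continuity also at 0.\<close>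
  define k where "k = (\<lambda>v. 2 *\<^sub>R pd2 E0 (0, v\<^sup>2) + (3 * v) *\<^sub>R T (0, v\<^sup>2) + (2 * v^3) *\<^sub>R pd2 T (0, v\<^sup>2))"
  have hk: "h v = k v" if v: "\<bar>v\<bar> < q" "v \<noteq> 0" for v
  proof -
    have m: "(0, v) \<in> sq q" using v q by (simp add: mem_sq)
    have "((\<lambda>v. E0 (0, v\<^sup>2) + v^3 *\<^sub>R T (0, v\<^sup>2)) has_vector_derivative
       (0 *\<^sub>R pd1 E0 (0, v\<^sup>2) + (2 * v) *\<^sub>R pd2 E0 (0, v\<^sup>2)) +
       (v^3 *\<^sub>R (0 *\<^sub>R pd1 T (0, v\<^sup>2) + (2 * v) *\<^sub>R pd2 T (0, v\<^sup>2)) + (3 * v\<^sup>2) *\<^sub>R T (0, v\<^sup>2))) (at v)"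
      using v2[OF m] by (intro has_vector_derivative_add has_vector_derivative_scaleR has_vector_derivative_pd[OF E] has_vector_derivative_pd[OF T(1)])
         (auto intro!: derivative_eq_intros)
    then have "((\<lambda>v. E0 (0, v\<^sup>2) + v^3 *\<^sub>R T (0, v\<^sup>2)) has_vector_derivative v *\<^sub>R k v) (at v)"
      by (rule has_vector_derivative_eq_rhs) (simp add: k_def algebra_simps power2_eq_square power3_eq_cube)
    then have "((\<lambda>v. f (0, v)) has_vector_derivative v *\<^sub>R k v) (at v)"
      by (rule has_vector_derivative_transform_within_open[of _ _ _ "{-q<..<q}"])
         (use v fT q in \<open>auto simp: mem_sq\<close>)
    then have "v *\<^sub>R k v = v *\<^sub>R h v"
      using h(1)[of v] v q(2) vector_derivative_unique_at unfolding f_def by fastforce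
    then show ?thesis using v by simp
  qed
  have kd: "(k has_vector_derivative 3 *\<^sub>R T (0, 0)) (at 0)"
  proof -
    have sE: "smooth_on (sq q) (pd2 E0)" and sT: "smooth_on (sq q) (pd2 T)"
      using smooth_on_pd E T by auto
    have "(k has_vector_derivative
        ((2 *\<^sub>R (0 *\<^sub>R pd1 (pd2 E0) (0, 0\<^sup>2) + 0 *\<^sub>R pd2 (pd2 E0) (0, 0\<^sup>2)) + 0 *\<^sub>R pd2 E0 (0, 0\<^sup>2))
        + ((3 * 0) *\<^sub>R (0 *\<^sub>R pd1 T (0, 0\<^sup>2) + 0 *\<^sub>R pd2 T (0, 0\<^sup>2)) + 3 *\<^sub>R T (0, 0\<^sup>2)))
        + ((2 * 0^3) *\<^sub>R (0 *\<^sub>R pd1 (pd2 T) (0, 0\<^sup>2) + 0 *\<^sub>R pd2 (pd2 T) (0, 0\<^sup>2)) + 0 *\<^sub>R pd2 T (0, 0\<^sup>2))) (at 0)"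
      unfolding k_def
      using z by (intro has_vector_derivative_add has_vector_derivative_scaleR has_vector_derivative_pd[OF sE]
          has_vector_derivative_pd[OF T(1)] has_vector_derivative_pd[OF sT])
         (auto intro!: derivative_eq_intros)
    then show ?thesis by simp
  qed
  have h0: "h 0 = 2 *\<^sub>R pd2 E0 (0, 0)"
  proof -
    have "isCont h 0" "isCont k 0"
      using h(2) kd has_vector_derivative_continuous by blast+
    then have lim: "(h \<longlongrightarrow> h 0) (at 0)" "(k \<longlongrightarrow> k 0) (at 0)" by (auto simp: isCont_def)
    have "\<forall>\<^sub>F v in at 0. h v = k v"
      using hk q by (auto simp: eventually_at intro!: exI[of _ q])
    from Lim_transform_eventually[OF lim(1) this] have "(k \<longlongrightarrow> h 0) (at 0)" .
    with lim(2) have "h 0 = k 0"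
      using tendsto_unique[OF at_neq_bot] by blast
    then show ?thesis by (simp add: k_def)
  qed
  have "k v = h v" if "\<bar>v\<bar> < q" for v
    using hk[of v] that h0 by (cases "v = 0") (simp_all add: k_def)
  then have "(h has_vector_derivative 3 *\<^sub>R T (0, 0)) (at 0)"
    using has_vector_derivative_transform_within_open[OF kd, of "{-q<..<q}" h] q by (auto simp: abs_less_iff)
  then have h1: "h1 = 3 *\<^sub>R T (0, 0)"
    using h(2) vector_derivative_unique_at by blast
  define pr :: "real \<times> real \<times> real \<Rightarrow> real \<times> real" where "pr = (\<lambda>w. (fst w, fst (snd w)))"
  have prb: "bounded_linear pr" unfolding pr_def
    by (intro bounded_linear_Pair bounded_linear_fst bounded_linear_fst_comp bounded_linear_snd)
  define D where "D = pr -` sq q"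
  define Psi where "Psi = (\<lambda>w. E0 (pr w) + snd (snd w) *\<^sub>R T (pr w))"
  have oD: "open D" unfolding D_def by (rule open_vimage[OF open_sq linear_continuous_on[OF prb]])
  have comp: "smooth_on D (\<lambda>w. g (pr w))" if "smooth_on (sq q) g" for g :: "real \<times> real \<Rightarrow> real^4"
    by (rule smooth_on_compose[OF that smooth_on_linear[OF prb] oD]) (auto simp: D_def)
  have Ps: "smooth_on D Psi" unfolding Psi_def
    by (intro smooth_on_intros comp E T oD)
  have pr0: "pr 0 = (0, 0)" by (simp add: pr_def)
  have D0: "0 \<in> D" using z by (simp add: D_def pr0)
  have "(Psi has_derivative (\<lambda>y. (fst (pr y) *\<^sub>R pd1 E0 (0, 0) + snd (pr y) *\<^sub>R pd2 E0 (0, 0)) +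
      (snd (snd (0 :: real \<times> real \<times> real)) *\<^sub>R (fst (pr y) *\<^sub>R pd1 T (0, 0) + snd (pr y) *\<^sub>R pd2 T (0, 0)) + snd (snd y) *\<^sub>R T (pr 0)))) (at 0)"
  proof -
    have c: "((\<lambda>w. g (pr w)) has_derivative (\<lambda>y. fst (pr y) *\<^sub>R pd1 g (0, 0) + snd (pr y) *\<^sub>R pd2 g (0, 0))) (at 0)"
      if "smooth_on (sq q) g" for g :: "real \<times> real \<Rightarrow> real^4"
      using has_derivative_compose[OF bounded_linear_imp_has_derivative[OF prb], of g _ 0 UNIV] has_derivative_pd[OF that z] pr0
      by simp
    show ?thesis unfolding Psi_def
      by (intro has_derivative_add has_derivative_scaleR c E T has_derivative_snd has_derivative_ident)
  qed
  from frechet_derivative_at[OF this]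
  have Pd: "frechet_derivative Psi (at 0) y = fst y *\<^sub>R pd1 E0 (0, 0) + fst (snd y) *\<^sub>R pd2 E0 (0, 0) + snd (snd y) *\<^sub>R T (0, 0)" for y
    by (simp add: fun_eq_iff pr_def)
  have Fp: "F p = f (0, 0)" using phi by (auto simp: diffeo_germ2_def f_def zero_prod_def)
  show ?thesis
    unfolding cuspidal_edge_def
  proof (rule A_equiv_S31I[OF phi oD Ps D0, of "sq q"])
    show "continuous_on (sq q) (\<lambda>(u, v). (u, v\<^sup>2, v^3))"
      unfolding split_beta by (intro continuous_intros)
    fix x assume "x \<in> sq q"
    moreover obtain u v where "x = (u, v)" by (cases x)
    ultimately have x: "(u, v) \<in> sq q" "x = (u, v)" by auto
    show "(case x of (u, v) \<Rightarrow> (u, v\<^sup>2, v^3)) \<in> D" using v2[OF x(1)] by (simp add: x D_def pr_def)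
    show "F (phi x) = Psi (case x of (u, v) \<Rightarrow> (u, v\<^sup>2, v^3))"
      using fT[OF x(1)] by (simp add: x Psi_def pr_def f_def)
    show "F (phi x) \<in> S31" using f(3) x sq_mono[OF q(2)] by auto
  next
    fix s :: real and y :: "real \<times> real \<times> real"
    assume "s *\<^sub>R Psi 0 + frechet_derivative Psi (at 0) y = 0"
    moreover have "Psi 0 = F p" using fT[OF z] by (simp add: Psi_def pr0 Fp)
    \<comment> \<open>The halves and thirds cancel the factors in \<open>h 0 = 2 pd2 E0\<close> and
      \<open>h1 = 3 T\<close>.\<close>
    ultimately have "s *\<^sub>R F p + fst y *\<^sub>R pd1 (\<lambda>x. F (phi x)) (0, 0) + (fst (snd y) / 2) *\<^sub>R h 0 + (snd (snd y) / 3) *\<^sub>R h1 = 0"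
      by (simp add: Pd p1[unfolded f_def] h0 h1 algebra_simps)
    from indep[OF this] show "s = 0 \<and> y = 0" by (simp add: prod_eq_iff)
  qed (use z in \<open>auto simp: zero_prod_def\<close>)
qed

section \<open>The focal surface of an adapted frame: cuspidal edges\<close>

lemma lor_orthonormal_indep:
  assumes "lor f1 f1 = 1" "lor f2 f2 = 1" "lor f3 f3 = -1" "lor f4 f4 = 1"
    "lor f1 f2 = 0" "lor f1 f3 = 0" "lor f1 f4 = 0" "lor f2 f3 = 0" "lor f2 f4 = 0" "lor f3 f4 = 0"
    and "a *\<^sub>R f1 + b *\<^sub>R f2 + c *\<^sub>R f3 + d *\<^sub>R f4 = 0"
  shows "a = 0 \<and> b = 0 \<and> c = 0 \<and> d = 0"
proof -
  have "lor (a *\<^sub>R f1 + b *\<^sub>R f2 + c *\<^sub>R f3 + d *\<^sub>R f4) f = 0" for f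
    by (simp only: assms(11) lor_zero)
  from this[of f1] this[of f2] this[of f3] this[of f4] show ?thesis
    using assms(1-10) by (simp add: lor_simps lor_commute[of f2 f1] lor_commute[of f3 f1] lor_commute[of f3 f2]
      lor_commute[of f4 f1] lor_commute[of f4 f2] lor_commute[of f4 f3])
qed

text \<open>Four independent vectors span the space. The third slot is reserved for the timelike
  vector, whence the minus sign.\<close>

lemma lor_orthonormal_expansion:
  assumes f: "lor f1 f1 = 1" "lor f2 f2 = 1" "lor f3 f3 = -1" "lor f4 f4 = 1"
    "lor f1 f2 = 0" "lor f1 f3 = 0" "lor f1 f4 = 0" "lor f2 f3 = 0" "lor f2 f4 = 0" "lor f3 f4 = 0"
  shows "x = lor x f1 *\<^sub>R f1 + lor x f2 *\<^sub>R f2 - lor x f3 *\<^sub>R f3 + lor x f4 *\<^sub>R f4"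
proof -
  define L where "L = (\<lambda>q::real^4. q $ 0 *\<^sub>R f1 + q $ 1 *\<^sub>R f2 + q $ 2 *\<^sub>R f3 + q $ 3 *\<^sub>R f4)"
  have lin: "linear L" by (auto simp: L_def algebra_simps intro!: linearI)
  have "inj L"
  proof (rule linear_injective_0[OF lin, THEN iffD2], intro allI impI)
    fix q assume "L q = 0"
    from lor_orthonormal_indep[OF f this[unfolded L_def]] show "q = 0"
      by (simp add: vec_eq_iff forall_4_zero)
  qed
  then have "surj L" using linear_injective_imp_surjective[OF lin] by simp
  then obtain q where x: "x = L q" by (metis surjD)
  have "lor x f1 = q $ 0" "lor x f2 = q $ 1" "lor x f3 = - q $ 2" "lor x f4 = q $ 3"
    using f by (simp_all add: x L_def lor_simps lor_commute[of f2 f1] lor_commute[of f3 f1] lor_commute[of f3 f2]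
      lor_commute[of f4 f1] lor_commute[of f4 f2] lor_commute[of f4 f3])
  then show ?thesis by (simp add: x L_def)
qed

text \<open>The source is shrunk until \<open>phi\<close> and \<open>psi\<close> are inverse
  bijections of open sets inside \<open>D\<close>. The parametrisation \<open>chi\<close> is an
  immersion because the chart \<open>kappa\<close> is a left inverse of it.\<close>

lemma A_equiv_S31E:
  fixes F :: "real \<times> real \<Rightarrow> real^4" and G :: "real \<times> real \<Rightarrow> real \<times> real \<times> real"
  assumes A: "A_equiv_S31 F p G" and D: "open D" "p \<in> D"
  obtains phi psi chi V U W where "open V" "0 \<in> V" "open U" "p \<in> U" "U \<subseteq> D" "smooth_on V phi" "smooth_on U psi"
    "phi 0 = p" "psi p = 0" "\<And>x. x \<in> V \<Longrightarrow> phi x \<in> U \<and> psi (phi x) = x" "\<And>y. y \<in> U \<Longrightarrow> psi y \<in> V \<and> phi (psi y) = y"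
    "open W" "smooth_on W chi" "\<And>x. x \<in> V \<Longrightarrow> G x \<in> W \<and> F (phi x) = chi (G x)"
    "\<And>y. y \<in> W \<Longrightarrow> inj (frechet_derivative chi (at y))"
proof -
  obtain phi W W' kappa chi e where phi: "diffeo_germ2 phi p" and W: "open W" "open W'"
    and ks: "smooth_on W kappa" and cs: "smooth_on W' chi" and cW: "chi ` W' = W \<inter> S31"
    and kc: "\<forall>y\<in>W'. kappa (chi y) = y" and ck: "\<forall>x\<in>W \<inter> S31. chi (kappa x) = x" and e: "e > 0"
    and FG: "\<forall>u\<in>ball 0 e. F (phi u) \<in> W \<inter> S31 \<and> kappa (F (phi u)) = G u"
    using A unfolding A_equiv_S31_def by blast
  obtain V0 U0 psi where V0: "open V0" "open U0" "0 \<in> V0" "phi ` V0 = U0" "smooth_on V0 phi" "smooth_on U0 psi"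
    and inv: "\<forall>v\<in>V0. psi (phi v) = v" "\<forall>u\<in>U0. phi (psi u) = u" and p0: "phi 0 = p"
    using phi unfolding diffeo_germ2_def by blast
  define V where "V = V0 \<inter> phi -` D \<inter> ball 0 e"
  define U where "U = U0 \<inter> psi -` V \<inter> D"
  have V: "open V" unfolding V_def
    by (intro open_Int continuous_open_preimage[OF smooth_on_imp_continuous_on] V0 D) auto
  have "open (U0 \<inter> psi -` V)"
    by (rule continuous_open_preimage[OF smooth_on_imp_continuous_on[OF V0(6)] V0(2) V])
  then have U: "open U" unfolding U_def using D(1) by (rule open_Int)
  show thesis
  proof (rule that[of V U phi psi W' chi])
    show "open V" "open U" "phi 0 = p" "open W'" "smooth_on W' chi" by fact+
    show "0 \<in> V" using V0 D e p0 by (auto simp: V_def)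
    then show "p \<in> U" using V0 inv p0 D by (auto simp: U_def)
    show "U \<subseteq> D" by (auto simp: U_def)
    show "smooth_on V phi" "smooth_on U psi"
      by (auto intro: smooth_on_subset[OF V0(5)] smooth_on_subset[OF V0(6)] simp: V_def U_def)
    show "psi p = 0" using inv V0 p0 by metis
    show "phi x \<in> U \<and> psi (phi x) = x" if "x \<in> V" for x
      using that V0(4) inv(1) by (auto simp: V_def U_def)
    show "psi y \<in> V \<and> phi (psi y) = y" if "y \<in> U" for y
      using that inv by (auto simp: U_def)
    show "G x \<in> W' \<and> F (phi x) = chi (G x)" if "x \<in> V" for x
    proof -
      have x: "F (phi x) \<in> W \<inter> S31" "kappa (F (phi x)) = G x" using that FG by (auto simp: V_def)
      then obtain y where "y \<in> W'" "F (phi x) = chi y" using cW by blast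
      then show ?thesis using kc x(2) by auto
    qed
    fix y assume y: "y \<in> W'"
    have "chi y \<in> W" using cW y by blast
    from has_derivative_compose[OF smooth_on_has_derivative[OF cs y] smooth_on_has_derivative[OF ks this]]
    have "((\<lambda>x. kappa (chi x)) has_derivative (\<lambda>h. frechet_derivative kappa (at (chi y)) (frechet_derivative chi (at y) h))) (at y)" .
    moreover have "((\<lambda>x. kappa (chi x)) has_derivative (\<lambda>h. h)) (at y)"
      by (rule has_derivative_transform_within_open[OF has_derivative_ident W(2) y]) (use kc in auto)
    ultimately have "(\<lambda>h. frechet_derivative kappa (at (chi y)) (frechet_derivative chi (at y) h)) = (\<lambda>h. h)"
      by (rule has_derivative_unique)
    then show "inj (frechet_derivative chi (at y))"
      by (metis injI)
  qed
qed

text \<open>All that the classification uses about the curve: \<open>e\<close>, \<open>n\<close>,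
  \<open>mu\<close> are spacelike, \<open>w\<close> is timelike, and the coefficients stand for
  \<open>kap = N / k\<close>, \<open>al = k A\<close>, \<open>c = M / A\<close>. That
  \<open>al\<close> has no zeros expresses the front property.\<close>

locale focal_frame =
  fixes I :: "real set" and e n w mu :: "real \<Rightarrow> real^4" and kap al :: "real \<Rightarrow> real" and c :: real
  assumes I: "open I"
    and smooth: "smooth_on I e" "smooth_on I n" "smooth_on I w" "smooth_on I kap"
    and e': "t \<in> I \<Longrightarrow> (e has_vector_derivative - (c * kap t) *\<^sub>R n t) (at t)"
    and n': "t \<in> I \<Longrightarrow> (n has_vector_derivative (c * kap t) *\<^sub>R e t - kap t *\<^sub>R w t) (at t)"
    and w': "t \<in> I \<Longrightarrow> (w has_vector_derivative al t *\<^sub>R mu t - kap t *\<^sub>R n t) (at t)"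
    and mu': "t \<in> I \<Longrightarrow> (mu has_vector_derivative al t *\<^sub>R w t) (at t)"
    and lor1: "t \<in> I \<Longrightarrow> lor (e t) (e t) = 1" "t \<in> I \<Longrightarrow> lor (n t) (n t) = 1"
      "t \<in> I \<Longrightarrow> lor (w t) (w t) = -1" "t \<in> I \<Longrightarrow> lor (mu t) (mu t) = 1"
    and lor0: "t \<in> I \<Longrightarrow> lor (e t) (n t) = 0" "t \<in> I \<Longrightarrow> lor (e t) (w t) = 0" "t \<in> I \<Longrightarrow> lor (e t) (mu t) = 0"
      "t \<in> I \<Longrightarrow> lor (n t) (w t) = 0" "t \<in> I \<Longrightarrow> lor (n t) (mu t) = 0" "t \<in> I \<Longrightarrow> lor (w t) (mu t) = 0"
    and c: "c \<noteq> 0" and al: "t \<in> I \<Longrightarrow> al t \<noteq> 0"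
begin

definition F :: "real \<times> real \<Rightarrow> real^4" where "F x = cos (snd x) *\<^sub>R e (fst x) + sin (snd x) *\<^sub>R n (fst x)"
definition Fth :: "real \<times> real \<Rightarrow> real^4" where "Fth x = (- sin (snd x)) *\<^sub>R e (fst x) + cos (snd x) *\<^sub>R n (fst x)"
text \<open>The derivative in \<open>t\<close>, resolved in the rotated frame \<open>F\<close>,
  \<open>Fth\<close>, \<open>w\<close>, \<open>mu\<close>. Modulo \<open>Fth\<close> only the
  \<open>w\<close> term remains, so the rank drops exactly where \<open>kap sin th\<close> vanishes,
  with null direction \<open>(1, c kap)\<close>.\<close>

definition Ft :: "real \<times> real \<Rightarrow> real^4" where
  "Ft x = - (c * kap (fst x)) *\<^sub>R Fth x - (kap (fst x) * sin (snd x)) *\<^sub>R w (fst x)"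

lemma lor_frame:
  assumes "fst x \<in> I"
  shows "lor (F x) (F x) = 1" "lor (Fth x) (Fth x) = 1" "lor (w (fst x)) (w (fst x)) = -1" "lor (mu (fst x)) (mu (fst x)) = 1"
    "lor (F x) (Fth x) = 0" "lor (F x) (w (fst x)) = 0" "lor (F x) (mu (fst x)) = 0"
    "lor (Fth x) (w (fst x)) = 0" "lor (Fth x) (mu (fst x)) = 0" "lor (w (fst x)) (mu (fst x)) = 0"
  using lor0[OF assms] lor1[OF assms] sin_cos_squared_add3[of "snd x"]
  by (simp_all add: F_def Fth_def lor_simps lor_commute[of "n _" "e _"])

lemmas frame_indep = lor_orthonormal_indep[OF lor_frame]
lemmas frame_expansion = lor_orthonormal_expansion[OF lor_frame]

lemma open_dom: "open (I \<times> (UNIV :: real set))"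
  using I by (simp add: open_Times)

lemma has_derivative_shift: "((\<lambda>v. t + v) has_derivative (\<lambda>h. h)) (at (v :: real))"
  by (auto intro!: derivative_eq_intros)

lemma e_n_has_derivative:
  assumes "fst x \<in> I"
  shows "((\<lambda>x. e (fst x)) has_derivative (\<lambda>h. fst h *\<^sub>R - (c * kap (fst x)) *\<^sub>R n (fst x))) (at x)"
    "((\<lambda>x. n (fst x)) has_derivative (\<lambda>h. fst h *\<^sub>R ((c * kap (fst x)) *\<^sub>R e (fst x) - kap (fst x) *\<^sub>R w (fst x)))) (at x)"
  using has_derivative_compose[OF has_derivative_fst[OF has_derivative_ident] e'[OF assms, unfolded has_vector_derivative_def]]
    has_derivative_compose[OF has_derivative_fst[OF has_derivative_ident] n'[OF assms, unfolded has_vector_derivative_def]]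
  by auto

lemma sin_cos_has_derivative:
  "((\<lambda>x. sin (snd x)) has_derivative (\<lambda>h. cos (snd x) * snd h)) (at (x :: real \<times> real))"
  "((\<lambda>x. cos (snd x)) has_derivative (\<lambda>h. - sin (snd x) * snd h)) (at x)"
  by (auto intro!: derivative_eq_intros)

lemma F_has_derivative:
  assumes "fst x \<in> I"
  shows "(F has_derivative (\<lambda>h. fst h *\<^sub>R Ft x + snd h *\<^sub>R Fth x)) (at x)"
  unfolding F_def[abs_def]
  by (rule has_derivative_eq_rhs[OF has_derivative_add[OF
       has_derivative_scaleR[OF sin_cos_has_derivative(2) e_n_has_derivative(1)[OF assms]]
       has_derivative_scaleR[OF sin_cos_has_derivative(1) e_n_has_derivative(2)[OF assms]]]])
     (simp add: fun_eq_iff Ft_def Fth_def algebra_simps)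

lemma Fth_has_derivative:
  assumes "fst x \<in> I"
  shows "(Fth has_derivative (\<lambda>h. fst h *\<^sub>R ((c * kap (fst x)) *\<^sub>R F x - (kap (fst x) * cos (snd x)) *\<^sub>R w (fst x))
     - snd h *\<^sub>R F x)) (at x)"
  unfolding Fth_def[abs_def]
  by (rule has_derivative_eq_rhs[OF has_derivative_add[OF
       has_derivative_scaleR[OF has_derivative_minus[OF sin_cos_has_derivative(1)] e_n_has_derivative(1)[OF assms]]
       has_derivative_scaleR[OF sin_cos_has_derivative(2) e_n_has_derivative(2)[OF assms]]]])
     (simp add: fun_eq_iff F_def algebra_simps)

lemma smooth_F: "smooth_on (I \<times> UNIV) F"
proof -
  have "smooth_on (I \<times> (UNIV :: real set)) (\<lambda>x. g (fst x))" if "smooth_on I g" for g :: "real \<Rightarrow> real^4"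
    by (rule smooth_on_compose[OF that]) (auto intro!: smooth_on_intros open_dom I)
  then show ?thesis
    unfolding F_def[abs_def] using smooth by (intro smooth_on_intros open_dom) auto
qed

lemma F_S31: "fst x \<in> I \<Longrightarrow> F x \<in> S31"
  using lor_frame(1) by (simp add: S31_def)

lemma singular_pointD:
  assumes "t \<in> I" "singular_point F (t, th)"
  shows "kap t * sin th = 0"
proof (rule ccontr)
  assume ne: "kap t * sin th \<noteq> 0"
  have d: "(F has_derivative (\<lambda>h. fst h *\<^sub>R Ft (t, th) + snd h *\<^sub>R Fth (t, th))) (at (t, th))"
    using F_has_derivative[of "(t, th)"] assms(1) by simp
  have "inj (\<lambda>h. fst h *\<^sub>R Ft (t, th) + snd h *\<^sub>R Fth (t, th))"
  proof (rule linear_injective_0[OF has_derivative_linear[OF d], THEN iffD2], intro allI impI)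
    fix h :: "real \<times> real" assume "fst h *\<^sub>R Ft (t, th) + snd h *\<^sub>R Fth (t, th) = 0"
    then have "0 *\<^sub>R F (t, th) + (snd h - fst h * c * kap t) *\<^sub>R Fth (t, th) + (- (fst h * (kap t * sin th))) *\<^sub>R w (fst (t, th)) + 0 *\<^sub>R mu (fst (t, th)) = 0"
      by (simp add: Ft_def algebra_simps)
    then have "snd h - fst h * c * kap t = 0 \<and> fst h * (kap t * sin th) = 0"
      using frame_indep[of "(t, th)"] assms(1) by fastforce
    then show "h = 0" using ne by (auto simp: prod_eq_iff)
  qed
  then show False using assms(2) frechet_derivative_at[OF d] by (simp add: singular_point_def)
qed

lemma F_compose_has_derivative:
  assumes "fst (phi x) \<in> I" "(phi has_derivative phi') (at x)"
  shows "((\<lambda>x. F (phi x)) has_derivative (\<lambda>h. fst (phi' h) *\<^sub>R Ft (phi x) + snd (phi' h) *\<^sub>R Fth (phi x))) (at x)"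
  using has_derivative_compose[OF assms(2) F_has_derivative[OF assms(1)]] .

text \<open>The singular line is \<open>t = t0\<close> and the null direction is along
  \<open>t\<close>. Because \<open>kap\<close> has a simple zero, \<open>Ft\<close> is
  \<open>v\<close> times a field with nonzero \<open>w\<close> part, and differentiating
  \<open>w\<close> brings in \<open>mu\<close>, the missing vector of the frame.\<close>

lemma cuspidal_edge_at_kap_zero:
  assumes t0: "t0 \<in> I" and kap0: "kap t0 = 0" and s0: "sin th0 \<noteq> 0" and kd: "(kap has_real_derivative k1) (at t0)" "k1 \<noteq> 0"
  shows "cuspidal_edge F (t0, th0)"
proof -
  obtain r where r: "r > 0" "ball t0 r \<subseteq> I" using I t0 open_contains_ball by blast
  have mI: "t0 + v \<in> I" if "\<bar>v\<bar> < r" for v using r(2) that by (auto simp: dist_real_def subset_iff)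
  \<comment> \<open>The coordinates are swapped: \<open>u\<close> runs along the singular line, in
    the angle, and \<open>v\<close> along the null direction, in \<open>t\<close>.\<close>
  define phi where "phi = (\<lambda>x :: real \<times> real. (t0 + snd x, th0 + fst x))"
  have phid: "(phi has_derivative (\<lambda>h. (snd h, fst h))) (at x)" for x
    unfolding phi_def by (auto intro!: derivative_eq_intros)
  have ps: "smooth_on S phi" if "open S" for S
    unfolding phi_def by (intro smooth_on_intros that)
  have dg: "diffeo_germ2 phi (t0, th0)"
  proof -
    have "inj (frechet_derivative phi (at 0))"
      unfolding frechet_derivative_at[OF phid[of 0], symmetric] by (auto simp: inj_def prod_eq_iff)
    from diffeo_germ2I[OF open_UNIV ps[OF open_UNIV] UNIV_I this] show ?thesis by (simp add: phi_def)
  qed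
  have "smooth_on {-r<..<r} (\<lambda>v. kap (t0 + v))"
    by (rule smooth_on_compose[OF smooth(4)]) (use I mI in \<open>auto intro!: smooth_on_intros\<close>)
  then obtain q where q: "smooth_on {-r<..<r} q" "\<And>v. \<bar>v\<bar> < r \<Longrightarrow> kap (t0 + v) = v * q v"
    using hadamard_1d[of r "\<lambda>v. kap (t0 + v)"] kap0 by auto
  obtain q1 where q1: "(q has_real_derivative q1) (at 0)"
    using smooth_on_deriv(2)[OF _ q(1), of 0] r by auto
  have q0: "q 0 = k1"
  proof (rule DERIV_unique)
    from DERIV_mult[OF DERIV_ident q1] show "((\<lambda>v. v * q v) has_real_derivative q 0) (at 0)" by simp
    have "((\<lambda>v. kap (t0 + v)) has_real_derivative k1) (at 0)"
      using kd(1) DERIV_shift[of kap k1 0 t0] by (simp add: add.commute)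
    then show "((\<lambda>v. v * q v) has_real_derivative k1) (at 0)"
      by (rule has_field_derivative_transform_within_open[of _ _ _ "{-r<..<r}"]) (use q r in auto)
  qed
  \<comment> \<open>On the line \<open>th = th0\<close> one has \<open>Ft = - kap Z\<close>, and
    \<open>q\<close> is \<open>kap\<close> with its zero divided out; \<open>- q Z\<close> is the
    quotient required by the criterion.\<close>
  define Z where "Z = (\<lambda>v. c *\<^sub>R Fth (t0 + v, th0) + sin th0 *\<^sub>R w (t0 + v))"
  define h where "h = (\<lambda>v. (- q v) *\<^sub>R Z v)"
  define p0 where "p0 = (t0, th0)"
  have p0I: "fst p0 \<in> I" using t0 by (simp add: p0_def)
  show ?thesis
  proof (rule cuspidal_edge_criterion[OF dg _ r(1), of F])
    show "smooth_on (sq r) (\<lambda>x. F (phi x))"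
      by (rule smooth_on_compose[OF smooth_F ps open_sq open_dom]) (auto simp: phi_def mI mem_sq)
    show "F (phi x) \<in> S31" if "x \<in> sq r" for x
      by (rule F_S31) (use that in \<open>auto simp: phi_def mI mem_sq\<close>)
    have pd: "pd1 (\<lambda>x. F (phi x)) (u, 0) = Fth (phi (u, 0))" "pd2 (\<lambda>x. F (phi x)) (u, 0) = 0" for u
    proof -
      have "fst (phi (u, 0)) \<in> I" using t0 by (simp add: phi_def)
      from frechet_derivative_at[OF F_compose_has_derivative[OF this phid], symmetric]
      show "pd1 (\<lambda>x. F (phi x)) (u, 0) = Fth (phi (u, 0))" "pd2 (\<lambda>x. F (phi x)) (u, 0) = 0"
        using kap0 by (simp_all add: Ft_def phi_def)
    qed
    then show "pd2 (\<lambda>x. F (phi x)) (u, 0) = 0" for u by simp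
    show "((\<lambda>v. F (phi (0, v))) has_vector_derivative v *\<^sub>R h v) (at v)" if v: "\<bar>v\<bar> < r" for v
    proof -
      have "((\<lambda>v. (t0 + v, th0)) has_derivative (\<lambda>h. (h, 0))) (at v)" by (auto intro!: derivative_eq_intros)
      from has_derivative_compose[OF this F_has_derivative] mI[OF v]
      have "((\<lambda>v. F (t0 + v, th0)) has_vector_derivative Ft (t0 + v, th0)) (at v)"
        by (simp add: has_vector_derivative_def)
      moreover have "Ft (t0 + v, th0) = v *\<^sub>R h v"
        by (simp add: Ft_def h_def Z_def q(2)[OF v] algebra_simps)
      ultimately show ?thesis by (simp add: phi_def)
    qed
    have "((\<lambda>v. (t0 + v, th0)) has_derivative (\<lambda>h. (h, 0))) (at 0)" by (auto intro!: derivative_eq_intros)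
    from has_derivative_compose[OF this Fth_has_derivative] t0 kap0
    have 1: "((\<lambda>v. Fth (t0 + v, th0)) has_vector_derivative 0) (at 0)"
      by (simp add: has_vector_derivative_def)
    have 2: "((\<lambda>v. w (t0 + v)) has_vector_derivative al t0 *\<^sub>R mu t0) (at 0)"
      using has_derivative_compose[OF has_derivative_shift, of w "\<lambda>h. h *\<^sub>R (al t0 *\<^sub>R mu t0 - kap t0 *\<^sub>R n t0)" t0 0]
        w'[OF t0] kap0 by (simp add: has_vector_derivative_def)
    have Zd: "(Z has_vector_derivative c *\<^sub>R 0 + sin th0 *\<^sub>R al t0 *\<^sub>R mu t0) (at 0)"
      unfolding Z_def 
      by (intro has_vector_derivative_add bounded_linear.has_vector_derivative[OF bounded_linear_scaleR_right] 1 2)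
    have "(h has_vector_derivative (- q 0) *\<^sub>R (c *\<^sub>R 0 + sin th0 *\<^sub>R al t0 *\<^sub>R mu t0) + (- q1) *\<^sub>R Z 0) (at 0)"
      unfolding h_def by (intro has_vector_derivative_scaleR Zd DERIV_minus q1)
    then show "(h has_vector_derivative (- q1) *\<^sub>R Z 0 - (k1 * sin th0 * al t0) *\<^sub>R mu t0) (at 0)"
      by (rule has_vector_derivative_eq_rhs) (simp add: q0 algebra_simps)
    have pd0: "pd1 (\<lambda>x. F (phi x)) (0, 0) = Fth p0"
      unfolding pd(1) by (simp add: phi_def p0_def)
    fix a b c' d
    assume "a *\<^sub>R F (t0, th0) + b *\<^sub>R pd1 (\<lambda>x. F (phi x)) (0, 0) + c' *\<^sub>R h 0 + d *\<^sub>R ((- q1) *\<^sub>R Z 0 - (k1 * sin th0 * al t0) *\<^sub>R mu t0) = 0"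
    then have "a *\<^sub>R F p0 + (b - c' * k1 * c - d * q1 * c) *\<^sub>R Fth p0 + (- c' * k1 * sin th0 - d * q1 * sin th0) *\<^sub>R w (fst p0) + (- d * (k1 * sin th0 * al t0)) *\<^sub>R mu (fst p0) = 0"
      by (simp add: pd0 h_def Z_def q0 p0_def algebra_simps)
    from frame_indep[OF p0I p0I p0I p0I p0I p0I p0I p0I p0I p0I this]
    show "a = 0 \<and> b = 0 \<and> c' = 0 \<and> d = 0"
      using kd(2) s0 al[OF t0] by auto
  qed
qed

text \<open>Near the point the singular set is the line \<open>th = th0\<close>. On the axis
  \<open>u = 0\<close> the derivative in \<open>v\<close> has \<open>Fth\<close> and
  \<open>w\<close> coefficients which both vanish at \<open>v = 0\<close>. After division by
  \<open>v\<close> the \<open>w\<close> coefficient is nonzero, because the null direction is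
  transversal to the line, and the derivative of \<open>w\<close> again contributes
  \<open>mu\<close>.\<close>

lemma cuspidal_edge_at_kap_nonzero:
  assumes t0: "t0 \<in> I" and kap0: "kap t0 \<noteq> 0" and s0: "sin th0 = 0"
  shows "cuspidal_edge F (t0, th0)"
proof -
  obtain d where d: "d > 0" "ball t0 d \<subseteq> I" using I t0 open_contains_ball by blast
  have mI: "t0 + v \<in> I" if "\<bar>v\<bar> < d" for v using d(2) that by (auto simp: dist_real_def subset_iff)
  \<comment> \<open>The first component of \<open>phi\<close> is \<open>t0 + u + v\<close>; halving
    keeps it in \<open>I\<close>.\<close>
  define r where "r = d / 2"
  have r: "r > 0" "r < d" using d(1) by (auto simp: r_def)
  have mI1: "t0 + u \<in> I" if "(u, v) \<in> sq r" for u v using that r mI[of u] by (simp add: mem_sq)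
  have mI2: "t0 + u + v \<in> I" if "(u, v) \<in> sq r" for u v
    using that mI[of "u + v"] abs_triangle_ineq[of u v] by (simp add: mem_sq r_def add.assoc)
  define om where "om = (\<lambda>t. c * kap t)"
  have oms: "smooth_on I om" unfolding om_def by (intro smooth_on_intros I smooth(4))
  note omd = smooth_on_deriv(2)[OF I oms]
  have om0: "om t0 \<noteq> 0" using kap0 c by (simp add: om_def)
  have cs: "cos th0 * cos th0 = 1" using s0 sin_cos_squared_add3[of th0] by simp
  then have cos0: "cos th0 \<noteq> 0" by auto
  text \<open>Along \<open>th = th0\<close> the null direction is \<open>(1, om t)\<close>.\<close>
  define phi where "phi = (\<lambda>x :: real \<times> real. (t0 + fst x + snd x, th0 + snd x * om (t0 + fst x)))"
  have phid: "(phi has_derivative (\<lambda>h. (fst h + snd h, snd x * (deriv om (t0 + fst x) * fst h) + snd h * om (t0 + fst x)))) (at x)"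
    if "x \<in> sq r" for x
  proof -
    have "t0 + fst x \<in> I" using mI1[of "fst x" "snd x"] that by simp
    from has_derivative_compose[OF has_derivative_compose[OF has_derivative_fst[OF has_derivative_ident] has_derivative_shift] omd[OF this, unfolded has_field_derivative_def]]
    have "((\<lambda>x. om (t0 + fst x)) has_derivative (\<lambda>h. deriv om (t0 + fst x) * fst h)) (at x)" .
    then show ?thesis unfolding phi_def
      by (auto intro!: derivative_eq_intros)
  qed
  have ps: "smooth_on (sq r) phi"
    unfolding phi_def
    by (intro smooth_on_intros smooth_on_compose[OF oms] open_sq I) (use mI1 in auto)
  have z: "0 \<in> sq r" using r by (simp add: mem_sq)
  have dg: "diffeo_germ2 phi (t0, th0)"
  proof -
    have "inj (frechet_derivative phi (at 0))"
      unfolding frechet_derivative_at[OF phid[OF z], symmetric] using om0 by (auto simp: inj_def prod_eq_iff)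
    from diffeo_germ2I[OF open_sq ps z this] show ?thesis by (simp add: phi_def)
  qed
  have "smooth_on {-d<..<d} (\<lambda>v. om t0 - om (t0 + v))"
    by (intro smooth_on_intros smooth_on_compose[OF oms] I) (use mI in auto)
  then obtain q where q: "smooth_on {-d<..<d} q" "\<And>v. \<bar>v\<bar> < d \<Longrightarrow> om t0 - om (t0 + v) = v * q v"
    using hadamard_1d[of d "\<lambda>v. om t0 - om (t0 + v)"] by auto
  obtain q1 where q1: "(q has_real_derivative q1) (at 0)"
    using smooth_on_deriv(2)[OF _ q(1), of 0] d by auto
  \<comment> \<open>The \<open>w\<close> coefficient on the straight line with direction
    \<open>(1, om t0)\<close>; dividing out its zero gives \<open>s\<close>, as \<open>q\<close>
    does for the \<open>Fth\<close> coefficient.\<close>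
  let ?s = "\<lambda>v. kap (t0 + v) * sin (th0 + om t0 * v)"
  have "smooth_on {-d<..<d} ?s"
    by (intro smooth_on_intros smooth_on_compose[OF smooth(4)] I) (use mI in auto)
  then obtain s where s: "smooth_on {-d<..<d} s" "\<And>v. \<bar>v\<bar> < d \<Longrightarrow> ?s v = v * s v"
    using hadamard_1d[of d ?s] s0 by auto
  obtain s1 where s1: "(s has_real_derivative s1) (at 0)"
    using smooth_on_deriv(2)[OF _ s(1), of 0] d by auto
  have s_0: "s 0 = kap t0 * (cos th0 * om t0)"
  proof (rule DERIV_unique)
    from DERIV_mult[OF DERIV_ident s1] show "((\<lambda>v. v * s v) has_real_derivative s 0) (at 0)" by simp
    have k: "((\<lambda>v. kap (t0 + v)) has_real_derivative deriv kap t0) (at 0)"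
      using smooth_on_deriv(2)[OF I smooth(4) t0] DERIV_shift[of kap "deriv kap t0" 0 t0] by (simp add: add.commute)
    have "((\<lambda>v. sin (th0 + om t0 * v)) has_real_derivative cos th0 * om t0) (at 0)"
      by (auto intro!: derivative_eq_intros)
    from DERIV_mult[OF k this] have "(?s has_real_derivative kap t0 * (cos th0 * om t0)) (at 0)"
      by (simp add: s0 mult_ac)
    then show "((\<lambda>v. v * s v) has_real_derivative kap t0 * (cos th0 * om t0)) (at 0)"
      by (rule has_field_derivative_transform_within_open[of _ _ _ "{-d<..<d}"]) (use s d in auto)
  qed
  define p0 where "p0 = (t0, th0)"
  have p0I: "fst p0 \<in> I" using t0 by (simp add: p0_def)
  have nF: "n t0 = cos th0 *\<^sub>R Fth p0" using s0 cs by (simp add: Fth_def p0_def)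
  define h where "h = (\<lambda>v. q v *\<^sub>R Fth (t0 + v, th0 + om t0 * v) - s v *\<^sub>R w (t0 + v))"
  have cd: "((\<lambda>v. (t0 + v, th0 + om t0 * v)) has_derivative (\<lambda>h. (h, om t0 * h))) (at v)" for v
    by (auto intro!: derivative_eq_intros)
  show ?thesis
  proof (rule cuspidal_edge_criterion[OF dg _ r(1), of F])
    show "smooth_on (sq r) (\<lambda>x. F (phi x))"
      by (rule smooth_on_compose[OF smooth_F ps open_sq open_dom]) (auto simp: phi_def mI2)
    show "F (phi x) \<in> S31" if "x \<in> sq r" for x
      by (rule F_S31) (use that mI2[of "fst x" "snd x"] in \<open>simp add: phi_def\<close>)
    have pd: "pd1 (\<lambda>x. F (phi x)) (u, 0) = Ft (phi (u, 0))" "pd2 (\<lambda>x. F (phi x)) (u, 0) = 0" if "\<bar>u\<bar> < r" for u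
    proof -
      have x: "(u, 0) \<in> sq r" using that r by (simp add: mem_sq)
      have "fst (phi (u, 0)) \<in> I" using mI2[OF x] by (simp add: phi_def)
      from frechet_derivative_at[OF F_compose_has_derivative[OF this phid[OF x]], symmetric]
      show "pd1 (\<lambda>x. F (phi x)) (u, 0) = Ft (phi (u, 0))" "pd2 (\<lambda>x. F (phi x)) (u, 0) = 0"
        using s0 by (simp_all add: Ft_def phi_def om_def)
    qed
    then show "\<bar>u\<bar> < r \<Longrightarrow> pd2 (\<lambda>x. F (phi x)) (u, 0) = 0" for u by simp
    show "((\<lambda>v. F (phi (0, v))) has_vector_derivative v *\<^sub>R h v) (at v)" if "\<bar>v\<bar> < r" for v
    proof -
      have v: "\<bar>v\<bar> < d" using that r by simp
      from has_derivative_compose[OF cd F_has_derivative, of v] mI[OF v]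
      have "((\<lambda>v. F (t0 + v, th0 + om t0 * v)) has_vector_derivative
          Ft (t0 + v, th0 + om t0 * v) + om t0 *\<^sub>R Fth (t0 + v, th0 + om t0 * v)) (at v)"
        by (simp add: has_vector_derivative_def scaleR_add_right mult.commute)
      moreover have "Ft (t0 + v, th0 + om t0 * v) + om t0 *\<^sub>R Fth (t0 + v, th0 + om t0 * v) =
         (om t0 - om (t0 + v)) *\<^sub>R Fth (t0 + v, th0 + om t0 * v) - (?s v) *\<^sub>R w (t0 + v)"
        by (simp add: Ft_def om_def algebra_simps)
      then have "Ft (t0 + v, th0 + om t0 * v) + om t0 *\<^sub>R Fth (t0 + v, th0 + om t0 * v) = v *\<^sub>R h v"
        unfolding q(2)[OF v] s(2)[OF v] by (simp add: h_def algebra_simps)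
      ultimately show ?thesis by (simp add: phi_def mult.commute)
    qed
    have 1: "((\<lambda>v. Fth (t0 + v, th0 + om t0 * v)) has_vector_derivative - (kap t0 * cos th0) *\<^sub>R w t0) (at 0)"
      using has_derivative_compose[OF cd Fth_has_derivative, of 0] t0
      by (simp add: has_vector_derivative_def om_def algebra_simps)
    have 2: "((\<lambda>v. w (t0 + v)) has_vector_derivative al t0 *\<^sub>R mu t0 - kap t0 *\<^sub>R n t0) (at 0)"
      using has_derivative_compose[OF has_derivative_shift, of w "\<lambda>h. h *\<^sub>R (al t0 *\<^sub>R mu t0 - kap t0 *\<^sub>R n t0)" t0 0]
        w'[OF t0] by (simp add: has_vector_derivative_def)
    have "(h has_vector_derivative (q 0 *\<^sub>R (- (kap t0 * cos th0) *\<^sub>R w t0) + q1 *\<^sub>R Fth (t0 + 0, th0 + om t0 * 0))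
        - (s 0 *\<^sub>R (al t0 *\<^sub>R mu t0 - kap t0 *\<^sub>R n t0) + s1 *\<^sub>R w (t0 + 0))) (at 0)"
      unfolding h_def by (intro has_vector_derivative_diff has_vector_derivative_scaleR 1 2 q1 s1)
    note hd = this
    define h1 where "h1 = (q1 + s 0 * kap t0 * cos th0) *\<^sub>R Fth p0 + (- (q 0 * kap t0 * cos th0) - s1) *\<^sub>R w t0 - (s 0 * al t0) *\<^sub>R mu t0"
    show "(h has_vector_derivative h1) (at 0)"
      by (rule has_vector_derivative_eq_rhs[OF hd]) (simp add: nF p0_def h1_def algebra_simps)
    have pd0: "pd1 (\<lambda>x. F (phi x)) (0, 0) = Ft p0"
      using pd(1)[of 0] r by (simp add: phi_def p0_def)
    fix a b c' d'
    assume "a *\<^sub>R F (t0, th0) + b *\<^sub>R pd1 (\<lambda>x. F (phi x)) (0, 0) + c' *\<^sub>R h 0 + d' *\<^sub>R h1 = 0"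
    then have "a *\<^sub>R F p0 + (- b * om t0 + c' * q 0 + d' * (q1 + s 0 * kap t0 * cos th0)) *\<^sub>R Fth p0
       + (- c' * s 0 + d' * (- (q 0 * kap t0 * cos th0) - s1)) *\<^sub>R w (fst p0) + (- d' * (s 0 * al t0)) *\<^sub>R mu (fst p0) = 0"
      using s0 by (simp add: pd0 h_def h1_def p0_def Ft_def om_def algebra_simps)
    from frame_indep[OF p0I p0I p0I p0I p0I p0I p0I p0I p0I p0I this]
    show "a = 0 \<and> b = 0 \<and> c' = 0 \<and> d' = 0"
      using s_0 kap0 cos0 om0 al[OF t0] by auto
  qed
qed

end

section \<open>Obstructions from singular sets and conormals\<close>

lemma path_in_open:
  fixes x :: "real \<Rightarrow> 'a::real_normed_vector"
  assumes "open V" "isCont x t" "x t \<in> V"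
  obtains d where "d > 0" "\<And>s. \<bar>s - t\<bar> < d \<Longrightarrow> x s \<in> V"
proof -
  have "\<forall>\<^sub>F s in at t. x s \<in> V"
    using assms by (auto simp: isCont_def intro: topological_tendstoD)
  then obtain d where "d > 0" "\<forall>s. s \<noteq> t \<and> dist s t < d \<longrightarrow> x s \<in> V"
    by (auto simp: eventually_at)
  then show thesis using that assms(3) by (metis dist_real_def)
qed

lemma isCont_limit_unique:
  fixes f g :: "real \<Rightarrow> real"
  assumes "isCont f 0" "d > 0" "\<And>v. v \<noteq> 0 \<Longrightarrow> \<bar>v\<bar> < d \<Longrightarrow> f v = g v" "(g \<longlongrightarrow> L) (at 0)"
  shows "f 0 = L"
proof -
  have "\<forall>\<^sub>F v in at 0. g v = f v"
    using assms(2,3) by (auto simp: eventually_at intro!: exI[of _ d])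
  from Lim_transform_eventually[OF assms(4) this] have "(f \<longlongrightarrow> L) (at 0)" .
  with assms(1) show ?thesis
    using tendsto_unique[OF at_neq_bot] by (auto simp: isCont_def)
qed

lemma bounded_bilinear_lor: "bounded_bilinear lor"
proof -
  have "bilinear lor"
    unfolding bilinear_def by (auto intro!: linearI simp: lor_simps)
  then show ?thesis by (simp add: bilinear_conv_bounded_bilinear)
qed

lemmas isCont_lor = bounded_bilinear.isCont[OF bounded_bilinear_lor]

text \<open>The common shape of the normal forms: the first component of \<open>G\<close> is
  \<open>u\<close>, so the columns satisfy \<open>fst gu = 1\<close> and \<open>fst gv = 0\<close>.
  Hence \<open>G\<close> is singular exactly where \<open>gv = 0\<close>, and the null direction
  there is the \<open>v\<close> direction.\<close>

locale focal_germ = focal_frame +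
  fixes t0 th0 :: real and phi psi :: "real \<times> real \<Rightarrow> real \<times> real" and chi :: "real \<times> real \<times> real \<Rightarrow> real^4"
    and V U W and G gu gv :: "real \<times> real \<Rightarrow> real \<times> real \<times> real"
  assumes VU: "open V" "0 \<in> V" "open U" "(t0, th0) \<in> U" "U \<subseteq> I \<times> UNIV" "smooth_on V phi" "smooth_on U psi"
      "phi 0 = (t0, th0)" "psi (t0, th0) = 0"
    and phi_psi: "\<And>x. x \<in> V \<Longrightarrow> phi x \<in> U \<and> psi (phi x) = x" "\<And>y. y \<in> U \<Longrightarrow> psi y \<in> V \<and> phi (psi y) = y"
    and W: "open W" "smooth_on W chi" "\<And>x. x \<in> V \<Longrightarrow> G x \<in> W \<and> F (phi x) = chi (G x)"
      "\<And>y. y \<in> W \<Longrightarrow> inj (frechet_derivative chi (at y))"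
    and G: "smooth_on UNIV G" "\<And>x. (G has_derivative (\<lambda>h. fst h *\<^sub>R gu x + snd h *\<^sub>R gv x)) (at x)"
      "\<And>x. fst (gu x) = 1" "\<And>x. fst (gv x) = 0"
    and gv0: "gv 0 = 0"
begin

abbreviation "p \<equiv> (t0, th0)"
abbreviation "dchi y \<equiv> frechet_derivative chi (at y)"

lemma t0: "t0 \<in> I" using VU by auto

lemma phi_I: "x \<in> V \<Longrightarrow> fst (phi x) \<in> I"
  using phi_psi(1)[of x] VU(5) by (auto simp: mem_Times_iff)

lemma dchi: "x \<in> V \<Longrightarrow> (chi has_derivative dchi (G x)) (at (G x))"
  using W(3) by (intro smooth_on_has_derivative[OF W(2)]) auto

lemma dchi_linear: "x \<in> V \<Longrightarrow> linear (dchi (G x))"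
  using dchi has_derivative_linear by blast

lemma dchi_eq_0:
  assumes "x \<in> V" "dchi (G x) k = 0"
  shows "k = 0"
proof -
  have "inj (dchi (G x))" using W(3)[OF assms(1)] W(4) by blast
  then show ?thesis using linear_injective_0[OF dchi_linear[OF assms(1)]] assms(2) by blast
qed

text \<open>Chain rule on both sides of \<open>F (phi x) = chi (G x)\<close>.\<close>

lemma dchi_columns:
  assumes x: "x \<in> V"
  shows "dchi (G x) (gu x) = fst (pd1 phi x) *\<^sub>R Ft (phi x) + snd (pd1 phi x) *\<^sub>R Fth (phi x)"
    "dchi (G x) (gv x) = fst (pd2 phi x) *\<^sub>R Ft (phi x) + snd (pd2 phi x) *\<^sub>R Fth (phi x)"
proof -
  have "((\<lambda>x. F (phi x)) has_derivative (\<lambda>h. dchi (G x) (fst h *\<^sub>R gu x + snd h *\<^sub>R gv x))) (at x)"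
    by (rule has_derivative_transform_within_open[OF has_derivative_compose[OF G(2) dchi[OF x]] VU(1) x])
       (use W(3) in auto)
  with F_compose_has_derivative[OF phi_I[OF x] has_derivative_pd[OF VU(6) x]]
  have "(\<lambda>h. fst (fst h *\<^sub>R pd1 phi x + snd h *\<^sub>R pd2 phi x) *\<^sub>R Ft (phi x) + snd (fst h *\<^sub>R pd1 phi x + snd h *\<^sub>R pd2 phi x) *\<^sub>R Fth (phi x))
     = (\<lambda>h. dchi (G x) (fst h *\<^sub>R gu x + snd h *\<^sub>R gv x))"
    by (rule has_derivative_unique)
  from fun_cong[OF this, of "(1, 0)"] fun_cong[OF this, of "(0, 1)"]
  show "dchi (G x) (gu x) = fst (pd1 phi x) *\<^sub>R Ft (phi x) + snd (pd1 phi x) *\<^sub>R Fth (phi x)"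
    "dchi (G x) (gv x) = fst (pd2 phi x) *\<^sub>R Ft (phi x) + snd (pd2 phi x) *\<^sub>R Fth (phi x)"
    by simp_all
qed

lemma phi_indep:
  assumes x: "x \<in> V" and "a *\<^sub>R pd1 phi x + b *\<^sub>R pd2 phi x = 0"
  shows "a = 0 \<and> b = 0"
proof -
  have y: "phi x \<in> U" using phi_psi(1)[OF x] by simp
  have "((\<lambda>x. psi (phi x)) has_derivative (\<lambda>h. h)) (at x)"
    by (rule has_derivative_transform_within_open[OF has_derivative_ident VU(1) x]) (use phi_psi in auto)
  with has_derivative_compose[OF has_derivative_pd[OF VU(6) x] smooth_on_has_derivative[OF VU(7) y]]
  have "(\<lambda>h. frechet_derivative psi (at (phi x)) (fst h *\<^sub>R pd1 phi x + snd h *\<^sub>R pd2 phi x)) = (\<lambda>h. h)"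
    by (rule has_derivative_unique)
  from fun_cong[OF this, of "(a, b)"] assms(2)
    linear_0[OF has_derivative_linear[OF smooth_on_has_derivative[OF VU(7) y]]]
  show ?thesis by (simp add: zero_prod_def)
qed

lemma psi_columns:
  "fst (pd1 psi p) *\<^sub>R pd1 phi 0 + snd (pd1 psi p) *\<^sub>R pd2 phi 0 = (1, 0)"
  "fst (pd2 psi p) *\<^sub>R pd1 phi 0 + snd (pd2 psi p) *\<^sub>R pd2 phi 0 = (0, 1)"
proof -
  have "((\<lambda>y. phi (psi y)) has_derivative (\<lambda>h. h)) (at p)"
    by (rule has_derivative_transform_within_open[OF has_derivative_ident VU(3,4)]) (use phi_psi in auto)
  with has_derivative_compose[OF has_derivative_pd[OF VU(7,4)], unfolded VU(9), OF has_derivative_pd[OF VU(6,2)]]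
  have "(\<lambda>h. fst (fst h *\<^sub>R pd1 psi p + snd h *\<^sub>R pd2 psi p) *\<^sub>R pd1 phi 0 + snd (fst h *\<^sub>R pd1 psi p + snd h *\<^sub>R pd2 psi p) *\<^sub>R pd2 phi 0)
      = (\<lambda>h. h)"
    by (rule has_derivative_unique)
  from fun_cong[OF this, of "(1, 0)"] fun_cong[OF this, of "(0, 1)"]
  show "fst (pd1 psi p) *\<^sub>R pd1 phi 0 + snd (pd1 psi p) *\<^sub>R pd2 phi 0 = (1, 0)"
  "fst (pd2 psi p) *\<^sub>R pd1 phi 0 + snd (pd2 psi p) *\<^sub>R pd2 phi 0 = (0, 1)" by simp_all
qed

text \<open>Where \<open>gv\<close> vanishes, \<open>pd2 phi\<close> lies in the kernel of the
  derivative of \<open>F\<close>. Its frame coefficients along \<open>Fth\<close> and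
  \<open>w\<close> give the slope and the singularity condition; the \<open>t\<close> component
  cannot vanish, as otherwise \<open>pd2 phi\<close> would.\<close>

lemma null_direction:
  assumes x: "x \<in> V" and "gv x = 0"
  shows "snd (pd2 phi x) = c * kap (fst (phi x)) * fst (pd2 phi x)" "fst (pd2 phi x) \<noteq> 0"
    "kap (fst (phi x)) * sin (snd (phi x)) = 0"
proof -
  have "0 *\<^sub>R F (phi x) + (snd (pd2 phi x) - c * kap (fst (phi x)) * fst (pd2 phi x)) *\<^sub>R Fth (phi x) +
      (- fst (pd2 phi x) * (kap (fst (phi x)) * sin (snd (phi x)))) *\<^sub>R w (fst (phi x)) + 0 *\<^sub>R mu (fst (phi x)) = 0"
    using dchi_columns(2)[OF x] assms(2) linear_0[OF dchi_linear[OF x]] by (simp add: Ft_def algebra_simps)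
  note z = frame_indep[OF phi_I phi_I phi_I phi_I phi_I phi_I phi_I phi_I phi_I phi_I this, OF x x x x x x x x x x]
  then show e: "snd (pd2 phi x) = c * kap (fst (phi x)) * fst (pd2 phi x)" by simp
  show f: "fst (pd2 phi x) \<noteq> 0"
  proof
    assume "fst (pd2 phi x) = 0"
    then have "0 *\<^sub>R pd1 phi x + 1 *\<^sub>R pd2 phi x = 0" using e by (simp add: prod_eq_iff)
    from phi_indep[OF x this] show False by simp
  qed
  show "kap (fst (phi x)) * sin (snd (phi x)) = 0" using z f by simp
qed

text \<open>At a singular point both columns are multiples of \<open>Fth\<close>. Injectivity of
  \<open>dchi\<close> carries this dependence back to \<open>gu\<close> and \<open>gv\<close>, whose
  first components 1 and 0 leave only \<open>gv = 0\<close>.\<close>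

lemma singular_imp_gv:
  assumes x: "x \<in> V" and s: "kap (fst (phi x)) * sin (snd (phi x)) = 0"
  shows "gv x = 0"
proof -
  define a where "a = snd (pd1 phi x) - c * kap (fst (phi x)) * fst (pd1 phi x)"
  define b where "b = snd (pd2 phi x) - c * kap (fst (phi x)) * fst (pd2 phi x)"
  have "Ft (phi x) = - (c * kap (fst (phi x))) *\<^sub>R Fth (phi x)"
    by (simp only: Ft_def s) simp
  then have ab: "dchi (G x) (gu x) = a *\<^sub>R Fth (phi x)" "dchi (G x) (gv x) = b *\<^sub>R Fth (phi x)"
    using dchi_columns[OF x] by (simp_all add: a_def b_def algebra_simps)
  note l = dchi_linear[OF x]
  have "dchi (G x) (b *\<^sub>R gu x - a *\<^sub>R gv x) = 0"
    using ab by (simp add: linear_diff[OF l] linear_scale[OF l])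
  from dchi_eq_0[OF x this] have "b *\<^sub>R gu x = a *\<^sub>R gv x" by simp
  then have "fst (b *\<^sub>R gu x) = fst (a *\<^sub>R gv x)" by simp
  then have "b = 0" using G(3,4) by simp
  then have "dchi (G x) (gv x) = 0" using ab by simp
  then show ?thesis by (rule dchi_eq_0[OF x])
qed

lemma singular_p: "kap t0 * sin th0 = 0"
  using null_direction(3)[OF VU(2) gv0] VU(8) by simp

text \<open>Orthogonality to \<open>F\<close>, \<open>w\<close> and \<open>mu\<close> forces the column \<open>dchi (G 0) k\<close> to be parallel to \<open>Fth\<close>,
  and so is the other column \<open>dchi (G 0) (gu 0)\<close>.\<close>

lemma no_conormal:
  assumes k: "fst k = 0" "k \<noteq> 0"
    and "lor (dchi (G 0) k) (F p) = 0" "lor (dchi (G 0) k) (w t0) = 0" "lor (dchi (G 0) k) (mu t0) = 0"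
  shows False
proof -
  let ?y = "dchi (G 0) k"
  have "fst p \<in> I" using t0 by simp
  note ex = frame_expansion[OF this this this this this this this this this this, of ?y]
  define a where "a = lor ?y (Fth p)"
  have y: "?y = a *\<^sub>R Fth p" using ex assms(3-5) by (simp add: a_def)
  define b where "b = snd (pd1 phi 0) - c * kap t0 * fst (pd1 phi 0)"
  have "Ft p = - (c * kap t0) *\<^sub>R Fth p"
    by (simp only: Ft_def fst_conv snd_conv singular_p) simp
  then have u: "dchi (G 0) (gu 0) = b *\<^sub>R Fth p"
    using dchi_columns(1)[OF VU(2)] VU(8) by (simp add: b_def algebra_simps)
  note l = dchi_linear[OF VU(2)]
  have "dchi (G 0) (a *\<^sub>R gu 0 - b *\<^sub>R k) = 0"
    using y u by (simp add: linear_diff[OF l] linear_scale[OF l])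
  from dchi_eq_0[OF VU(2) this] have "a *\<^sub>R gu 0 = b *\<^sub>R k" by simp
  then have "fst (a *\<^sub>R gu 0) = fst (b *\<^sub>R k)" by simp
  then have "a = 0" using G(3) k by simp
  then have "?y = 0" using y by simp
  from dchi_eq_0[OF VU(2) this] k show False by simp
qed

lemma phi_curve:
  assumes "(a has_real_derivative a') (at s)" "(b has_real_derivative b') (at s)" "(a s, b s) \<in> V"
  shows "((\<lambda>s. fst (phi (a s, b s))) has_real_derivative a' * fst (pd1 phi (a s, b s)) + b' * fst (pd2 phi (a s, b s))) (at s)"
    "((\<lambda>s. snd (phi (a s, b s))) has_real_derivative a' * snd (pd1 phi (a s, b s)) + b' * snd (pd2 phi (a s, b s))) (at s)"
  using bounded_linear.has_vector_derivative[OF bounded_linear_fst has_vector_derivative_pd[OF VU(6) assms(3,1,2)]]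
    bounded_linear.has_vector_derivative[OF bounded_linear_snd has_vector_derivative_pd[OF VU(6) assms(3,1,2)]]
  by (simp_all add: has_real_derivative_iff_has_vector_derivative)

lemma psi_curve_th:
  "((\<lambda>s. fst (psi (t0, s))) has_real_derivative fst (pd2 psi p)) (at th0)"
  "((\<lambda>s. snd (psi (t0, s))) has_real_derivative snd (pd2 psi p)) (at th0)"
  using bounded_linear.has_vector_derivative[OF bounded_linear_fst has_vector_derivative_pd[of U psi "\<lambda>_. t0" th0 "\<lambda>s. s" 0 1]]
    bounded_linear.has_vector_derivative[OF bounded_linear_snd has_vector_derivative_pd[of U psi "\<lambda>_. t0" th0 "\<lambda>s. s" 0 1]]
    VU(4,7)
  by (simp_all add: has_real_derivative_iff_has_vector_derivative)

lemma psi_curve_t: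
  "((\<lambda>s. fst (psi (s, th0))) has_real_derivative fst (pd1 psi p)) (at t0)"
  "((\<lambda>s. snd (psi (s, th0))) has_real_derivative snd (pd1 psi p)) (at t0)"
  using bounded_linear.has_vector_derivative[OF bounded_linear_fst has_vector_derivative_pd[of U psi "\<lambda>s. s" t0 "\<lambda>_. th0" 1 0]]
    bounded_linear.has_vector_derivative[OF bounded_linear_snd has_vector_derivative_pd[of U psi "\<lambda>s. s" t0 "\<lambda>_. th0" 1 0]]
    VU(4,7)
  by (simp_all add: has_real_derivative_iff_has_vector_derivative)

lemma singular_line_t0:
  assumes "kap t0 = 0"
  obtains d where "d > 0" "\<And>s. \<bar>s - th0\<bar> < d \<Longrightarrow> (t0, s) \<in> U \<and> gv (psi (t0, s)) = 0"
proof -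
  obtain d where d: "d > 0" "\<And>s. \<bar>s - th0\<bar> < d \<Longrightarrow> (t0, s) \<in> U"
    using path_in_open[OF VU(3), where x = "\<lambda>s. (t0, s)" and t = th0] VU(4) by (auto intro: continuous_intros)
  have "gv (psi (t0, s)) = 0" if "\<bar>s - th0\<bar> < d" for s
    using singular_imp_gv[of "psi (t0, s)"] phi_psi(2)[OF d(2)[OF that]] assms by simp
  with d show thesis using that by blast
qed

lemma singular_line_th0:
  assumes "sin th0 = 0"
  obtains d where "d > 0" "\<And>s. \<bar>s - t0\<bar> < d \<Longrightarrow> (s, th0) \<in> U \<and> gv (psi (s, th0)) = 0"
proof -
  obtain d where d: "d > 0" "\<And>s. \<bar>s - t0\<bar> < d \<Longrightarrow> (s, th0) \<in> U"
    using path_in_open[OF VU(3), where x = "\<lambda>s. (s, th0)" and t = t0] VU(4) by (auto intro: continuous_intros)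
  have "gv (psi (s, th0)) = 0" if "\<bar>s - t0\<bar> < d" for s
    using singular_imp_gv[of "psi (s, th0)"] phi_psi(2)[OF d(2)[OF that]] assms by simp
  with d show thesis using that by blast
qed

text \<open>For nonzero \<open>v\<close> the vector \<open>dchi k\<close> is the derivative of
  \<open>F o phi\<close> in \<open>v\<close>, divided by \<open>v\<close>, so its products with the
  frame are known. Written through \<open>chi\<close> it extends smoothly to \<open>v = 0\<close>,
  where the limits of these products can be taken.\<close>

lemma dchi_along_axis:
  assumes k: "smooth_on UNIV k" and gk: "\<And>v. gv (0, v) = v *\<^sub>R k v"
  obtains d where "d > 0" "\<And>v. \<bar>v\<bar> < d \<Longrightarrow> (0, v) \<in> V"
    "smooth_on {-d<..<d} (\<lambda>v. dchi (G (0, v)) (k v))"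
    "\<And>v. \<bar>v\<bar> < d \<Longrightarrow> v \<noteq> 0 \<Longrightarrow> lor (dchi (G (0, v)) (k v)) (F (phi (0, v))) = 0"
    "\<And>v. \<bar>v\<bar> < d \<Longrightarrow> v \<noteq> 0 \<Longrightarrow> lor (dchi (G (0, v)) (k v)) (mu (fst (phi (0, v)))) = 0"
    "\<And>v. \<bar>v\<bar> < d \<Longrightarrow> v \<noteq> 0 \<Longrightarrow> lor (dchi (G (0, v)) (k v)) (w (fst (phi (0, v)))) =
        fst (pd2 phi (0, v)) * sin (snd (phi (0, v))) * (kap (fst (phi (0, v))) / v)"
proof -
  obtain d where d: "d > 0" "\<And>v. \<bar>v - 0\<bar> < d \<Longrightarrow> (0, v) \<in> V"
    using path_in_open[OF VU(1), where x = "\<lambda>v. (0, v)" and t = 0] VU(2) by (auto intro: continuous_intros simp: zero_prod_def)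
  have Gs: "smooth_on {-d<..<d} (\<lambda>v. G (0, v))"
    by (rule smooth_on_compose[OF G(1)]) (auto intro!: smooth_on_intros)
  have "smooth_on {-d<..<d} (\<lambda>v. \<Sum>j\<in>Basis. (k v \<bullet> j) *\<^sub>R dchi (G (0, v)) j)"
  proof (intro smooth_on_sum smooth_on_scaleR smooth_on_inner smooth_on_subset[OF k])
    fix j :: "real \<times> real \<times> real" assume "j \<in> Basis"
    show "smooth_on {-d<..<d} (\<lambda>v. dchi (G (0, v)) j)"
      by (rule smooth_on_compose[OF smooth_on_frechet_Basis[OF W(2) \<open>j \<in> Basis\<close>] Gs _ W(1)])
         (use d(2) W(3) in auto)
  qed auto
  then have 1: "smooth_on {-d<..<d} (\<lambda>v. dchi (G (0, v)) (k v))"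
  proof (rule smooth_on_cong[rotated 1])
    fix v assume "v \<in> {-d<..<d}"
    then have "(0, v) \<in> V" using d(2)[of v] by (auto simp: abs_less_iff)
    note l = dchi_linear[OF this]
    have "dchi (G (0, v)) (\<Sum>j\<in>Basis. (k v \<bullet> j) *\<^sub>R j) = (\<Sum>j\<in>Basis. (k v \<bullet> j) *\<^sub>R dchi (G (0, v)) j)"
      by (simp add: linear_sum[OF l] linear_scale[OF l])
    then show "(\<Sum>j\<in>Basis. (k v \<bullet> j) *\<^sub>R dchi (G (0, v)) j) = dchi (G (0, v)) (k v)"
      by (simp add: euclidean_representation)
  qed auto
  have Y: "lor (dchi (G (0, v)) (k v)) z = lor (fst (pd2 phi (0, v)) *\<^sub>R Ft (phi (0, v)) + snd (pd2 phi (0, v)) *\<^sub>R Fth (phi (0, v))) z / v"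
    if "\<bar>v\<bar> < d" "v \<noteq> 0" for v z
  proof -
    have m: "(0, v) \<in> V" using d(2)[of v] that by simp
    have "v *\<^sub>R dchi (G (0, v)) (k v) = fst (pd2 phi (0, v)) *\<^sub>R Ft (phi (0, v)) + snd (pd2 phi (0, v)) *\<^sub>R Fth (phi (0, v))"
      using dchi_columns(2)[OF m] gk[of v] linear_scale[OF dchi_linear[OF m]] by simp
    then show ?thesis using that(2) by (metis lor_scaleR(1) nonzero_mult_div_cancel_left)
  qed
  show thesis
  proof (rule that[OF d(1) _ 1])
    fix v assume v: "\<bar>v\<bar> < d"
    show m: "(0, v) \<in> V" using d(2)[of v] v by simp
    note fr = lor_frame[OF phi_I[OF m]]
    assume v0: "v \<noteq> 0"
    show "lor (dchi (G (0, v)) (k v)) (F (phi (0, v))) = 0"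
      "lor (dchi (G (0, v)) (k v)) (mu (fst (phi (0, v)))) = 0"
      "lor (dchi (G (0, v)) (k v)) (w (fst (phi (0, v)))) = fst (pd2 phi (0, v)) * sin (snd (phi (0, v))) * (kap (fst (phi (0, v))) / v)"
      unfolding Y[OF v v0]
      using fr by (simp_all add: Ft_def lor_simps lor_commute[of "Fth _" "F _"] lor_commute[of "w _" "F _"])
  qed
qed

text \<open>The swallowtail is singular on the parabola \<open>u = - 6 v^2\<close>, which at the
  origin is tangent to the null direction. The focal surface has a singular line transversal to the
  null direction: \<open>th = th0\<close> if \<open>kap t0\<close> is nonzero, \<open>t = t0\<close>
  otherwise.\<close>

lemma no_swallowtail:
  assumes gv: "\<And>u v. gv (u, v) = (0, 12 * v^2 + 2 * u, 12 * v^3 + 2 * u * v)"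
  shows False
proof (cases "kap t0 = 0")
  case False
  then have s0: "sin th0 = 0" using singular_p by simp
  \<comment> \<open>Where \<open>kap\<close> is nonzero, only the sine can make a point
    singular.\<close>
  define V' where "V' = V \<inter> (\<lambda>x. kap (fst (phi x))) -` (-{0})"
  have "continuous_on V (\<lambda>x. kap (fst (phi x)))"
    by (rule continuous_on_compose2[OF smooth_on_imp_continuous_on[OF smooth(4)]])
       (use phi_I in \<open>auto intro!: continuous_intros smooth_on_imp_continuous_on[OF VU(6)]\<close>)
  then have "open V'" unfolding V'_def by (intro continuous_open_preimage VU(1)) auto
  moreover have "isCont (\<lambda>v::real. (-6 * v\<^sup>2, v)) 0" by (intro continuous_intros)
  moreover have "(-6 * (0::real)\<^sup>2, 0) \<in> V'" using VU(2,8) False by (auto simp: V'_def zero_prod_def)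
  ultimately obtain d where d: "d > 0" "\<And>v. \<bar>v - 0\<bar> < d \<Longrightarrow> (-6 * v\<^sup>2, v) \<in> V'"
    using path_in_open[where x = "\<lambda>v. (-6 * v\<^sup>2, v)" and t = 0] by blast
  have sn: "sin (snd (phi (-6 * v\<^sup>2, v))) = 0" if "\<bar>v\<bar> < d" for v
  proof -
    have m: "(-6 * v\<^sup>2, v) \<in> V" "kap (fst (phi (-6 * v\<^sup>2, v))) \<noteq> 0" using d(2)[of v] that by (auto simp: V'_def)
    have "gv (-6 * v\<^sup>2, v) = 0" by (simp add: gv zero_prod_def power2_eq_square power3_eq_cube)
    from null_direction(3)[OF m(1) this] m(2) show ?thesis by simp
  qed
  have "((\<lambda>v. snd (phi (-6 * v\<^sup>2, v))) has_real_derivative 0 * snd (pd1 phi (-6 * 0\<^sup>2, 0)) + 1 * snd (pd2 phi (-6 * 0\<^sup>2, 0))) (at 0)"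
    by (rule phi_curve) (use VU(2) in \<open>auto intro!: derivative_eq_intros simp: zero_prod_def\<close>)
  then have "((\<lambda>v. sin (snd (phi (-6 * v\<^sup>2, v)))) has_real_derivative cos th0 * snd (pd2 phi 0)) (at 0)"
    by (auto intro!: derivative_eq_intros simp: VU(8)[unfolded zero_prod_def] zero_prod_def)
  moreover have "((\<lambda>v. sin (snd (phi (-6 * v\<^sup>2, v)))) has_real_derivative 0) (at 0)"
    by (rule has_field_derivative_transform_within_open[OF DERIV_const[of 0], of "{-d<..<d}"]) (use sn d in auto)
  ultimately have "cos th0 * snd (pd2 phi 0) = 0" by (rule DERIV_unique)
  then have "snd (pd2 phi 0) = 0" using s0 sin_cos_squared_add3[of th0] by auto
  then show False using null_direction(1,2)[OF VU(2) gv0] VU(8) c False by simp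
next
  case True
  then obtain d where d: "d > 0" "\<And>s. \<bar>s - th0\<bar> < d \<Longrightarrow> (t0, s) \<in> U \<and> gv (psi (t0, s)) = 0"
    using singular_line_t0 by blast
  have e: "-6 * (snd (psi (t0, s)))\<^sup>2 = fst (psi (t0, s))" if "\<bar>s - th0\<bar> < d" for s
    using d(2)[OF that] gv[of "fst (psi (t0, s))" "snd (psi (t0, s))"] by (simp add: zero_prod_def)
  have "((\<lambda>s. -6 * (snd (psi (t0, s)))\<^sup>2) has_real_derivative 0) (at th0)"
    by (auto intro!: derivative_eq_intros psi_curve_th simp: VU(9))
  then have "((\<lambda>s. fst (psi (t0, s))) has_real_derivative 0) (at th0)"
    by (rule has_field_derivative_transform_within_open[where S = "{th0 - d<..<th0 + d}"]) (use e d in \<open>auto simp: abs_less_iff\<close>)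
  then have "fst (pd2 psi p) = 0" using DERIV_unique psi_curve_th(1) by blast
  with psi_columns(2) have "snd (pd2 psi p) * snd (pd2 phi 0) = 1"
    by (simp add: prod_eq_iff)
  then show False using null_direction(1)[OF VU(2) gv0] VU(8) True by simp
qed

text \<open>The lips are singular only at the origin, whereas the line \<open>t = t0\<close>
  consists of singular points.\<close>

lemma no_lips:
  assumes gv: "\<And>u v. gv (u, v) = (0, 6 * v^2 + u^2, 12 * v^3 + 2 * u^2 * v)" and "kap t0 = 0"
  shows False
proof -
  obtain d where d: "d > 0" "\<And>s. \<bar>s - th0\<bar> < d \<Longrightarrow> (t0, s) \<in> U \<and> gv (psi (t0, s)) = 0"
    using singular_line_t0[OF assms(2)] by blast
  have s: "(t0, th0 + d/2) \<in> U" "gv (psi (t0, th0 + d/2)) = 0"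
    using d(2)[of "th0 + d/2"] d(1) by auto
  then have "6 * (snd (psi (t0, th0 + d/2)))\<^sup>2 + (fst (psi (t0, th0 + d/2)))\<^sup>2 = 0"
    using gv[of "fst (psi (t0, th0 + d/2))" "snd (psi (t0, th0 + d/2))"] by (simp add: zero_prod_def)
  then have "psi (t0, th0 + d/2) = 0"
    by (simp add: add_nonneg_eq_0_iff prod_eq_iff)
  then have "phi 0 = (t0, th0 + d/2)" using phi_psi(2)[OF s(1)] by simp
  then show False using VU(8) d(1) by simp
qed

text \<open>The beaks are singular on the two lines \<open>u^2 = 6 v^2\<close>, neither of them in
  the null direction \<open>u = 0\<close>. If \<open>sin th0 = 0\<close>, the line
  \<open>th = th0\<close> is singular and runs in the null direction, since
  \<open>kap t0 = 0\<close>; its preimage would have to be tangent to both.\<close>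

lemma no_beaks:
  assumes gv: "\<And>u v. gv (u, v) = (0, 6 * v^2 - u^2, 12 * v^3 - 2 * u^2 * v)" and k0: "kap t0 = 0"
  shows False
proof -
  have b: "snd (pd2 phi 0) = 0" "fst (pd2 phi 0) \<noteq> 0"
    using null_direction(1,2)[OF VU(2) gv0] VU(8) k0 by auto
  let ?a = "fst (pd1 phi 0)" and ?b = "fst (pd2 phi 0)"
  show False
  proof (cases "sin th0 = 0")
    case True
    then obtain d where d: "d > 0" "\<And>s. \<bar>s - t0\<bar> < d \<Longrightarrow> (s, th0) \<in> U \<and> gv (psi (s, th0)) = 0"
      using singular_line_th0 by blast
    have e: "(fst (psi (t0 + h, th0)) / h)\<^sup>2 = 6 * (snd (psi (t0 + h, th0)) / h)\<^sup>2" if "\<bar>h\<bar> < d" for h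
      using d(2)[of "t0 + h"] that gv[of "fst (psi (t0 + h, th0))" "snd (psi (t0 + h, th0))"]
      by (simp add: zero_prod_def power_divide)
    have 1: "((\<lambda>h. (fst (psi (t0 + h, th0)) / h)\<^sup>2) \<longlongrightarrow> (fst (pd1 psi p))\<^sup>2) (at 0)"
      and 2: "((\<lambda>h. 6 * (snd (psi (t0 + h, th0)) / h)\<^sup>2) \<longlongrightarrow> 6 * (snd (pd1 psi p))\<^sup>2) (at 0)"
      using psi_curve_t unfolding DERIV_def by (auto intro!: tendsto_intros simp: VU(9))
    have "\<forall>\<^sub>F h in at 0. (fst (psi (t0 + h, th0)) / h)\<^sup>2 = 6 * (snd (psi (t0 + h, th0)) / h)\<^sup>2"
      using e d(1) by (auto simp: eventually_at intro!: exI[of _ d])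
    from Lim_transform_eventually[OF 1 this] 2 have ab: "(fst (pd1 psi p))\<^sup>2 = 6 * (snd (pd1 psi p))\<^sup>2"
      using tendsto_unique[OF at_neq_bot] by blast
    have "snd (pd1 phi 0) \<noteq> 0"
    proof
      assume "snd (pd1 phi 0) = 0"
      then have "?b *\<^sub>R pd1 phi 0 + (- ?a) *\<^sub>R pd2 phi 0 = 0" using b by (simp add: prod_eq_iff)
      from phi_indep[OF VU(2) this] show False using b by simp
    qed
    then have "fst (pd1 psi p) = 0" using psi_columns(1) b by (simp add: prod_eq_iff)
    then show False using ab psi_columns(1) by (simp add: prod_eq_iff)
  next
    case False
    text \<open>One branch \<open>(al v, be v)\<close> of the singular set maps transversally to the lines of constant \<open>t\<close>.
      As \<open>kap\<close> vanishes along it, \<open>kap\<close> vanishes near \<open>t0\<close>, and then every nearby point is singular.\<close>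
    define V' where "V' = V \<inter> (\<lambda>x. sin (snd (phi x))) -` (-{0})"
    have "continuous_on V (\<lambda>x. sin (snd (phi x)))"
      by (intro continuous_intros smooth_on_imp_continuous_on[OF VU(6)])
    then have V': "open V'" unfolding V'_def by (intro continuous_open_preimage VU(1)) auto
    obtain al be where ab: "al\<^sup>2 = 6 * be\<^sup>2" "al * ?a + be * ?b > 0"
    proof -
      \<comment> \<open>The \<open>t\<close> velocities of the two branches, with
        \<open>be = 1\<close>, add up to \<open>2 ?b\<close>, which is nonzero; so they do not both
        vanish.\<close>
      have "\<exists>al be. al\<^sup>2 = 6 * be\<^sup>2 \<and> al * ?a + be * ?b \<noteq> 0"
      proof (cases "sqrt 6 * ?a + 1 * ?b = 0")
        case True
        then have "(- sqrt 6) * ?a + 1 * ?b \<noteq> 0" using b by linarith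
        then show ?thesis by (intro exI[of _ "- sqrt 6"] exI[of _ 1]) simp
      qed (intro exI[of _ "sqrt 6"] exI[of _ 1], simp)
      then obtain al be where "al\<^sup>2 = 6 * be\<^sup>2" "al * ?a + be * ?b \<noteq> 0" by blast
      then show thesis using that[of al be] that[of "- al" "- be"] by (cases "al * ?a + be * ?b > 0") auto
    qed
    obtain d where d: "d > 0" "\<And>v. \<bar>v - 0\<bar> < d \<Longrightarrow> (al * v, be * v) \<in> V'"
    proof (rule path_in_open[OF V', where x = "\<lambda>v. (al * v, be * v)" and t = 0])
      show "isCont (\<lambda>v. (al * v, be * v)) 0" by (intro continuous_intros)
      show "(al * 0, be * 0) \<in> V'" using VU(2,8) False by (auto simp: V'_def zero_prod_def)
    qed blast
    have m: "(al * v, be * v) \<in> V" if "\<bar>v\<bar> < d" for v using d(2)[of v] that by (simp add: V'_def)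
    define T where "T = (\<lambda>v. fst (phi (al * v, be * v)))"
    have kT: "kap (T v) = 0" if "\<bar>v\<bar> < d" for v
    proof -
      have "gv (al * v, be * v) = 0"
        using ab(1) by (simp add: gv zero_prod_def power_mult_distrib power3_eq_cube power2_eq_square) 
      from null_direction(3)[OF m[OF that] this] d(2)[of v] that show ?thesis by (auto simp: V'_def T_def)
    qed
    have Td: "(T has_real_derivative al * fst (pd1 phi (al * v, be * v)) + be * fst (pd2 phi (al * v, be * v))) (at v)"
      if "\<bar>v\<bar> < d" for v
      unfolding T_def by (rule phi_curve) (use m[OF that] in \<open>auto intro!: derivative_eq_intros\<close>)
    have T0: "T 0 = t0" using VU(8) by (simp add: T_def zero_prod_def)
    have T0d: "(T has_real_derivative al * ?a + be * ?b) (at 0)" using Td[of 0] d(1) by (simp add: zero_prod_def)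
    obtain d1 where d1: "d1 > 0" "\<And>h. 0 < h \<Longrightarrow> h < d1 \<Longrightarrow> T 0 < T (0 + h)"
      using DERIV_pos_inc_right[OF T0d ab(2)] by blast
    obtain d2 where d2: "d2 > 0" "\<And>h. 0 < h \<Longrightarrow> h < d2 \<Longrightarrow> T (0 - h) < T 0"
      using DERIV_pos_inc_left[OF T0d ab(2)] by blast
    define h where "h = min d (min d1 d2) / 2"
    have h: "0 < h" "h < d" "h < d1" "h < d2" using d(1) d1(1) d2(1) by (auto simp: h_def)
    have lr: "T (- h) < t0" "t0 < T h" using d1(2)[OF h(1,3)] d2(2)[OF h(1,4)] by (simp_all add: T0)
    have kap_near: "kap t = 0" if tt: "T (- h) < t" "t < T h" for t
    proof -
      have "continuous_on {-h..h} T"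
        by (intro continuous_at_imp_continuous_on ballI DERIV_isCont[OF Td]) (use h in \<open>auto simp: abs_less_iff\<close>)
      then obtain v where "-h \<le> v" "v \<le> h" "T v = t"
        using IVT'[of T "-h" t h] tt h by force
      then show ?thesis using kT[of v] h by auto
    qed
    define V2 where "V2 = V \<inter> (\<lambda>x. fst (phi x)) -` {T (- h)<..<T h}"
    have V2: "open V2" unfolding V2_def
      by (intro continuous_open_preimage VU(1) continuous_intros smooth_on_imp_continuous_on[OF VU(6)] open_greaterThanLessThan)
    obtain d3 where d3: "d3 > 0" "\<And>s. \<bar>s - 0\<bar> < d3 \<Longrightarrow> (s, 0) \<in> V2"
    proof (rule path_in_open[OF V2, where x = "\<lambda>s. (s, 0)" and t = 0])
      show "isCont (\<lambda>s::real. (s, 0::real)) 0" by (intro continuous_intros)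
      show "(0, 0) \<in> V2" using VU(2,8) lr by (auto simp: V2_def zero_prod_def)
    qed blast
    \<comment> \<open>On the line \<open>v = 0\<close> the second component of \<open>gv\<close> is
      \<open>- u^2\<close>, which vanishes only at the origin.\<close>
    have "(d3 / 2, 0) \<in> V2" using d3 by simp
    then have "(d3 / 2, 0) \<in> V" "kap (fst (phi (d3 / 2, 0))) = 0" using kap_near by (auto simp: V2_def)
    then have "gv (d3 / 2, 0) = 0" using singular_imp_gv by simp
    then show False using gv[of "d3 / 2" 0] d3(1) by (simp add: zero_prod_def)
  qed
qed

lemma axis_curve:
  assumes "(0, v) \<in> V"
  shows "((\<lambda>v. fst (phi (0, v))) has_real_derivative fst (pd2 phi (0, v))) (at v)"
  using phi_curve(1)[of "\<lambda>_. 0" 0 v "\<lambda>v. v" 1] assms by simp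

lemma axis_isCont:
  "isCont (\<lambda>v. phi (0, v)) 0" "isCont (\<lambda>v. F (phi (0, v))) 0" "isCont (\<lambda>v. mu (fst (phi (0, v)))) 0"
  "isCont (\<lambda>v. w (fst (phi (0, v)))) 0" "isCont (\<lambda>v. pd2 phi (0, v)) 0"
proof -
  have z: "(0, 0) \<in> V" "phi (0, 0) = (t0, th0)" using VU(2,8) by (auto simp: zero_prod_def)
  have P: "isCont (\<lambda>v::real. (0::real, v)) 0" by (intro continuous_intros)
  have ph: "isCont phi (0, 0)" "isCont (pd2 phi) (0, 0)"
    using smooth_on_imp_continuous_on[OF VU(6)] smooth_on_imp_continuous_on[OF smooth_on_pd(2)[OF VU(6)]] VU(1) z
    by (auto simp: continuous_on_eq_continuous_at)
  show 1: "isCont (\<lambda>v. phi (0, v)) 0" and "isCont (\<lambda>v. pd2 phi (0, v)) 0"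
    using isCont_o2[OF P] ph by auto
  have "isCont F (t0, th0)" using F_has_derivative[of "(t0, th0)"] t0 has_derivative_continuous by auto
  then show "isCont (\<lambda>v. F (phi (0, v))) 0" using isCont_o2[OF 1] z by simp
  have "isCont mu t0" "isCont w t0"
    using mu'[OF t0] w'[OF t0] has_vector_derivative_continuous by blast+
  moreover have "isCont (\<lambda>v. fst (phi (0, v))) 0" using 1 by (rule isCont_fst)
  ultimately show "isCont (\<lambda>v. mu (fst (phi (0, v)))) 0" "isCont (\<lambda>v. w (fst (phi (0, v)))) 0"
    using isCont_o2[of 0 "\<lambda>v. fst (phi (0, v))"] z by auto
qed

text \<open>The limit tangent vector \<open>dchi k\<close> is constant to first order along
  \<open>u = 0\<close>, while \<open>mu\<close> moves in the direction \<open>w\<close> at nonzero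
  speed. Differentiating their orthogonality therefore yields orthogonality to \<open>w\<close>, and
  \<open>no_conormal\<close> applies.\<close>

lemma no_cross_cap:
  assumes gv: "\<And>u v. gv (u, v) = (0, 2 * v, 3 * u * v^2)" and G0: "\<And>v. G (0, v) = (0, v^2, 0)"
  shows False
proof -
  have z: "(0, 0) = (0 :: real \<times> real)" "phi (0, 0) = (t0, th0)" using VU(8) by (auto simp: zero_prod_def)
  define k :: "real \<times> real \<times> real" where "k = (0, 2, 0)"
  have k: "smooth_on UNIV (\<lambda>_::real. k)" "gv (0, v) = v *\<^sub>R k" for v by (simp_all add: gv k_def)
  obtain d where d: "d > 0" "\<And>v. \<bar>v\<bar> < d \<Longrightarrow> (0, v) \<in> V"
    and Ys: "smooth_on {-d<..<d} (\<lambda>v. dchi (G (0, v)) k)"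
    and YF: "\<And>v. \<bar>v\<bar> < d \<Longrightarrow> v \<noteq> 0 \<Longrightarrow> lor (dchi (G (0, v)) k) (F (phi (0, v))) = 0"
    and Ymu: "\<And>v. \<bar>v\<bar> < d \<Longrightarrow> v \<noteq> 0 \<Longrightarrow> lor (dchi (G (0, v)) k) (mu (fst (phi (0, v)))) = 0"
    by (rule dchi_along_axis[of "\<lambda>_. k", OF k]) blast
  let ?Y = "\<lambda>v. dchi (G (0, v)) k"
  have Yc: "isCont ?Y 0"
    using smooth_on_imp_continuous_on[OF Ys] d(1) by (simp add: continuous_on_eq_continuous_at)
  have F0: "lor (dchi (G 0) k) (F p) = 0"
    using isCont_limit_unique[OF isCont_lor[OF Yc axis_isCont(2)] d(1), of "\<lambda>_. 0" 0] YF z by simp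
  have m0: "lor (dchi (G 0) k) (mu t0) = 0"
    using isCont_limit_unique[OF isCont_lor[OF Yc axis_isCont(3)] d(1), of "\<lambda>_. 0" 0] Ymu z by simp
  have W0: "(0, 0, 0) \<in> W" using W(3)[OF VU(2)] G0[of 0] z by simp
  \<comment> \<open>The path \<open>v -> (0, v^2, 0)\<close> is stationary at 0, and so is every
    smooth function of the position on it.\<close>
  have Y1: "(?Y has_vector_derivative 0) (at 0)"
  proof -
    have "smooth_on W (\<lambda>y. dchi y k)" by (intro smooth_on_frechet_apply W smooth_on_const)
    from smooth_on_has_derivative[OF this W0]
    obtain D where D: "((\<lambda>y. dchi y k) has_derivative D) (at (0, 0, 0))" by blast
    have "((\<lambda>v::real. (0::real, v^2, 0::real)) has_derivative (\<lambda>h. 0)) (at 0)"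
      unfolding zero_prod_def by (auto intro!: derivative_eq_intros)
    from has_derivative_compose[OF this, of "\<lambda>y. dchi y k" D] D
    show ?thesis using linear_0[OF has_derivative_linear[OF D]]
      by (simp add: has_vector_derivative_def G0)
  qed
  have b1: "fst (pd2 phi 0) \<noteq> 0" using null_direction(2)[OF VU(2) gv0] .
  have "((\<lambda>v. mu (fst (phi (0, v)))) has_vector_derivative fst (pd2 phi 0) *\<^sub>R al t0 *\<^sub>R w t0) (at 0)"
  proof -
    have "((\<lambda>v. fst (phi (0, v))) has_derivative (\<lambda>h. fst (pd2 phi 0) * h)) (at 0)"
      using axis_curve[of 0] VU(2) z by (simp add: has_field_derivative_def)
    from has_derivative_compose[OF this, of mu "\<lambda>h. h *\<^sub>R al t0 *\<^sub>R w t0"] mu'[OF t0] z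
    show ?thesis by (simp add: has_vector_derivative_def mult_ac)
  qed
  from bounded_bilinear.has_vector_derivative[OF bounded_bilinear_lor Y1 this]
  have "((\<lambda>v. lor (?Y v) (mu (fst (phi (0, v))))) has_vector_derivative
      lor (?Y 0) (fst (pd2 phi 0) *\<^sub>R al t0 *\<^sub>R w t0) + lor 0 (mu (fst (phi (0, 0))))) (at 0)" .
  moreover have "((\<lambda>v. lor (?Y v) (mu (fst (phi (0, v))))) has_vector_derivative 0) (at 0)"
  proof (rule has_vector_derivative_transform_within_open[OF has_vector_derivative_const[of 0], of "{-d<..<d}"])
    show "0 = lor (?Y v) (mu (fst (phi (0, v))))" if "v \<in> {-d<..<d}" for v
      using Ymu[of v] m0 that z by (cases "v = 0") (auto simp: abs_less_iff)
  qed (use d in auto)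
  ultimately have "lor (?Y 0) (fst (pd2 phi 0) *\<^sub>R al t0 *\<^sub>R w t0) + lor 0 (mu (fst (phi (0, 0)))) = 0"
    by (rule vector_derivative_unique_at)
  then have "lor (dchi (G 0) k) (w t0) = 0"
    using b1 al[OF t0] z by (simp add: lor_simps)
  from no_conormal[OF _ _ F0 this m0] show False by (simp add: k_def zero_prod_def)
qed

text \<open>The cuspidal edge is singular only on \<open>v = 0\<close>, transversally to its null
  direction; if \<open>sin th0 = 0\<close>, the singular line \<open>th = th0\<close> would run in
  the null direction. If the derivative of \<open>kap\<close> vanished, the \<open>w\<close> product
  of the limit tangent vector, proportional to \<open>kap / v\<close>, would tend to zero, and
  \<open>no_conormal\<close> applies.\<close>

lemma edge_conditions:
  assumes gv: "\<And>u v. gv (u, v) = (0, 2 * v, 3 * v^2)" and k0: "kap t0 = 0"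
  shows "sin th0 \<noteq> 0" "deriv kap t0 \<noteq> 0"
proof -
  have z: "(0, 0) = (0 :: real \<times> real)" "phi (0, 0) = (t0, th0)" using VU(8) by (auto simp: zero_prod_def)
  have b: "snd (pd2 phi 0) = 0" "fst (pd2 phi 0) \<noteq> 0"
    using null_direction(1,2)[OF VU(2) gv0] VU(8) k0 by auto
  show "sin th0 \<noteq> 0"
  proof
    assume "sin th0 = 0"
    then obtain d where d: "d > 0" "\<And>s. \<bar>s - t0\<bar> < d \<Longrightarrow> (s, th0) \<in> U \<and> gv (psi (s, th0)) = 0"
      using singular_line_th0 by blast
    have e: "snd (psi (s, th0)) = 0" if "\<bar>s - t0\<bar> < d" for s
      using d(2)[OF that] gv[of "fst (psi (s, th0))" "snd (psi (s, th0))"] by (simp add: zero_prod_def)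
    have "((\<lambda>s. snd (psi (s, th0))) has_real_derivative 0) (at t0)"
      by (rule has_field_derivative_transform_within_open[OF DERIV_const[of 0], where S = "{t0 - d<..<t0 + d}"])
         (use e d in \<open>auto simp: abs_less_iff\<close>)
    then have "snd (pd1 psi p) = 0" using DERIV_unique psi_curve_t(2) by blast
    with psi_columns(1) have c1: "fst (pd1 psi p) *\<^sub>R pd1 phi 0 = (1, 0)" by simp
    have "(fst (pd2 phi 0) * fst (pd1 psi p)) *\<^sub>R pd1 phi 0 + (-1) *\<^sub>R pd2 phi 0
        = fst (pd2 phi 0) *\<^sub>R (fst (pd1 psi p) *\<^sub>R pd1 phi 0) - pd2 phi 0" by simp
    also have "\<dots> = 0" unfolding c1 using b by (simp add: prod_eq_iff)
    finally show False using phi_indep[OF VU(2)] by fastforce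
  qed
  show "deriv kap t0 \<noteq> 0"
  proof
    assume kd: "deriv kap t0 = 0"
    define k :: "real \<Rightarrow> real \<times> real \<times> real" where "k = (\<lambda>v. (0, 2, 3 * v))"
    have "smooth_on UNIV k" unfolding k_def by (intro smooth_on_intros) auto
    moreover have "gv (0, v) = v *\<^sub>R k v" for v by (simp add: gv k_def power2_eq_square)
    ultimately obtain d where d: "d > 0" "\<And>v. \<bar>v\<bar> < d \<Longrightarrow> (0, v) \<in> V"
    and Ys: "smooth_on {-d<..<d} (\<lambda>v. dchi (G (0, v)) (k v))"
    and YF: "\<And>v. \<bar>v\<bar> < d \<Longrightarrow> v \<noteq> 0 \<Longrightarrow> lor (dchi (G (0, v)) (k v)) (F (phi (0, v))) = 0"
    and Ymu: "\<And>v. \<bar>v\<bar> < d \<Longrightarrow> v \<noteq> 0 \<Longrightarrow> lor (dchi (G (0, v)) (k v)) (mu (fst (phi (0, v)))) = 0"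
    and Yw: "\<And>v. \<bar>v\<bar> < d \<Longrightarrow> v \<noteq> 0 \<Longrightarrow> lor (dchi (G (0, v)) (k v)) (w (fst (phi (0, v)))) =
        fst (pd2 phi (0, v)) * sin (snd (phi (0, v))) * (kap (fst (phi (0, v))) / v)"
      using dchi_along_axis[of k] by blast
    let ?Y = "\<lambda>v. dchi (G (0, v)) (k v)"
    have Yc: "isCont ?Y 0"
      using smooth_on_imp_continuous_on[OF Ys] d(1) by (simp add: continuous_on_eq_continuous_at)
    have "((\<lambda>v. kap (fst (phi (0, v)))) has_real_derivative 0 * fst (pd2 phi (0, 0))) (at 0)"
      using DERIV_chain2[OF _ axis_curve, of kap 0 0] smooth_on_deriv(2)[OF I smooth(4) t0] VU(2) z kd by simp
    then have klim: "((\<lambda>v. kap (fst (phi (0, v))) / v) \<longlongrightarrow> 0) (at 0)"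
      unfolding DERIV_def using k0 z by simp
    have "((\<lambda>v. fst (pd2 phi (0, v)) * sin (snd (phi (0, v))) * (kap (fst (phi (0, v))) / v)) \<longlongrightarrow>
        fst (pd2 phi (0, 0)) * sin (snd (phi (0, 0))) * 0) (at 0)"
      using axis_isCont(1,5) by (intro tendsto_mult tendsto_fst tendsto_sin tendsto_snd klim) (auto simp: isCont_def)
    then have w0: "lor (dchi (G 0) (k 0)) (w t0) = 0"
      using isCont_limit_unique[OF isCont_lor[OF Yc axis_isCont(4)] d(1) Yw] z by simp
    have F0: "lor (dchi (G 0) (k 0)) (F p) = 0"
      using isCont_limit_unique[OF isCont_lor[OF Yc axis_isCont(2)] d(1), of "\<lambda>_. 0" 0] YF z by simp
    have m0: "lor (dchi (G 0) (k 0)) (mu t0) = 0"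
      using isCont_limit_unique[OF isCont_lor[OF Yc axis_isCont(3)] d(1), of "\<lambda>_. 0" 0] Ymu z by simp
    from no_conormal[OF _ _ F0 w0 m0] show False by (simp add: k_def zero_prod_def)
  qed
qed

end

section \<open>Hyperbolic framed curves\<close>

context focal_frame
begin

lemma A_equiv_germ:
  assumes A: "A_equiv_S31 F (t0, th0) G" and t0: "t0 \<in> I"
    and G: "smooth_on UNIV G" "\<And>x. (G has_derivative (\<lambda>h. fst h *\<^sub>R gu x + snd h *\<^sub>R gv x)) (at x)"
      "\<And>x. fst (gu x) = 1" "\<And>x. fst (gv x) = 0" "gv 0 = 0"
  obtains phi psi chi V U W where "focal_germ I e n w mu kap al c t0 th0 phi psi chi V U W G gu gv"
proof -
  have p: "(t0, th0) \<in> I \<times> UNIV" using t0 by simp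
  obtain phi psi chi V U W
    where *: "open V" "0 \<in> V" "open U" "(t0, th0) \<in> U" "U \<subseteq> I \<times> UNIV" "smooth_on V phi" "smooth_on U psi"
    "phi 0 = (t0, th0)" "psi (t0, th0) = 0" "\<And>x. x \<in> V \<Longrightarrow> phi x \<in> U \<and> psi (phi x) = x" "\<And>y. y \<in> U \<Longrightarrow> psi y \<in> V \<and> phi (psi y) = y"
    "open W" "smooth_on W chi" "\<And>x. x \<in> V \<Longrightarrow> G x \<in> W \<and> F (phi x) = chi (G x)"
    "\<And>y. y \<in> W \<Longrightarrow> inj (frechet_derivative chi (at y))"
    by (rule A_equiv_S31E[OF A open_dom p]) (rule that)
  have "focal_germ I e n w mu kap al c t0 th0 phi psi chi V U W G gu gv"
    by (intro focal_germ.intro focal_frame_axioms focal_germ_axioms.intro * G)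
  then show thesis by (rule that)
qed

text \<open>\<open>gu\<close> and \<open>gv\<close> are the partial derivatives of the normal form,
  given explicitly; the other types follow the same pattern.\<close>

lemma not_swallowtail: "t0 \<in> I \<Longrightarrow> \<not> swallowtail F (t0, th0)"
proof
  assume t0: "t0 \<in> I" and "swallowtail F (t0, th0)"
  then have A: "A_equiv_S31 F (t0, th0) (\<lambda>x. (fst x, 4 * snd x ^ 3 + 2 * fst x * snd x, 3 * snd x ^ 4 + fst x * snd x ^ 2))"
    by (simp add: swallowtail_def case_prod_unfold)
  show False
    by (rule A_equiv_germ[OF A t0, where gu = "\<lambda>x. (1, 2 * snd x, snd x ^ 2)" and
          gv = "\<lambda>x. (0, 12 * snd x ^ 2 + 2 * fst x, 12 * snd x ^ 3 + 2 * fst x * snd x)"],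
        intro smooth_on_intros open_UNIV)
       (auto intro!: derivative_eq_intros simp: zero_prod_def algebra_simps dest: focal_germ.no_swallowtail)
qed

lemma not_cross_cap: "t0 \<in> I \<Longrightarrow> \<not> cuspidal_cross_cap F (t0, th0)"
proof
  assume t0: "t0 \<in> I" and "cuspidal_cross_cap F (t0, th0)"
  then have A: "A_equiv_S31 F (t0, th0) (\<lambda>x. (fst x, snd x ^ 2, fst x * snd x ^ 3))"
    by (simp add: cuspidal_cross_cap_def case_prod_unfold)
  show False
    by (rule A_equiv_germ[OF A t0, where gu = "\<lambda>x. (1, 0, snd x ^ 3)" and
          gv = "\<lambda>x. (0, 2 * snd x, 3 * fst x * snd x ^ 2)"],
        intro smooth_on_intros open_UNIV)
       (auto intro!: derivative_eq_intros simp: zero_prod_def algebra_simps dest: focal_germ.no_cross_cap)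
qed

lemma not_lips: "t0 \<in> I \<Longrightarrow> kap t0 = 0 \<Longrightarrow> \<not> cuspidal_lips F (t0, th0)"
proof
  assume t0: "t0 \<in> I" and k0: "kap t0 = 0" and "cuspidal_lips F (t0, th0)"
  then have A: "A_equiv_S31 F (t0, th0) (\<lambda>x. (fst x, 2 * snd x ^ 3 + fst x ^ 2 * snd x, 3 * snd x ^ 4 + fst x ^ 2 * snd x ^ 2))"
    by (simp add: cuspidal_lips_def case_prod_unfold)
  show False
    by (rule A_equiv_germ[OF A t0, where gu = "\<lambda>x. (1, 2 * fst x * snd x, 2 * fst x * snd x ^ 2)" and
          gv = "\<lambda>x. (0, 6 * snd x ^ 2 + fst x ^ 2, 12 * snd x ^ 3 + 2 * fst x ^ 2 * snd x)"],
        intro smooth_on_intros open_UNIV)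
       (use k0 in \<open>auto intro!: derivative_eq_intros simp: zero_prod_def algebra_simps dest: focal_germ.no_lips\<close>)
qed

lemma not_beaks: "t0 \<in> I \<Longrightarrow> kap t0 = 0 \<Longrightarrow> \<not> cuspidal_beaks F (t0, th0)"
proof
  assume t0: "t0 \<in> I" and k0: "kap t0 = 0" and "cuspidal_beaks F (t0, th0)"
  then have A: "A_equiv_S31 F (t0, th0) (\<lambda>x. (fst x, 2 * snd x ^ 3 - fst x ^ 2 * snd x, 3 * snd x ^ 4 - fst x ^ 2 * snd x ^ 2))"
    by (simp add: cuspidal_beaks_def case_prod_unfold)
  show False
    by (rule A_equiv_germ[OF A t0, where gu = "\<lambda>x. (1, - 2 * fst x * snd x, - 2 * fst x * snd x ^ 2)" and
          gv = "\<lambda>x. (0, 6 * snd x ^ 2 - fst x ^ 2, 12 * snd x ^ 3 - 2 * fst x ^ 2 * snd x)"],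
        intro smooth_on_intros open_UNIV)
       (use k0 in \<open>auto intro!: derivative_eq_intros simp: zero_prod_def algebra_simps dest: focal_germ.no_beaks\<close>)
qed

lemma cuspidal_edge_conditions:
  assumes t0: "t0 \<in> I" and k0: "kap t0 = 0" and "cuspidal_edge F (t0, th0)"
  shows "sin th0 \<noteq> 0 \<and> deriv kap t0 \<noteq> 0"
proof -
  have A: "A_equiv_S31 F (t0, th0) (\<lambda>x. (fst x, snd x ^ 2, snd x ^ 3))"
    using assms(3) by (simp add: cuspidal_edge_def case_prod_unfold)
  show ?thesis
    by (rule A_equiv_germ[OF A t0, where gu = "\<lambda>x. (1, 0, 0)" and gv = "\<lambda>x. (0, 2 * snd x, 3 * snd x ^ 2)"],
        intro smooth_on_intros open_UNIV)
       (use k0 in \<open>auto intro!: derivative_eq_intros simp: zero_prod_def algebra_simps dest: focal_germ.edge_conditions\<close>)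
qed

theorem classification:
  assumes t0: "t0 \<in> I" and "singular_point F (t0, th0)"
  shows "(kap t0 \<noteq> 0 \<longrightarrow> cuspidal_edge F (t0, th0) \<and> \<not> swallowtail F (t0, th0) \<and> \<not> cuspidal_cross_cap F (t0, th0)) \<and>
    (kap t0 = 0 \<longrightarrow> (cuspidal_edge F (t0, th0) \<longleftrightarrow> sin th0 \<noteq> 0 \<and> deriv kap t0 \<noteq> 0) \<and>
       \<not> cuspidal_beaks F (t0, th0) \<and> \<not> cuspidal_lips F (t0, th0) \<and>
       \<not> swallowtail F (t0, th0) \<and> \<not> cuspidal_cross_cap F (t0, th0))"
  using singular_pointD[OF assms] cuspidal_edge_at_kap_nonzero[OF t0] not_swallowtail[OF t0] not_cross_cap[OF t0]
    not_lips[OF t0] not_beaks[OF t0] cuspidal_edge_conditions[OF t0]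
    cuspidal_edge_at_kap_zero[OF t0 _ _ smooth_on_deriv(2)[OF I smooth(4) t0]]
  by auto

end

section \<open>The Frenet type frame of a framed curve\<close>

lemma wedge_eq_vec4: "wedge x y z = vec4
   (- det3 (x$1) (x$2) (x$3) (y$1) (y$2) (y$3) (z$1) (z$2) (z$3))
   (- det3 (x$0) (x$2) (x$3) (y$0) (y$2) (y$3) (z$0) (z$2) (z$3))
   (det3 (x$0) (x$1) (x$3) (y$0) (y$1) (y$3) (z$0) (z$1) (z$3))
   (- det3 (x$0) (x$1) (x$2) (y$0) (y$1) (y$2) (z$0) (z$1) (z$2))"
  by (simp add: wedge_def vec4_def)

lemma lor_wedge: "lor (wedge x y z) x = 0" "lor (wedge x y z) y = 0" "lor (wedge x y z) z = 0"
  by (simp_all add: wedge_eq_vec4 lor_def det3_def algebra_simps)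

text \<open>Lorentzian Gram identity. For the Gram matrix diag(-1, 1, 1) it makes \<open>mu\<close>
  a spacelike unit vector.\<close>

lemma lor_wedge_wedge:
  "lor (wedge x y z) (wedge x y z) =
    - det3 (lor x x) (lor x y) (lor x z) (lor y x) (lor y y) (lor y z) (lor z x) (lor z y) (lor z z)"
  by (simp add: wedge_eq_vec4 lor_def det3_def) algebra

lemma smooth_on_wedge:
  "open S \<Longrightarrow> smooth_on S f \<Longrightarrow> smooth_on S g \<Longrightarrow> smooth_on S h \<Longrightarrow> smooth_on S (\<lambda>x. wedge (f x) (g x) (h x))"
  unfolding wedge_eq_vec4 det3_def by (intro smooth_on_vec4 smooth_on_intros)

lemma lor_const_derivative:
  assumes "open I" "t \<in> I" "\<And>s. s \<in> I \<Longrightarrow> lor (x s) (y s) = k"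
    and x: "(x has_vector_derivative x') (at t)" and y: "(y has_vector_derivative y') (at t)"
  shows "lor x' (y t) = - lor (x t) y'"
proof -
  have "((\<lambda>s. lor (x s) (y s)) has_vector_derivative 0) (at t)"
    by (rule has_vector_derivative_transform_within_open[OF has_vector_derivative_const[of k] assms(1,2)])
       (use assms(3) in auto)
  from vector_derivative_unique_at[OF this bounded_bilinear.has_vector_derivative[OF bounded_bilinear_lor x y]]
  show ?thesis by simp
qed

locale hyp_frame =
  fixes I g v1 v2
  assumes I: "open I" and curve: "hyp_framed_curve I g v1 v2"
begin

abbreviation "mu \<equiv> fc_mu g v1 v2"
abbreviation "m \<equiv> fc_m g v1 v2"
abbreviation "n \<equiv> fc_n g v1 v2"
abbreviation "a \<equiv> fc_a g v1 v2"
abbreviation "b \<equiv> fc_b g v1 v2"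

lemma smooth: "smooth_on I g" "smooth_on I v1" "smooth_on I v2"
  using curve by (auto simp: hyp_framed_curve_def)

text \<open>The order \<open>v1\<close>, \<open>v2\<close>, \<open>g\<close>, \<open>mu\<close> puts
  the timelike vector third, as the expansion in an orthonormal frame expects.\<close>

lemma lors:
  assumes "t \<in> I"
  shows "lor (v1 t) (v1 t) = 1" "lor (v2 t) (v2 t) = 1" "lor (g t) (g t) = -1" "lor (mu t) (mu t) = 1"
    "lor (v1 t) (v2 t) = 0" "lor (v1 t) (g t) = 0" "lor (v1 t) (mu t) = 0"
    "lor (v2 t) (g t) = 0" "lor (v2 t) (mu t) = 0" "lor (g t) (mu t) = 0"
proof -
  show *: "lor (v1 t) (v1 t) = 1" "lor (v2 t) (v2 t) = 1" "lor (g t) (g t) = -1"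
    "lor (v1 t) (v2 t) = 0" "lor (v1 t) (g t) = 0" "lor (v2 t) (g t) = 0"
    using curve assms by (auto simp: hyp_framed_curve_def lor_commute)
  show "lor (v1 t) (mu t) = 0" "lor (v2 t) (mu t) = 0" "lor (g t) (mu t) = 0"
    by (simp_all add: fc_mu_def lor_wedge lor_commute[of _ "wedge _ _ _"])
  show "lor (mu t) (mu t) = 1"
    using * by (simp add: fc_mu_def lor_wedge_wedge det3_def lor_commute)
qed

lemma smooth_mu: "smooth_on I mu"
  unfolding fc_mu_def[abs_def] by (intro smooth_on_wedge I smooth)

lemma smooth_coeffs: "smooth_on I m" "smooth_on I n" "smooth_on I a" "smooth_on I b"
  unfolding fc_m_def[abs_def] fc_n_def[abs_def] fc_a_def[abs_def] fc_b_def[abs_def]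
  by (intro smooth_on_lor I smooth smooth_mu smooth_on_vector_derivative)+

text \<open>Each derivative is expanded in the frame. Differentiating the constant products makes
  the coefficient matrix skew for the Lorentzian form, so \<open>m\<close>, \<open>n\<close>,
  \<open>a\<close>, \<open>b\<close> determine all of it.\<close>

lemma frame_equations:
  assumes t: "t \<in> I"
  shows "(g has_vector_derivative m t *\<^sub>R mu t) (at t)"
    "(v1 has_vector_derivative n t *\<^sub>R v2 t + a t *\<^sub>R mu t) (at t)"
    "(v2 has_vector_derivative - n t *\<^sub>R v1 t + b t *\<^sub>R mu t) (at t)"
    "(mu has_vector_derivative m t *\<^sub>R g t - a t *\<^sub>R v1 t - b t *\<^sub>R v2 t) (at t)"
proof -
  let ?d = "\<lambda>f. vector_derivative f (at t)"
  note d = smooth_on_vector_derivative(2)[OF I smooth(1) t] smooth_on_vector_derivative(2)[OF I smooth(2) t]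
    smooth_on_vector_derivative(2)[OF I smooth(3) t] smooth_on_vector_derivative(2)[OF I smooth_mu t]
  note ex = lor_orthonormal_expansion[OF lors, OF t t t t t t t t t t]
  note lc = lor_const_derivative[OF I t]
  have gv: "lor (?d g) (v1 t) = 0" "lor (?d g) (v2 t) = 0"
    using curve t by (auto simp: hyp_framed_curve_def)
  have self: "lor (?d g) (g t) = 0" "lor (?d v1) (v1 t) = 0" "lor (?d v2) (v2 t) = 0" "lor (?d mu) (mu t) = 0"
    using lc[OF lors(3) d(1) d(1)] lc[OF lors(1) d(2) d(2)] lc[OF lors(2) d(3) d(3)] lc[OF lors(4) d(4) d(4)]
    by (simp_all add: lor_commute[of _ "?d _"])
  have mixed: "lor (?d v1) (g t) = 0" "lor (?d v2) (g t) = 0" "lor (?d v2) (v1 t) = - n t"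
      "lor (?d mu) (g t) = - m t" "lor (?d mu) (v1 t) = - a t" "lor (?d mu) (v2 t) = - b t"
    using lc[OF lors(6) d(2) d(1)] lc[OF lors(8) d(3) d(1)] lc[OF lors(5) d(2) d(3)]
      lc[OF lors(10) d(1) d(4)] lc[OF lors(7) d(2) d(4)] lc[OF lors(9) d(3) d(4)] gv
    by (simp_all add: fc_m_def fc_n_def fc_a_def fc_b_def lor_commute[of _ "?d _"])
  have "?d g = m t *\<^sub>R mu t" "?d v1 = n t *\<^sub>R v2 t + a t *\<^sub>R mu t" "?d v2 = - n t *\<^sub>R v1 t + b t *\<^sub>R mu t"
    "?d mu = m t *\<^sub>R g t - a t *\<^sub>R v1 t - b t *\<^sub>R v2 t"
    using ex[of "?d g"] ex[of "?d v1"] ex[of "?d v2"] ex[of "?d mu"] gv self mixed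
    by (simp_all add: fc_m_def fc_n_def fc_a_def fc_b_def)
  with d show "(g has_vector_derivative m t *\<^sub>R mu t) (at t)"
    "(v1 has_vector_derivative n t *\<^sub>R v2 t + a t *\<^sub>R mu t) (at t)"
    "(v2 has_vector_derivative - n t *\<^sub>R v1 t + b t *\<^sub>R mu t) (at t)"
    "(mu has_vector_derivative m t *\<^sub>R g t - a t *\<^sub>R v1 t - b t *\<^sub>R v2 t) (at t)"
    by simp_all
qed

end

text \<open>The vector \<open>e\<close> is kept in the literal form of the focal surface, square
  root included, so that \<open>F\<close> and \<open>focal_dS\<close> agree as functions and not
  merely over \<open>I\<close>.\<close>

lemma hyp_frame_imp_focal_frame:
  fixes I g v1 v2
  assumes I: "open I" and interval: "is_interval I" and curve: "hyp_framed_curve I g v1 v2"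
    and reg: "\<forall>t\<in>I. (fc_a g v1 v2 t)\<^sup>2 + (fc_b g v1 v2 t)\<^sup>2 \<noteq> 0"
    and MA: "\<forall>t\<in>I. (fr_M g v1 v2 t)\<^sup>2 > (fr_A g v1 v2 t)\<^sup>2"
    and const: "\<forall>t\<in>I. fr_M g v1 v2 t * deriv (fr_A g v1 v2) t - deriv (fr_M g v1 v2) t * fr_A g v1 v2 t = 0"
    and t0: "t0 \<in> I"
  obtains c k where "k > 0"
    "focal_frame I (\<lambda>t. (1 / sqrt ((fr_M g v1 v2 t)\<^sup>2 - (fr_A g v1 v2 t)\<^sup>2)) *\<^sub>R
        (fr_A g v1 v2 t *\<^sub>R g t - fr_M g v1 v2 t *\<^sub>R fr_n1 g v1 v2 t))
      (fr_n2 g v1 v2) (\<lambda>t. (1 / k) *\<^sub>R (c *\<^sub>R g t - fr_n1 g v1 v2 t)) (fc_mu g v1 v2)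
      (\<lambda>t. fr_N g v1 v2 t / k) (\<lambda>t. k * fr_A g v1 v2 t) c"
    "\<And>t. t \<in> I \<Longrightarrow> fr_A g v1 v2 t > 0"
    "\<And>t. t \<in> I \<Longrightarrow> sqrt ((fr_M g v1 v2 t)\<^sup>2 - (fr_A g v1 v2 t)\<^sup>2) = k * fr_A g v1 v2 t"
    "smooth_on I (fr_A g v1 v2)"
proof -
  interpret hyp_frame I g v1 v2 by unfold_locales (fact I curve)+
  let ?A = "fr_A g v1 v2" and ?M = "fr_M g v1 v2" and ?N = "fr_N g v1 v2"
  let ?n1 = "fr_n1 g v1 v2" and ?n2 = "fr_n2 g v1 v2"
  have pos: "(a t)\<^sup>2 + (b t)\<^sup>2 > 0" if "t \<in> I" for t
    using reg that by (metis sum_power2_gt_zero_iff sum_power2_eq_zero_iff)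
  have Apos: "?A t > 0" and A2: "?A t * ?A t = a t * a t + b t * b t" if "t \<in> I" for t
    using pos[OF that] by (simp_all add: fr_A_def power2_eq_square)
  have Ms: "smooth_on I ?M" using smooth_coeffs(1) by (simp add: fr_M_def[abs_def])
  have As: "smooth_on I ?A" unfolding fr_A_def[abs_def]
    by (intro smooth_on_intros smooth_coeffs I pos)
  have Ns: "smooth_on I ?N" unfolding fr_N_def[abs_def] fc_f_def
    using pos by (intro smooth_on_intros smooth_coeffs smooth_on_deriv I) fastforce
  \<comment> \<open>\<open>x\<close> and \<open>y\<close> are the cosine and sine of the rotation
    from \<open>(v1, v2)\<close> to \<open>(n1, n2)\<close>, without choosing an angle
    function.\<close>
  define x where "x = (\<lambda>t. a t / ?A t)"
  define y where "y = (\<lambda>t. b t / ?A t)"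
  have xs: "smooth_on I x" and ys: "smooth_on I y"
    unfolding x_def y_def using Apos by (intro smooth_on_divide smooth_coeffs As I; fastforce)+
  have xy1: "x t * x t + y t * y t = 1" if "t \<in> I" for t
    using Apos[OF that] by (simp add: x_def y_def A2[OF that, symmetric] add_divide_distrib[symmetric])
  have n1: "?n1 = (\<lambda>t. x t *\<^sub>R v1 t + y t *\<^sub>R v2 t)"
    by (simp add: fun_eq_iff fr_n1_def x_def y_def algebra_simps)
  have n2: "?n2 = (\<lambda>t. - y t *\<^sub>R v1 t + x t *\<^sub>R v2 t)"
    by (simp add: fun_eq_iff fr_n2_def x_def y_def algebra_simps)
  have axA: "a t = ?A t * x t" "b t = ?A t * y t" if "t \<in> I" for t
    using Apos[OF that] by (simp_all add: x_def y_def)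
  have nd: "(?n1 has_vector_derivative ?N t *\<^sub>R ?n2 t + ?A t *\<^sub>R mu t) (at t)"
      "(?n2 has_vector_derivative - ?N t *\<^sub>R ?n1 t) (at t)" if t: "t \<in> I" for t
  proof -
    let ?x' = "deriv x t" and ?y' = "deriv y t"
    have xd: "(x has_real_derivative ?x') (at t)" and yd: "(y has_real_derivative ?y') (at t)"
      using smooth_on_deriv(2)[OF I xs t] smooth_on_deriv(2)[OF I ys t] by auto
    have "((\<lambda>t. x t * x t + y t * y t) has_real_derivative (x t * ?x' + ?x' * x t) + (y t * ?y' + ?y' * y t)) (at t)"
      by (intro DERIV_add DERIV_mult' xd yd)
    moreover have "((\<lambda>t. x t * x t + y t * y t) has_real_derivative 0) (at t)"
      by (rule has_field_derivative_transform_within_open[OF DERIV_const[of 1] I t]) (simp add: xy1)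
    ultimately have orth: "x t * ?x' + y t * ?y' = 0"
      using DERIV_unique by fastforce
    \<comment> \<open>Angular velocity of \<open>(x, y)\<close>. From \<open>a = A x\<close> and
      \<open>b = A y\<close> one gets \<open>a b' - a' b = A^2 W\<close>, whence
      \<open>N = n + W\<close>.\<close>
    define W where "W = x t * ?y' - y t * ?x'"
    have x'W: "?x' = - y t * W" and y'W: "?y' = x t * W"
      using orth xy1[OF t] unfolding W_def by algebra+
    have NW: "?N t = n t + W"
    proof -
      have A': "(?A has_real_derivative deriv ?A t) (at t)" using smooth_on_deriv(2)[OF I As t] .
      have "deriv a t = ?A t * ?x' + deriv ?A t * x t"
        by (rule DERIV_imp_deriv, rule has_field_derivative_transform_within_open[OF DERIV_mult'[OF A' xd] I t])
           (simp add: axA)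
      moreover have "deriv b t = ?A t * ?y' + deriv ?A t * y t"
        by (rule DERIV_imp_deriv, rule has_field_derivative_transform_within_open[OF DERIV_mult'[OF A' yd] I t])
           (simp add: axA)
      ultimately have "a t * deriv b t - deriv a t * b t = (?A t * ?A t) * W"
        unfolding axA[OF t] W_def by algebra
      then show ?thesis
        using pos[OF t] A2[OF t] by (auto simp: fr_N_def fc_f_def power2_eq_square add_divide_distrib)
    qed
    have "(?n1 has_vector_derivative (x t *\<^sub>R (n t *\<^sub>R v2 t + a t *\<^sub>R mu t) + ?x' *\<^sub>R v1 t) + (y t *\<^sub>R (- n t *\<^sub>R v1 t + b t *\<^sub>R mu t) + ?y' *\<^sub>R v2 t)) (at t)"
      unfolding n1 by (intro has_vector_derivative_add has_vector_derivative_scaleR xd yd frame_equations t)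
    moreover have "x t * a t + y t * b t = ?A t"
      unfolding axA[OF t] using xy1[OF t] by algebra
    then have "(x t *\<^sub>R (n t *\<^sub>R v2 t + a t *\<^sub>R mu t) + ?x' *\<^sub>R v1 t) + (y t *\<^sub>R (- n t *\<^sub>R v1 t + b t *\<^sub>R mu t) + ?y' *\<^sub>R v2 t)
       = ?N t *\<^sub>R ?n2 t + ?A t *\<^sub>R mu t"
      unfolding NW n2 x'W y'W by (simp add: algebra_simps flip: scaleR_add_left)
    ultimately show "(?n1 has_vector_derivative ?N t *\<^sub>R ?n2 t + ?A t *\<^sub>R mu t) (at t)" by simp
    have "(?n2 has_vector_derivative (- y t *\<^sub>R (n t *\<^sub>R v2 t + a t *\<^sub>R mu t) + (- ?y') *\<^sub>R v1 t) + (x t *\<^sub>R (- n t *\<^sub>R v1 t + b t *\<^sub>R mu t) + ?x' *\<^sub>R v2 t)) (at t)"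
      unfolding n2 by (intro has_vector_derivative_add has_vector_derivative_scaleR DERIV_minus xd yd frame_equations t)
    moreover have "x t * b t = y t * a t" unfolding axA[OF t] by simp
    then have "(- y t *\<^sub>R (n t *\<^sub>R v2 t + a t *\<^sub>R mu t) + (- ?y') *\<^sub>R v1 t) + (x t *\<^sub>R (- n t *\<^sub>R v1 t + b t *\<^sub>R mu t) + ?x' *\<^sub>R v2 t)
       = - ?N t *\<^sub>R ?n1 t"
      unfolding NW n1 x'W y'W by (simp add: algebra_simps)
    ultimately show "(?n2 has_vector_derivative - ?N t *\<^sub>R ?n1 t) (at t)" by simp
  qed
  \<comment> \<open>The identity between \<open>M\<close> and \<open>A\<close> says that
    \<open>M / A\<close> has derivative zero, and \<open>I\<close> is an interval.\<close>
  obtain c where c: "\<And>t. t \<in> I \<Longrightarrow> ?M t = c * ?A t"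
  proof -
    have "((\<lambda>t. ?M t / ?A t) has_real_derivative 0) (at t within I)" if t: "t \<in> I" for t
    proof -
      have "((\<lambda>t. ?M t / ?A t) has_real_derivative (deriv ?M t * ?A t - ?M t * deriv ?A t) / (?A t * ?A t)) (at t within I)"
        by (rule has_field_derivative_at_within[OF
              DERIV_divide[OF smooth_on_deriv(2)[OF I Ms t] smooth_on_deriv(2)[OF I As t] Apos[OF t, THEN less_imp_neq, symmetric]]])
      moreover have "deriv ?M t * ?A t - ?M t * deriv ?A t = 0" using const t by force
      ultimately show ?thesis by simp
    qed
    then obtain c where "\<And>t. t \<in> I \<Longrightarrow> ?M t / ?A t = c"
      using has_field_derivative_zero_constant[of I "\<lambda>t. ?M t / ?A t"] interval by (metis is_interval_convex)
    then show thesis using that[of c] Apos by (metis less_irrefl nonzero_divide_eq_eq)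
  qed
  have c1: "c\<^sup>2 > 1"
  proof -
    have "(?A t0)\<^sup>2 < c\<^sup>2 * (?A t0)\<^sup>2" using MA t0 c[OF t0] by (auto simp: power_mult_distrib)
    then show ?thesis using Apos[OF t0] by simp
  qed
  define k where "k = sqrt (c\<^sup>2 - 1)"
  have k: "k > 0" "k * k = c * c - 1" using c1 by (auto simp: k_def power2_eq_square)
  have root: "sqrt ((?M t)\<^sup>2 - (?A t)\<^sup>2) = k * ?A t" if "t \<in> I" for t
  proof -
    have "(?M t)\<^sup>2 - (?A t)\<^sup>2 = (c\<^sup>2 - 1) * (?A t)\<^sup>2"
      by (simp add: c[OF that] power_mult_distrib algebra_simps)
    then show ?thesis using Apos[OF that] by (simp add: k_def real_sqrt_mult)
  qed
  define e where "e = (\<lambda>t. (1 / sqrt ((?M t)\<^sup>2 - (?A t)\<^sup>2)) *\<^sub>R (?A t *\<^sub>R g t - ?M t *\<^sub>R ?n1 t))"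
  define w where "w = (\<lambda>t. (1 / k) *\<^sub>R (c *\<^sub>R g t - ?n1 t))"
  have e: "e t = (1 / k) *\<^sub>R (g t - c *\<^sub>R ?n1 t)" if "t \<in> I" for t
    unfolding e_def root[OF that] unfolding c[OF that] using Apos[OF that] k(1) by (simp add: scaleR_diff_right)
  have n1s: "smooth_on I ?n1" and n2s: "smooth_on I ?n2"
    unfolding n1 n2 by (intro smooth_on_intros xs ys smooth I)+
  note sb = bounded_linear.has_vector_derivative[OF bounded_linear_scaleR_right]
  \<comment> \<open>The hyperbolic rotation solved for \<open>n1\<close>; it turns
    \<open>n2' = - N n1\<close> into an equation in \<open>e\<close> and \<open>w\<close>.\<close>
  have n1e: "c *\<^sub>R e t - w t = - k *\<^sub>R ?n1 t" if "t \<in> I" for t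
  proof -
    have "c *\<^sub>R e t - w t = (- (k * k) / k) *\<^sub>R ?n1 t"
      unfolding k(2) by (simp add: e[OF that] w_def algebra_simps diff_divide_distrib)
    then show ?thesis using k(1) by simp
  qed
  have M: "m t = c * ?A t" if "t \<in> I" for t using c[OF that] by (simp add: fr_M_def)
  have "focal_frame I e ?n2 w mu (\<lambda>t. ?N t / k) (\<lambda>t. k * ?A t) c"
  proof
    show "open I" by fact
    show "smooth_on I e"
      by (rule smooth_on_cong[OF I _ e[symmetric]]) (intro smooth_on_intros smooth n1s I)
    show "smooth_on I w" unfolding w_def by (intro smooth_on_intros smooth n1s I)
    show "smooth_on I (\<lambda>t. ?N t / k)" using k(1) by (intro smooth_on_intros Ns I) auto
    show "smooth_on I ?n2" by fact
    show "c \<noteq> 0" using c1 by auto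
    fix t assume t: "t \<in> I"
    show "k * ?A t \<noteq> 0" using k(1) Apos[OF t] by simp
    note fe = frame_equations[OF t] nd[OF t]
    have "((\<lambda>t. (1 / k) *\<^sub>R (g t - c *\<^sub>R ?n1 t)) has_vector_derivative
        (1 / k) *\<^sub>R (m t *\<^sub>R mu t - c *\<^sub>R (?N t *\<^sub>R ?n2 t + ?A t *\<^sub>R mu t))) (at t)"
      by (intro sb has_vector_derivative_diff fe)
    then have "(e has_vector_derivative (1 / k) *\<^sub>R (m t *\<^sub>R mu t - c *\<^sub>R (?N t *\<^sub>R ?n2 t + ?A t *\<^sub>R mu t))) (at t)"
      by (rule has_vector_derivative_transform_within_open[OF _ I t]) (simp add: e)
    then show "(e has_vector_derivative - (c * (?N t / k)) *\<^sub>R ?n2 t) (at t)"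
      by (rule has_vector_derivative_eq_rhs) (simp add: M[OF t] algebra_simps)
    have "(c * (?N t / k)) *\<^sub>R e t - (?N t / k) *\<^sub>R w t = (?N t / k) *\<^sub>R (c *\<^sub>R e t - w t)"
      by (simp add: algebra_simps)
    also have "\<dots> = - ?N t *\<^sub>R ?n1 t" unfolding n1e[OF t] using k(1) by simp
    finally show "(?n2 has_vector_derivative (c * (?N t / k)) *\<^sub>R e t - (?N t / k) *\<^sub>R w t) (at t)"
      using fe(6) by simp
    have "(w has_vector_derivative (1 / k) *\<^sub>R (c *\<^sub>R m t *\<^sub>R mu t - (?N t *\<^sub>R ?n2 t + ?A t *\<^sub>R mu t))) (at t)"
      unfolding w_def by (intro sb has_vector_derivative_diff fe)
    moreover have "(1 / k) *\<^sub>R (c *\<^sub>R m t *\<^sub>R mu t - (?N t *\<^sub>R ?n2 t + ?A t *\<^sub>R mu t)) =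
       ((k * k) * ?A t / k) *\<^sub>R mu t - (?N t / k) *\<^sub>R ?n2 t"
      unfolding k(2) by (simp add: M[OF t] algebra_simps diff_divide_distrib)
    ultimately show "(w has_vector_derivative (k * ?A t) *\<^sub>R mu t - (?N t / k) *\<^sub>R ?n2 t) (at t)"
      using k(1) by simp
    have "(k * ?A t) *\<^sub>R w t = m t *\<^sub>R g t - a t *\<^sub>R v1 t - b t *\<^sub>R v2 t"
      using k(1) by (simp add: w_def n1 M[OF t] axA[OF t] algebra_simps)
    then show "(mu has_vector_derivative (k * ?A t) *\<^sub>R w t) (at t)" using fe(4) by simp
    note l = lors[OF t] lor_commute[of "v2 t" "v1 t"] lor_commute[of "g t" "v1 t"] lor_commute[of "g t" "v2 t"] lor_commute[of "mu t" "v1 t"]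
      lor_commute[of "mu t" "v2 t"] lor_commute[of "mu t" "g t"]
    have nn: "lor (?n1 t) (?n1 t) = 1" "lor (?n2 t) (?n2 t) = 1" "lor (?n1 t) (?n2 t) = 0" "lor (?n2 t) (?n1 t) = 0"
      "lor (g t) (?n1 t) = 0" "lor (g t) (?n2 t) = 0" "lor (?n1 t) (g t) = 0" "lor (?n2 t) (g t) = 0"
      "lor (?n1 t) (mu t) = 0" "lor (?n2 t) (mu t) = 0"
      using xy1[OF t] by (simp_all add: n1 n2 lor_simps l)
    show "lor (?n2 t) (?n2 t) = 1" "lor (mu t) (mu t) = 1" "lor (?n2 t) (mu t) = 0" by (simp_all add: nn l)
    have kk: "(c * c - 1) / (k * k) = 1" unfolding k(2)[symmetric] using k(1) by simp
    show "lor (e t) (e t) = 1" "lor (w t) (w t) = -1"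
      using kk k by (simp_all add: e[OF t] w_def lor_simps nn l field_simps)
    show "lor (e t) (?n2 t) = 0" "lor (e t) (w t) = 0" "lor (e t) (mu t) = 0" "lor (?n2 t) (w t) = 0" "lor (w t) (mu t) = 0"
      by (simp_all add: e[OF t] w_def lor_simps nn l)
  qed
  with that[of k c] k(1) Apos root As show thesis unfolding e_def w_def by blast
qed

section \<open>Translation back to the invariants of the curve\<close>

theorem mainTheorem15:
  fixes I :: "real set" and g v1 v2 :: "real \<Rightarrow> real^4" and t0 th0 :: real
  assumes "open I" and "is_interval I"
    and "hyp_framed_curve I g v1 v2"
    and "\<forall>t\<in>I. (fc_a g v1 v2 t)\<^sup>2 + (fc_b g v1 v2 t)\<^sup>2 \<noteq> 0"
    and "\<forall>t\<in>I. (fr_M g v1 v2 t)\<^sup>2 > (fr_A g v1 v2 t)\<^sup>2"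
    and "\<forall>t\<in>I. fr_M g v1 v2 t * deriv (fr_A g v1 v2) t - deriv (fr_M g v1 v2) t * fr_A g v1 v2 t = 0"
    and "t0 \<in> I" and "th0 \<in> {0..2*pi}"
    and "singular_point (focal_dS g v1 v2) (t0, th0)"
  shows "(fr_N g v1 v2 t0 \<noteq> 0 \<longrightarrow>
            cuspidal_edge (focal_dS g v1 v2) (t0, th0) \<and>
            \<not> swallowtail (focal_dS g v1 v2) (t0, th0) \<and>
            \<not> cuspidal_cross_cap (focal_dS g v1 v2) (t0, th0))
       \<and> (fr_N g v1 v2 t0 = 0 \<longrightarrow>
            (cuspidal_edge (focal_dS g v1 v2) (t0, th0) \<longleftrightarrow>
               th0 \<notin> {0, pi, 2*pi} \<and>
               deriv (\<lambda>t. fr_A g v1 v2 t * fr_N g v1 v2 t *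
                          sqrt ((fr_M g v1 v2 t)\<^sup>2 - (fr_A g v1 v2 t)\<^sup>2)) t0 \<noteq> 0) \<and>
            \<not> cuspidal_beaks (focal_dS g v1 v2) (t0, th0) \<and>
            \<not> cuspidal_lips (focal_dS g v1 v2) (t0, th0) \<and>
            \<not> swallowtail (focal_dS g v1 v2) (t0, th0) \<and>
            \<not> cuspidal_cross_cap (focal_dS g v1 v2) (t0, th0))"
proof -
  obtain c k where k: "k > 0" and ff: "focal_frame I (\<lambda>t. (1 / sqrt ((fr_M g v1 v2 t)\<^sup>2 - (fr_A g v1 v2 t)\<^sup>2)) *\<^sub>R
        (fr_A g v1 v2 t *\<^sub>R g t - fr_M g v1 v2 t *\<^sub>R fr_n1 g v1 v2 t))
      (fr_n2 g v1 v2) (\<lambda>t. (1 / k) *\<^sub>R (c *\<^sub>R g t - fr_n1 g v1 v2 t)) (fc_mu g v1 v2)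
      (\<lambda>t. fr_N g v1 v2 t / k) (\<lambda>t. k * fr_A g v1 v2 t) c"
    and A: "\<And>t. t \<in> I \<Longrightarrow> fr_A g v1 v2 t > 0"
    and root: "\<And>t. t \<in> I \<Longrightarrow> sqrt ((fr_M g v1 v2 t)\<^sup>2 - (fr_A g v1 v2 t)\<^sup>2) = k * fr_A g v1 v2 t"
    and As: "smooth_on I (fr_A g v1 v2)"
    by (rule hyp_frame_imp_focal_frame[OF assms(1-7)]) (rule that)
  interpret focal_frame I "\<lambda>t. (1 / sqrt ((fr_M g v1 v2 t)\<^sup>2 - (fr_A g v1 v2 t)\<^sup>2)) *\<^sub>R
        (fr_A g v1 v2 t *\<^sub>R g t - fr_M g v1 v2 t *\<^sub>R fr_n1 g v1 v2 t)"
      "fr_n2 g v1 v2" "\<lambda>t. (1 / k) *\<^sub>R (c *\<^sub>R g t - fr_n1 g v1 v2 t)" "fc_mu g v1 v2"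
      "\<lambda>t. fr_N g v1 v2 t / k" "\<lambda>t. k * fr_A g v1 v2 t" c
    by (rule ff)
  have F: "F = focal_dS g v1 v2"
    by (simp add: fun_eq_iff F_def focal_dS_def)
  let ?kap = "\<lambda>t. fr_N g v1 v2 t / k"
  \<comment> \<open>On the closed range of angles the sine also vanishes at \<open>2 * pi\<close>,
    the same point of the circle as 0.\<close>
  have sin0: "sin th0 = 0 \<longleftrightarrow> th0 \<in> {0, pi, 2 * pi}"
  proof
    assume "sin th0 = 0"
    then obtain i :: int where i: "th0 = of_int i * pi" by (auto simp: sin_zero_iff_int2)
    then have "0 \<le> of_int i * pi" "of_int i * pi \<le> 2 * pi" using assms(8) by auto
    then have "0 \<le> i" "i \<le> 2" using pi_gt_zero by (auto simp: zero_le_mult_iff)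
    then have "i = 0 \<or> i = 1 \<or> i = 2" by auto
    then show "th0 \<in> {0, pi, 2 * pi}" using i by auto
  qed auto
  have kd: "deriv (\<lambda>t. fr_A g v1 v2 t * fr_N g v1 v2 t * sqrt ((fr_M g v1 v2 t)\<^sup>2 - (fr_A g v1 v2 t)\<^sup>2)) t0 \<noteq> 0 \<longleftrightarrow> deriv ?kap t0 \<noteq> 0"
    if N0: "fr_N g v1 v2 t0 = 0"
  proof -
    \<comment> \<open>The product in the theorem is \<open>(k A)^2 (N / k)\<close>; where
      \<open>N\<close> vanishes, only the derivative of the second factor survives.\<close>
    let ?P = "\<lambda>t. (k * fr_A g v1 v2 t)\<^sup>2"
    have "smooth_on I ?P" by (intro smooth_on_intros As I)
    from DERIV_mult[OF smooth_on_deriv(2)[OF I this assms(7)] smooth_on_deriv(2)[OF I smooth(4) assms(7)]]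
    have "((\<lambda>t. ?P t * ?kap t) has_real_derivative ?P t0 * deriv ?kap t0) (at t0)"
      using N0 by (simp add: mult.commute)
    then have "((\<lambda>t. fr_A g v1 v2 t * fr_N g v1 v2 t * sqrt ((fr_M g v1 v2 t)\<^sup>2 - (fr_A g v1 v2 t)\<^sup>2))
        has_real_derivative ?P t0 * deriv ?kap t0) (at t0)"
      by (rule has_field_derivative_transform_within_open[OF _ I assms(7)])
         (simp only: root, use k in \<open>simp add: power2_eq_square\<close>)
    from DERIV_imp_deriv[OF this] show ?thesis
      using k A[OF assms(7)] by simp
  qed
  have "k \<noteq> 0" using k by simp
  with classification[OF assms(7), unfolded F, OF assms(9)] kd sin0 show ?thesis by simp
qed

end
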